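(* Let $H_1,H_2:\mathbb R\to\mathbb R$ be continuous, quasi-convex and coercive, and let $A_I^\pm$, $\check F_A$ be defined as in the context. Then $A_I^-\le A_I^+$ and the following holds. (i) (Ishii sub-solution) Every Ishii sub-solution is a $\check F_{A_I^-}$-sub-solution. (ii) (Ishii super-solution) Every Ishii super-solution is a $\check F_{A_I^+}$-super-solution. (iii) (Particular Ishii solutions) Every $\check F_A$-solution is an Ishii solution if $A\in[A_I^-,A_I^+]$. (iv) (Maximal and minimal Ishii solutions) For a given uniformly continuous initial datum $g:\mathbb R\to\mathbb R$, the $\check F_{A_I^+}$-solution is the minimal Ishii solution with initial datum $g$, and the $\check F_{A_I^-}$-solution is the maximal Ishii solution with initial datum $g$. Moreover, the Ishii solution is unique (for every uniformly continuous initial datum) if and only if $A_I^+=A_I^-$.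
   Context: Quasi-convex: sub-level sets are convex; coercive: $H_i(p)\to+\infty$ as $|p|\to+\infty$. For $i=1,2$, $p_i^0$ is a point such that $H_i$ is nonincreasing on $(-\infty,p_i^0]$ and nondecreasing on $[p_i^0,+\infty)$. $H_i^-(q)=H_i(q)$ if $q<p_i^0$, $H_i^-(q)=H_i(p_i^0)$ if $q\ge p_i^0$; $H_i^+(q)=H_i(p_i^0)$ if $q\le p_i^0$, $H_i^+(q)=H_i(q)$ if $q>p_i^0$. Constants: $A_0=\max_{i=1,2}H_i(p_i^0)$; $A^*=\max\{\min(H_1(q),H_2(q)): q\in[\min(p_1^0,p_2^0),\max(p_1^0,p_2^0)]\}$; $A_I^+=\max(A^*,A_0)$; $A_I^-=A_I^+$ if $p_2^0<p_1^0$ and $A_I^-=A_0$ if $p_2^0\ge p_1^0$. (These do not depend on the choice of $p_i^0$.) All functions are defined on $[0,+\infty)\times\mathbb R$ and locally bounded; $u^*,u_*$ denote upper and lower semi-continuous envelopes. Sub-solution (resp. super-solution) inequalities are in the viscosity sense for $t>0$: they are required for test functions touching $u^*$ from above (resp. $u_*$ from below) locally at the point. Ishii sub-solution: with $C^1$ test functions on $(0,+\infty)\times\mathbb R$, $u_t+H_1(u_x)\le0$ for $x<0$, $u_t+H_2(u_x)\le0$ for $x>0$, and $u_t+\min(H_1(u_x),H_2(u_x))\le0$ at $x=0$. Ishii super-solution: $u_t+H_1(u_x)\ge0$ for $x<0$, $u_t+H_2(u_x)\ge0$ for $x>0$, $u_t+\max(H_1(u_x),H_2(u_x))\ge0$ at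 $x=0$. Ishii solution: both. $\check F_A$-sub-solution (resp. super-solution, solution), $A\in\mathbb R$: viscosity sub-solution (resp. super-solution, both) of $u_t+H_1(u_x)=0$ for $x<0$, $u_t+H_2(u_x)=0$ for $x>0$, $u_t+\check F_A(u_x(t,0^-),u_x(t,0^+))=0$ at $x=0$, where $\check F_A(q_1,q_2)=\max(A,H_1^+(q_1),H_2^-(q_2))$ and test functions are continuous on $(0,+\infty)\times\mathbb R$ and $C^1$ on $(0,+\infty)\times(-\infty,0]$ and on $(0,+\infty)\times[0,+\infty)$. A (sub/super-)solution has initial datum $g$ if $u^*(0,\cdot)\le g$ (sub-solution), $u_*(0,\cdot)\ge g$ (super-solution), both (solution). Solutions with initial datum $g$ are considered in the class of functions with at most linear growth: for each $T>0$ there is $C_T$ with $|u(t,x)|\le C_T(1+|x|)$ on $[0,T)\times\mathbb R$. "The $\check F_A$-solution" with initial datum $g$ is the unique one in this class. Minimal/maximal means $\le$/$\ge$ every other Ishii solution with initial datum $g$ in this class. *)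

theory Defs
  imports "HOL-Analysis.Analysis"
begin

section \<open>Hamiltonians and flux limiters\<close>

definition quasi_convex :: "(real \<Rightarrow> real) \<Rightarrow> bool" where
  "quasi_convex H \<longleftrightarrow> (\<forall>c. convex {q. H q \<le> c})"

definition coercive :: "(real \<Rightarrow> real) \<Rightarrow> bool" where
  "coercive H \<longleftrightarrow> filterlim H at_top at_infinity"

definition turning_point :: "(real \<Rightarrow> real) \<Rightarrow> real \<Rightarrow> bool" where
  "turning_point H p \<longleftrightarrow> antimono_on {..p} H \<and> mono_on {p..} H"

definition H_minus :: "(real \<Rightarrow> real) \<Rightarrow> real \<Rightarrow> real \<Rightarrow> real" where
  "H_minus H p q = (if q < p then H q else H p)"

definition H_plus :: "(real \<Rightarrow> real) \<Rightarrow> real \<Rightarrow> real \<Rightarrow> real" where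
  "H_plus H p q = (if q \<le> p then H p else H q)"

definition A_zero :: "(real \<Rightarrow> real) \<Rightarrow> (real \<Rightarrow> real) \<Rightarrow> real \<Rightarrow> real \<Rightarrow> real" where
  "A_zero H1 H2 p1 p2 = max (H1 p1) (H2 p2)"

text \<open>A supremum over a nonempty compact interval; it is a maximum when \<open>H1\<close> and \<open>H2\<close> are
  continuous.\<close>
definition A_star :: "(real \<Rightarrow> real) \<Rightarrow> (real \<Rightarrow> real) \<Rightarrow> real \<Rightarrow> real \<Rightarrow> real" where
  "A_star H1 H2 p1 p2 = (SUP q\<in>{min p1 p2..max p1 p2}. min (H1 q) (H2 q))"

definition AI_plus :: "(real \<Rightarrow> real) \<Rightarrow> (real \<Rightarrow> real) \<Rightarrow> real \<Rightarrow> real \<Rightarrow> real" where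
  "AI_plus H1 H2 p1 p2 = max (A_star H1 H2 p1 p2) (A_zero H1 H2 p1 p2)"

definition AI_minus :: "(real \<Rightarrow> real) \<Rightarrow> (real \<Rightarrow> real) \<Rightarrow> real \<Rightarrow> real \<Rightarrow> real" where
  "AI_minus H1 H2 p1 p2 = (if p2 < p1 then AI_plus H1 H2 p1 p2 else A_zero H1 H2 p1 p2)"

definition flux ::
  "(real \<Rightarrow> real) \<Rightarrow> (real \<Rightarrow> real) \<Rightarrow> real \<Rightarrow> real \<Rightarrow> real \<Rightarrow> real \<Rightarrow> real \<Rightarrow> real" where
  "flux H1 H2 p1 p2 A q1 q2 = max A (max (H_plus H1 p1 q1) (H_minus H2 p2 q2))"

section \<open>Functions on the closed half-plane and their envelopes\<close>

text \<open>A point is a pair (time, space). Functions are total on \<^typ>\<open>real \<times> real\<close>; every notion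
  below looks only at their values on \<open>half_plane\<close>.\<close>

definition half_plane :: "(real \<times> real) set" where
  "half_plane = {0..} \<times> UNIV"

definition locally_bounded :: "(real \<times> real \<Rightarrow> real) \<Rightarrow> bool" where
  "locally_bounded u \<longleftrightarrow> (\<forall>z\<in>half_plane. \<exists>r>0. bounded (u ` (ball z r \<inter> half_plane)))"

text \<open>The filter of neighbourhoods of \<open>z\<close> relative to \<open>half_plane\<close> contains \<open>z\<close> itself, unlike
  \<open>at z within half_plane\<close>, so that \<open>lower_env u z \<le> u z \<le> upper_env u z\<close>. The passage through
  \<^typ>\<open>ereal\<close> loses nothing for locally bounded functions.\<close>

definition upper_env :: "(real \<times> real \<Rightarrow> real) \<Rightarrow> real \<times> real \<Rightarrow> real" where
  "upper_env u z = real_of_ereal (Limsup (inf (nhds z) (principal half_plane)) (\<lambda>w. ereal (u w)))"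

definition lower_env :: "(real \<times> real \<Rightarrow> real) \<Rightarrow> real \<times> real \<Rightarrow> real" where
  "lower_env u z = real_of_ereal (Liminf (inf (nhds z) (principal half_plane)) (\<lambda>w. ereal (u w)))"

section \<open>Test functions\<close>

text \<open>\<open>\<phi>\<close> is continuously differentiable on \<open>S\<close> with gradient \<open>G = (\<phi>\<^sub>t, \<phi>\<^sub>x)\<close>, the derivative being
  taken relative to \<open>S\<close>. On the three sets used below the gradient is unique, including at the
  boundary points of the two closed sides, where its second component is the one-sided space
  derivative.\<close>
definition C1_on :: "(real \<times> real) set \<Rightarrow> (real \<times> real \<Rightarrow> real) \<Rightarrow> (real \<times> real \<Rightarrow> real \<times> real) \<Rightarrow> bool"
  where "C1_on S \<phi> G \<longleftrightarrow>
    continuous_on S G \<and> (\<forall>z\<in>S. (\<phi> has_derivative (\<lambda>h. G z \<bullet> h)) (at z within S))"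

definition touches_above :: "(real \<times> real \<Rightarrow> real) \<Rightarrow> (real \<times> real \<Rightarrow> real) \<Rightarrow> real \<times> real \<Rightarrow> bool"
  where "touches_above \<phi> w z \<longleftrightarrow> \<phi> z = w z \<and> (\<forall>\<^sub>F y in nhds z. w y \<le> \<phi> y)"

definition touches_below :: "(real \<times> real \<Rightarrow> real) \<Rightarrow> (real \<times> real \<Rightarrow> real) \<Rightarrow> real \<times> real \<Rightarrow> bool"
  where "touches_below \<phi> w z \<longleftrightarrow> \<phi> z = w z \<and> (\<forall>\<^sub>F y in nhds z. \<phi> y \<le> w y)"

section \<open>Ishii solutions\<close>

definition ishii_subsol ::
  "(real \<Rightarrow> real) \<Rightarrow> (real \<Rightarrow> real) \<Rightarrow> (real \<times> real \<Rightarrow> real) \<Rightarrow> bool" where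
  "ishii_subsol H1 H2 u \<longleftrightarrow> locally_bounded u \<and>
    (\<forall>\<phi> G t x. C1_on ({0<..} \<times> UNIV) \<phi> G \<and> 0 < t \<and> touches_above \<phi> (upper_env u) (t, x) \<longrightarrow>
      (let \<phi>t = fst (G (t, x)); \<phi>x = snd (G (t, x)) in
        (x < 0 \<longrightarrow> \<phi>t + H1 \<phi>x \<le> 0) \<and>
        (0 < x \<longrightarrow> \<phi>t + H2 \<phi>x \<le> 0) \<and>
        (x = 0 \<longrightarrow> \<phi>t + min (H1 \<phi>x) (H2 \<phi>x) \<le> 0)))"

definition ishii_supersol ::
  "(real \<Rightarrow> real) \<Rightarrow> (real \<Rightarrow> real) \<Rightarrow> (real \<times> real \<Rightarrow> real) \<Rightarrow> bool" where
  "ishii_supersol H1 H2 u \<longleftrightarrow> locally_bounded u \<and>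
    (\<forall>\<phi> G t x. C1_on ({0<..} \<times> UNIV) \<phi> G \<and> 0 < t \<and> touches_below \<phi> (lower_env u) (t, x) \<longrightarrow>
      (let \<phi>t = fst (G (t, x)); \<phi>x = snd (G (t, x)) in
        (x < 0 \<longrightarrow> \<phi>t + H1 \<phi>x \<ge> 0) \<and>
        (0 < x \<longrightarrow> \<phi>t + H2 \<phi>x \<ge> 0) \<and>
        (x = 0 \<longrightarrow> \<phi>t + max (H1 \<phi>x) (H2 \<phi>x) \<ge> 0)))"

definition ishii_sol ::
  "(real \<Rightarrow> real) \<Rightarrow> (real \<Rightarrow> real) \<Rightarrow> (real \<times> real \<Rightarrow> real) \<Rightarrow> bool" where
  "ishii_sol H1 H2 u \<longleftrightarrow> ishii_subsol H1 H2 u \<and> ishii_supersol H1 H2 u"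

section \<open>Solutions with a junction condition\<close>

text \<open>The test functions are \<open>C\<^sup>1\<close> up to \<open>x = 0\<close> on each side, with gradients \<open>GL\<close> and \<open>GR\<close>. At
  \<open>x = 0\<close> the time derivatives \<open>fst GL\<close> and \<open>fst GR\<close> coincide, both being the derivative of
  \<open>t \<mapsto> \<phi>(t, 0)\<close>.\<close>

definition junction_test ::
  "(real \<times> real \<Rightarrow> real) \<Rightarrow> (real \<times> real \<Rightarrow> real \<times> real) \<Rightarrow> (real \<times> real \<Rightarrow> real \<times> real) \<Rightarrow> bool" where
  "junction_test \<phi> GL GR \<longleftrightarrow> continuous_on ({0<..} \<times> UNIV) \<phi> \<and>
    C1_on ({0<..} \<times> {..0}) \<phi> GL \<and> C1_on ({0<..} \<times> {0..}) \<phi> GR"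

definition junction_subsol ::
  "(real \<Rightarrow> real) \<Rightarrow> (real \<Rightarrow> real) \<Rightarrow> (real \<Rightarrow> real \<Rightarrow> real) \<Rightarrow> (real \<times> real \<Rightarrow> real) \<Rightarrow> bool" where
  "junction_subsol H1 H2 F u \<longleftrightarrow> locally_bounded u \<and>
    (\<forall>\<phi> GL GR t x. junction_test \<phi> GL GR \<and> 0 < t \<and> touches_above \<phi> (upper_env u) (t, x) \<longrightarrow>
      (x < 0 \<longrightarrow> fst (GL (t, x)) + H1 (snd (GL (t, x))) \<le> 0) \<and>
      (0 < x \<longrightarrow> fst (GR (t, x)) + H2 (snd (GR (t, x))) \<le> 0) \<and>
      (x = 0 \<longrightarrow> fst (GL (t, 0)) + F (snd (GL (t, 0))) (snd (GR (t, 0))) \<le> 0))"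

definition junction_supersol ::
  "(real \<Rightarrow> real) \<Rightarrow> (real \<Rightarrow> real) \<Rightarrow> (real \<Rightarrow> real \<Rightarrow> real) \<Rightarrow> (real \<times> real \<Rightarrow> real) \<Rightarrow> bool" where
  "junction_supersol H1 H2 F u \<longleftrightarrow> locally_bounded u \<and>
    (\<forall>\<phi> GL GR t x. junction_test \<phi> GL GR \<and> 0 < t \<and> touches_below \<phi> (lower_env u) (t, x) \<longrightarrow>
      (x < 0 \<longrightarrow> fst (GL (t, x)) + H1 (snd (GL (t, x))) \<ge> 0) \<and>
      (0 < x \<longrightarrow> fst (GR (t, x)) + H2 (snd (GR (t, x))) \<ge> 0) \<and>
      (x = 0 \<longrightarrow> fst (GL (t, 0)) + F (snd (GL (t, 0))) (snd (GR (t, 0))) \<ge> 0))"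

definition junction_sol ::
  "(real \<Rightarrow> real) \<Rightarrow> (real \<Rightarrow> real) \<Rightarrow> (real \<Rightarrow> real \<Rightarrow> real) \<Rightarrow> (real \<times> real \<Rightarrow> real) \<Rightarrow> bool" where
  "junction_sol H1 H2 F u \<longleftrightarrow> junction_subsol H1 H2 F u \<and> junction_supersol H1 H2 F u"

section \<open>The Cauchy problem\<close>

definition has_initial_datum :: "(real \<times> real \<Rightarrow> real) \<Rightarrow> (real \<Rightarrow> real) \<Rightarrow> bool" where
  "has_initial_datum u g \<longleftrightarrow> (\<forall>x. upper_env u (0, x) \<le> g x \<and> g x \<le> lower_env u (0, x))"

definition linear_growth :: "(real \<times> real \<Rightarrow> real) \<Rightarrow> bool" where
  "linear_growth u \<longleftrightarrow>
    (\<forall>T>0. \<exists>C. \<forall>t x. 0 \<le> t \<and> t < T \<longrightarrow> \<bar>u (t, x)\<bar> \<le> C * (1 + \<bar>x\<bar>))"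

definition ishii_cauchy ::
  "(real \<Rightarrow> real) \<Rightarrow> (real \<Rightarrow> real) \<Rightarrow> (real \<Rightarrow> real) \<Rightarrow> (real \<times> real \<Rightarrow> real) \<Rightarrow> bool" where
  "ishii_cauchy H1 H2 g u \<longleftrightarrow> ishii_sol H1 H2 u \<and> has_initial_datum u g \<and> linear_growth u"

definition junction_cauchy ::
  "(real \<Rightarrow> real) \<Rightarrow> (real \<Rightarrow> real) \<Rightarrow> (real \<Rightarrow> real \<Rightarrow> real) \<Rightarrow> (real \<Rightarrow> real) \<Rightarrow>
    (real \<times> real \<Rightarrow> real) \<Rightarrow> bool" where
  "junction_cauchy H1 H2 F g u \<longleftrightarrow>
    junction_sol H1 H2 F u \<and> has_initial_datum u g \<and> linear_growth u"

text \<open>\<open>u\<close> is the only function on \<open>half_plane\<close> with property \<open>P\<close>.\<close>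
definition is_the_only ::
  "((real \<times> real \<Rightarrow> real) \<Rightarrow> bool) \<Rightarrow> (real \<times> real \<Rightarrow> real) \<Rightarrow> bool" where
  "is_the_only P u \<longleftrightarrow> P u \<and> (\<forall>v. P v \<longrightarrow> (\<forall>z\<in>half_plane. v z = u z))"

definition minimal_ishii ::
  "(real \<Rightarrow> real) \<Rightarrow> (real \<Rightarrow> real) \<Rightarrow> (real \<Rightarrow> real) \<Rightarrow> (real \<times> real \<Rightarrow> real) \<Rightarrow> bool" where
  "minimal_ishii H1 H2 g u \<longleftrightarrow> ishii_cauchy H1 H2 g u \<and>
    (\<forall>v. ishii_cauchy H1 H2 g v \<longrightarrow> (\<forall>z\<in>half_plane. u z \<le> v z))"

definition maximal_ishii ::
  "(real \<Rightarrow> real) \<Rightarrow> (real \<Rightarrow> real) \<Rightarrow> (real \<Rightarrow> real) \<Rightarrow> (real \<times> real \<Rightarrow> real) \<Rightarrow> bool" where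
  "maximal_ishii H1 H2 g u \<longleftrightarrow> ishii_cauchy H1 H2 g u \<and>
    (\<forall>v. ishii_cauchy H1 H2 g v \<longrightarrow> (\<forall>z\<in>half_plane. v z \<le> u z))"

end

theory Submission
  imports Defs
begin

text \<open>
  A super-solution of a Hamilton-Jacobi equation on one side of a point cannot leave the point with
  a slope at which the equation is strictly violated. Hence, if a test function with a kink at the
  junction touches a super-solution from below, its slopes, counted away from the junction, may be
  increased for as long as the equation stays violated (\<open>steepen_super\<close>), and
  symmetrically for sub-solutions (\<open>steepen_sub\<close>). If the slopes on both sides can be
  moved to a common value \<open>p\<close>, a \<open>C\<^sup>1\<close> test function of slope
  \<open>p\<close> touches. Which slopes can be reached is a question about the sublevel sets of
  the two Hamiltonians; its answer is that a violation of the junction condition for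
  \<open>Aplus\<close> or \<open>Aminus\<close> leads to a violation of the Ishii condition
  (\<open>super_flux_Aplus\<close>, \<open>sub_flux_Aminus\<close>). This gives the first two
  claims. The third one compares the flux at two equal slopes with the two Hamiltonians
  (\<open>min_le_flux\<close>, \<open>flux_le_max\<close>).

  For the extremal solutions one needs comparison for the junction problem with a limiter
  \<open>A \<ge> A0\<close> (\<open>comparison\<close>). Only the time variable is doubled. At a
  maximum point of the penalized difference, the equation for the sub-solution \<open>U\<close>
  confines its slopes to a sublevel set of the Hamiltonian. The super-solution \<open>V\<close>
  lies above \<open>U\<close> up to the penalty and inherits one-sided bounds for its slopes
  (\<open>V_slope\<close>). At the junction these bounds lie on the branches that the flux sees, so
  the flux at the two bounds does not exceed the level of the sublevel set, and a kinked test
  function with these slopes contradicts the condition for \<open>V\<close>. Elsewhere the slopes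
  are first moved to the minimum point of the Hamiltonian. The maximum exists because both
  functions stay close to the initial datum, \<open>U \<le> g + c t\<close> and
  \<open>V \<ge> g - \<epsilon> - c t\<close> with \<open>c\<close> depending on
  \<open>\<epsilon>\<close> in the second bound (\<open>upper_barrier\<close>,
  \<open>lower_barrier\<close>).

  Existence for the junction problem follows from Perron's method (\<open>perron\<close>). By the
  first two claims, every Ishii solution is a sub-solution of the junction problem for
  \<open>Aminus\<close> and a super-solution of the one for \<open>Aplus\<close>, so comparison
  squeezes it between the two junction solutions, which are Ishii solutions by the third claim. If
  the limiters agree, the Ishii solution is therefore unique. If they differ, a wedge with slopes
  on the branches that the flux does not see solves the junction problem for \<open>Aplus\<close>
  and not the one for \<open>Aminus\<close> (\<open>wedge_solution\<close>), so the two extremal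
  Ishii solutions with its initial datum are different.
\<close>

section \<open>Hamiltonians and limited fluxes\<close>

locale hamiltonian =
  fixes H :: "real \<Rightarrow> real" and p :: real
  assumes continuous: "continuous_on UNIV H"
    and coercive: "coercive H"
    and turning: "turning_point H p"
begin

lemma decreasing: "a \<le> b \<Longrightarrow> b \<le> p \<Longrightarrow> H b \<le> H a"
  using turning unfolding turning_point_def by (auto simp: monotone_on_def)

lemma increasing: "p \<le> a \<Longrightarrow> a \<le> b \<Longrightarrow> H a \<le> H b"
  using turning unfolding turning_point_def by (auto simp: monotone_on_def)

lemma minimal: "H p \<le> H q"
  using decreasing[of q p] increasing[of p q] by linarith

lemma large_outside: obtains R where "R > 0" "\<And>q. R \<le> \<bar>q\<bar> \<Longrightarrow> c < H q"
proof -
  have "eventually (\<lambda>q. c < H q) at_infinity"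
    using coercive unfolding coercive_def filterlim_at_top_dense by blast
  then obtain b where "\<forall>q. b \<le> norm q \<longrightarrow> c < H q"
    unfolding eventually_at_infinity by blast
  then show ?thesis using that[of "max b 1"] by auto
qed

lemma level_left:
  assumes "H p \<le> c" obtains q where "q \<le> p" "H q = c"
proof -
  obtain R where R: "R > 0" "\<And>q. R \<le> \<bar>q\<bar> \<Longrightarrow> c < H q" using large_outside[of c] by metis
  have "c \<le> H (p - (\<bar>p\<bar> + R))" using R(1) R(2)[of "p - (\<bar>p\<bar> + R)"] by linarith
  moreover have "p - (\<bar>p\<bar> + R) \<le> p" using R(1) by linarith
  ultimately obtain q where "p - (\<bar>p\<bar> + R) \<le> q" "q \<le> p" "H q = c"
    using IVT2'[of H p c "p - (\<bar>p\<bar> + R)"] assms continuous continuous_on_subset by blast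
  then show ?thesis using that by blast
qed

lemma level_right:
  assumes "H p \<le> c" obtains q where "p \<le> q" "H q = c"
proof -
  obtain R where R: "R > 0" "\<And>q. R \<le> \<bar>q\<bar> \<Longrightarrow> c < H q" using large_outside[of c] by metis
  have "c \<le> H (p + (\<bar>p\<bar> + R))" using R(1) R(2)[of "p + (\<bar>p\<bar> + R)"] by linarith
  moreover have "p \<le> p + (\<bar>p\<bar> + R)" using R(1) by linarith
  ultimately obtain q where "p \<le> q" "q \<le> p + (\<bar>p\<bar> + R)" "H q = c"
    using IVT'[of H p c "p + (\<bar>p\<bar> + R)"] assms continuous continuous_on_subset by blast
  then show ?thesis using that by blast
qed

lemma H_minus_eq: "H_minus H p q = H (min q p)"
  by (auto simp: H_minus_def min_def)

lemma H_plus_eq: "H_plus H p q = H (max q p)"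
  by (auto simp: H_plus_def max_def)

lemma H_minus_antimono: "a \<le> b \<Longrightarrow> H_minus H p b \<le> H_minus H p a"
  unfolding H_minus_eq by (intro decreasing) auto

lemma H_plus_mono: "a \<le> b \<Longrightarrow> H_plus H p a \<le> H_plus H p b"
  unfolding H_plus_eq by (intro increasing) auto

lemma H_minus_bounds: "H p \<le> H_minus H p q" "H_minus H p q \<le> H q"
  by (auto simp: H_minus_def minimal)

lemma H_plus_bounds: "H p \<le> H_plus H p q" "H_plus H p q \<le> H q"
  by (auto simp: H_plus_def minimal)

text \<open>Uniform continuity on a bounded range of slopes, in the form in which a small perturbation of
  the slopes is absorbed by a strict inequality.\<close>
lemma perturb_slope:
  assumes "e > 0"
  obtains d where "d > 0" "\<And>q q'. H q \<le> c \<Longrightarrow> \<bar>q' - q\<bar> \<le> d \<Longrightarrow> H q' < H q + e"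
proof -
  obtain R where R: "R > 0" "\<And>q. R \<le> \<bar>q\<bar> \<Longrightarrow> c < H q" using large_outside[of c] by metis
  have "uniformly_continuous_on (cball 0 (R + 1)) H"
    by (intro compact_uniformly_continuous continuous_on_subset[OF continuous]) auto
  then obtain d where d: "d > 0"
    "\<And>x y. x \<in> cball 0 (R+1) \<Longrightarrow> y \<in> cball 0 (R+1) \<Longrightarrow> dist y x < d \<Longrightarrow> dist (H y) (H x) < e"
    using assms unfolding uniformly_continuous_on_def by metis
  show ?thesis
  proof (rule that[of "min (d/2) 1"])
    fix q q' assume q: "H q \<le> c" "\<bar>q' - q\<bar> \<le> min (d/2) 1"
    have "\<bar>q\<bar> < R" using R(2)[of q] q(1) by (cases "R \<le> \<bar>q\<bar>") auto
    then have "dist (H q') (H q) < e"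
      using q(2) d(1) by (intro d(2)) (auto simp: dist_real_def)
    then show "H q' < H q + e" by (auto simp: dist_real_def)
  qed (use d in auto)
qed

lemma bounded_slopes_bound:
  obtains C where "\<And>q. \<bar>q\<bar> \<le> L \<Longrightarrow> H q \<le> C"
proof -
  have "bounded (H ` cball 0 L)"
    by (intro compact_imp_bounded compact_continuous_image continuous_on_subset[OF continuous]) auto
  then obtain C where "\<forall>q\<in>cball 0 L. \<bar>H q\<bar> \<le> C" by (auto simp: bounded_iff)
  then show ?thesis by (intro that[of C]) (force simp: abs_le_iff)
qed

end

locale junction =
  fixes H1 H2 :: "real \<Rightarrow> real" and p1 p2 :: real
  assumes H1: "hamiltonian H1 p1" and H2: "hamiltonian H2 p2"
begin

sublocale H1: hamiltonian H1 p1 by (rule H1)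
sublocale H2: hamiltonian H2 p2 by (rule H2)

abbreviation "F \<equiv> flux H1 H2 p1 p2"
abbreviation "A0 \<equiv> A_zero H1 H2 p1 p2"
abbreviation "Astar \<equiv> A_star H1 H2 p1 p2"
abbreviation "Aplus \<equiv> AI_plus H1 H2 p1 p2"
abbreviation "Aminus \<equiv> AI_minus H1 H2 p1 p2"

lemma flux_ge: "A \<le> F A q1 q2" "H1 p1 \<le> F A q1 q2" "H2 p2 \<le> F A q1 q2"
    "H_plus H1 p1 q1 \<le> F A q1 q2" "H_minus H2 p2 q2 \<le> F A q1 q2"
  using H1.H_plus_bounds(1)[of q1] H2.H_minus_bounds(1)[of q2] by (auto simp: flux_def)

lemma flux_less_iff:
  "F A q1 q2 < c \<longleftrightarrow> A < c \<and> H_plus H1 p1 q1 < c \<and> H_minus H2 p2 q2 < c"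
  by (auto simp: flux_def)

lemma flux_le_iff:
  "F A q1 q2 \<le> c \<longleftrightarrow> A \<le> c \<and> H_plus H1 p1 q1 \<le> c \<and> H_minus H2 p2 q2 \<le> c"
  by (auto simp: flux_def)

lemma flux_mono: "q1 \<le> q1' \<Longrightarrow> q2' \<le> q2 \<Longrightarrow> F A q1 q2 \<le> F A q1' q2'"
  using H1.H_plus_mono[of q1 q1'] H2.H_minus_antimono[of q2' q2] unfolding flux_def by linarith

lemma continuous_flux:
  assumes "continuous_on S f" "continuous_on S g"
  shows "continuous_on S (\<lambda>z. F A (f z) (g z))"
proof -
  have *: "continuous_on S (\<lambda>z. H1 (max (f z) p1))" "continuous_on S (\<lambda>z. H2 (min (g z) p2))"
    using assms
    by (auto intro!: continuous_on_compose2[OF H1.continuous] continuous_on_compose2[OF H2.continuous]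
        continuous_intros)
  show ?thesis unfolding flux_def H1.H_plus_eq H2.H_minus_eq
    by (intro continuous_intros *)
qed

lemma A0_le_Aminus: "A0 \<le> Aminus" and Aminus_le_Aplus: "Aminus \<le> Aplus"
  by (auto simp: AI_minus_def AI_plus_def)

lemma A0_le: "H1 p1 \<le> A0" "H2 p2 \<le> A0"
  by (auto simp: A_zero_def)

lemma A_star_attained:
  obtains q where "min p1 p2 \<le> q" "q \<le> max p1 p2" "Astar = min (H1 q) (H2 q)"
    and "\<And>q'. min p1 p2 \<le> q' \<Longrightarrow> q' \<le> max p1 p2 \<Longrightarrow> min (H1 q') (H2 q') \<le> Astar"
proof -
  let ?I = "{min p1 p2..max p1 p2}"
  have "continuous_on ?I (\<lambda>q. min (H1 q) (H2 q))"
    by (intro continuous_intros continuous_on_subset[OF H1.continuous] continuous_on_subset[OF H2.continuous]) auto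
  moreover have "compact ?I" "?I \<noteq> {}" by auto
  ultimately obtain q where q: "q \<in> ?I" "\<And>q'. q' \<in> ?I \<Longrightarrow> min (H1 q') (H2 q') \<le> min (H1 q) (H2 q)"
    using continuous_attains_sup[of ?I "\<lambda>q. min (H1 q) (H2 q)"] by blast
  have "Astar = min (H1 q) (H2 q)"
    unfolding A_star_def by (intro cSup_eq_maximum) (use q in \<open>auto simp del: atLeastAtMost_iff\<close>)
  then show ?thesis using q by (intro that[of q]) auto
qed

text \<open>Above \<open>Aplus\<close> the open sublevel sets of \<open>H1\<close> and \<open>H2\<close> cover the interval between the two
  turning points, and each of them contains one end. The interval being connected, they meet.\<close>
lemma common_sublevel:
  assumes B: "Aplus < B"
  obtains q where "H1 q < B" "H2 q < B"
proof -
  have B0: "H1 p1 < B" "H2 p2 < B" "Astar < B" using B by (auto simp: AI_plus_def A_zero_def)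
  let ?I = "{min p1 p2..max p1 p2}"
  have star: "min (H1 q) (H2 q) < B" if "q \<in> ?I" for q
    using A_star_attained that B0(3) by (metis le_less_trans atLeastAtMost_iff)
  have "\<exists>q. H1 q < B \<and> H2 q < B"
  proof (rule ccontr)
    assume none: "\<nexists>q. H1 q < B \<and> H2 q < B"
    have "open {q. H1 q < B}" "open {q. H2 q < B}"
      by (intro open_Collect_less H1.continuous H2.continuous continuous_on_const)+
    moreover have "connected ?I" by simp
    moreover have "{q. H1 q < B} \<inter> {q. H2 q < B} \<inter> ?I = {}" using none by auto
    moreover have "?I \<subseteq> {q. H1 q < B} \<union> {q. H2 q < B}" using star unfolding min_less_iff_disj by blast
    ultimately have "{q. H1 q < B} \<inter> ?I = {} \<or> {q. H2 q < B} \<inter> ?I = {}" by (meson connectedD)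
    then show False using B0 by fastforce
  qed
  then show ?thesis using that by blast
qed

end

section \<open>Semicontinuity and envelopes\<close>

text \<open>Upper semicontinuity relative to a set. Lower semicontinuity of \<open>f\<close> is expressed as upper
  semicontinuity of \<open>- f\<close>.\<close>
definition usc_on :: "'a::metric_space set \<Rightarrow> ('a \<Rightarrow> real) \<Rightarrow> bool" where
  "usc_on S f \<longleftrightarrow> (\<forall>z\<in>S. \<forall>c>f z. \<exists>r>0. \<forall>w\<in>ball z r \<inter> S. f w < c)"

lemma usc_onD:
  assumes "usc_on S f" "z \<in> S" "f z < c"
  obtains r where "r > 0" "\<And>w. w \<in> S \<Longrightarrow> dist z w < r \<Longrightarrow> f w < c"
  using assms unfolding usc_on_def by (metis Int_iff mem_ball)

lemma usc_onI:
  assumes "\<And>z c. z \<in> S \<Longrightarrow> f z < c \<Longrightarrow> \<exists>r>0. \<forall>w\<in>S. dist z w < r \<longrightarrow> f w < c"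
  shows "usc_on S f"
  using assms unfolding usc_on_def by (metis Int_iff mem_ball)

lemma continuous_imp_usc_on:
  fixes f :: "'a::metric_space \<Rightarrow> real"
  assumes "continuous_on S f" shows "usc_on S f"
proof (rule usc_onI)
  fix z c assume z: "z \<in> S" "f z < c"
  then obtain d where "d > 0" "\<forall>w\<in>S. dist w z < d \<longrightarrow> dist (f w) (f z) < c - f z"
    using assms unfolding continuous_on_iff by (metis diff_gt_0_iff_gt)
  then show "\<exists>r>0. \<forall>w\<in>S. dist z w < r \<longrightarrow> f w < c"
    by (intro exI[of _ d]) (force simp: dist_real_def dist_commute)
qed

lemma usc_on_subset: "usc_on S f \<Longrightarrow> T \<subseteq> S \<Longrightarrow> usc_on T f"
  by (rule usc_onI) (meson subsetD usc_onD)

lemma usc_on_add: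
  assumes "usc_on S f" "usc_on S g" shows "usc_on S (\<lambda>z. f z + g z)"
proof (rule usc_onI)
  fix z c assume z: "z \<in> S" "f z + g z < c"
  define e where "e = (c - (f z + g z)) / 2"
  have e: "e > 0" using z by (auto simp: e_def)
  obtain r where r: "r > 0" "\<And>w. w \<in> S \<Longrightarrow> dist z w < r \<Longrightarrow> f w < f z + e"
    using usc_onD[OF assms(1) z(1), of "f z + e"] e by auto
  obtain s where s: "s > 0" "\<And>w. w \<in> S \<Longrightarrow> dist z w < s \<Longrightarrow> g w < g z + e"
    using usc_onD[OF assms(2) z(1), of "g z + e"] e by auto
  have *: "f w + g w < c" if "w \<in> S" "dist z w < min r s" for w
  proof -
    have "f w < f z + e" "g w < g z + e" using r(2)[of w] s(2)[of w] that by auto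
    then show ?thesis by (simp add: e_def field_simps)
  qed
  then show "\<exists>r>0. \<forall>w\<in>S. dist z w < r \<longrightarrow> f w + g w < c"
    by (intro exI[of _ "min r s"]) (use r(1) s(1) * in simp)
qed

lemma usc_on_compose:
  assumes f: "usc_on S f" and m: "continuous_on T m" "m ` T \<subseteq> S"
  shows "usc_on T (\<lambda>z. f (m z))"
proof (rule usc_onI)
  fix z c assume z: "z \<in> T" "f (m z) < c"
  then have "m z \<in> S" using m by auto
  then obtain r where r: "r > 0" "\<And>w. w \<in> S \<Longrightarrow> dist (m z) w < r \<Longrightarrow> f w < c"
    using usc_onD[OF f] z by metis
  obtain d where "d > 0" "\<forall>w\<in>T. dist w z < d \<longrightarrow> dist (m w) (m z) < r"
    using m(1) z(1) r(1) unfolding continuous_on_iff by metis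
  then show "\<exists>r>0. \<forall>w\<in>T. dist z w < r \<longrightarrow> f (m w) < c"
    using r m(2) by (intro exI[of _ d]) (auto simp: dist_commute)
qed

lemma usc_on_max:
  assumes "usc_on S f" "usc_on S g" shows "usc_on S (\<lambda>z. max (f z) (g z))"
proof (rule usc_onI)
  fix z c assume z: "z \<in> S" "max (f z) (g z) < c"
  obtain r where r: "r > 0" "\<And>w. w \<in> S \<Longrightarrow> dist z w < r \<Longrightarrow> f w < c"
    using usc_onD[OF assms(1) z(1), of c] z by auto
  obtain s where s: "s > 0" "\<And>w. w \<in> S \<Longrightarrow> dist z w < s \<Longrightarrow> g w < c"
    using usc_onD[OF assms(2) z(1), of c] z by auto
  show "\<exists>r>0. \<forall>w\<in>S. dist z w < r \<longrightarrow> max (f w) (g w) < c"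
    using r s by (intro exI[of _ "min r s"]) auto
qed

lemma usc_on_attains_max:
  assumes f: "usc_on S f" and S: "compact S" "S \<noteq> {}"
  obtains z where "z \<in> S" "\<And>w. w \<in> S \<Longrightarrow> f w \<le> f z"
proof -
  have "\<exists>z\<in>S. \<forall>w\<in>S. f w \<le> f z"
  proof (rule ccontr)
    assume "\<not> ?thesis"
    then have "\<exists>w. w \<in> S \<and> f z < f w" if "z \<in> S" for z using that by force
    then obtain b where b: "\<And>z. z \<in> S \<Longrightarrow> b z \<in> S \<and> f z < f (b z)" by metis
    have "\<exists>r>0. \<forall>w\<in>S. dist z w < r \<longrightarrow> f w < f (b z)" if "z \<in> S" for z
      using usc_onD[OF f that, of "f (b z)"] b[OF that] by metis
    then obtain r where r: "\<And>z. z \<in> S \<Longrightarrow> r z > 0 \<and> (\<forall>w\<in>S. dist z w < r z \<longrightarrow> f w < f (b z))"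
      by metis
    \<comment> \<open>Finitely many of the balls on which \<open>f < f (b z)\<close> cover \<open>S\<close>; a largest of the
      corresponding values \<open>f (b z)\<close> is attained in \<open>S\<close>, so it exceeds itself.\<close>
    have "S \<subseteq> (\<Union>z\<in>S. ball z (r z))" using r by force
    then obtain C where C: "C \<subseteq> S" "finite C" "S \<subseteq> (\<Union>z\<in>C. ball z (r z))"
      using compactE_image[OF S(1), of S "\<lambda>z. ball z (r z)"] by auto
    have "C \<noteq> {}" using C(3) S(2) by auto
    define m where "m = Max ((\<lambda>y. f (b y)) ` C)"
    have "m \<in> (\<lambda>y. f (b y)) ` C" unfolding m_def using C(2) \<open>C \<noteq> {}\<close> by (intro Max_in) auto
    moreover have "f (b y) \<le> m" if "y \<in> C" for y unfolding m_def using C(2) that by (intro Max_ge) auto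
    ultimately obtain z where z: "z \<in> C" "\<And>y. y \<in> C \<Longrightarrow> f (b y) \<le> f (b z)" by force
    have bz: "b z \<in> S" using b C(1) z(1) by blast
    then obtain y where y: "y \<in> C" "b z \<in> ball y (r y)" using C(3) by blast
    have "y \<in> S" using y(1) C(1) by blast
    then have "f (b z) < f (b y)" using r y(2) bz by (metis mem_ball)
    then show False using z(2)[OF y(1)] by simp
  qed
  then show ?thesis using that by blast
qed

lemma half_plane_iff [simp]: "(t, x) \<in> half_plane \<longleftrightarrow> 0 \<le> t"
  by (auto simp: half_plane_def)

lemma upper_env_ereal:
  assumes u: "locally_bounded u" and z: "z \<in> half_plane"
  shows "ereal (upper_env u z) = Limsup (inf (nhds z) (principal half_plane)) (\<lambda>w. ereal (u w))"
proof -
  let ?F = "inf (nhds z) (principal half_plane)"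
  obtain r where r: "r > 0" "bounded (u ` (ball z r \<inter> half_plane))"
    using u z unfolding locally_bounded_def by blast
  then obtain B where B: "\<And>w. w \<in> ball z r \<inter> half_plane \<Longrightarrow> \<bar>u w\<bar> \<le> B"
    unfolding bounded_iff by (metis imageI real_norm_def)
  have ev: "eventually (\<lambda>w. w \<in> ball z r \<inter> half_plane) ?F"
    using r(1) by (auto simp: eventually_inf_principal eventually_nhds_metric dist_commute)
  have nb: "?F \<noteq> bot"
    using z by (auto simp: trivial_limit_def eventually_inf_principal dest: eventually_nhds_x_imp_x)
  have le: "Limsup ?F (\<lambda>w. ereal (u w)) \<le> ereal B"
    by (rule Limsup_bounded) (use ev B in \<open>auto elim!: eventually_mono simp: abs_le_iff\<close>)
  have ge: "ereal (- B) \<le> Limsup ?F (\<lambda>w. ereal (u w))"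
    by (rule le_Limsup[OF nb]) (use ev B in \<open>force elim!: eventually_mono simp: abs_le_iff\<close>)
  show ?thesis using le ge unfolding upper_env_def
    by (cases "Limsup ?F (\<lambda>w. ereal (u w))") auto
qed

lemma upper_env_lessD:
  assumes u: "locally_bounded u" "z \<in> half_plane" and less: "upper_env u z < c"
  obtains r where "r > 0" "\<And>w. w \<in> half_plane \<Longrightarrow> dist z w < r \<Longrightarrow> u w < c"
proof -
  have "Limsup (inf (nhds z) (principal half_plane)) (\<lambda>w. ereal (u w)) < ereal c"
    using less upper_env_ereal[OF u] by (metis less_ereal.simps(1))
  from Limsup_lessD[OF this] show ?thesis using that
    by (auto simp: eventually_inf_principal eventually_nhds_metric dist_commute)
qed

lemma upper_env_leI:
  assumes u: "locally_bounded u" "z \<in> half_plane"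
    and r: "r > 0" "\<And>w. w \<in> half_plane \<Longrightarrow> dist z w < r \<Longrightarrow> u w \<le> c"
  shows "upper_env u z \<le> c"
proof -
  have "Limsup (inf (nhds z) (principal half_plane)) (\<lambda>w. ereal (u w)) \<le> ereal c"
    by (rule Limsup_bounded)
       (use r in \<open>auto simp: eventually_inf_principal eventually_nhds_metric dist_commute\<close>)
  then show ?thesis using upper_env_ereal[OF u] by (metis ereal_less_eq(3))
qed

lemma le_upper_env: "locally_bounded u \<Longrightarrow> z \<in> half_plane \<Longrightarrow> u z \<le> upper_env u z"
  by (rule ccontr) (metis dist_self less_irrefl not_le upper_env_lessD)

lemma usc_upper_env:
  assumes u: "locally_bounded u" shows "usc_on half_plane (upper_env u)"
proof (rule usc_onI)
  fix z c assume z: "z \<in> half_plane" "upper_env u z < c"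
  obtain c' where c': "upper_env u z < c'" "c' < c" using z(2) dense by blast
  obtain r where r: "r > 0" "\<And>w. w \<in> half_plane \<Longrightarrow> dist z w < r \<Longrightarrow> u w < c'"
    using upper_env_lessD[OF u z(1) c'(1)] by metis
  have "upper_env u w < c" if w: "w \<in> half_plane" "dist z w < r" for w
  proof -
    have "upper_env u w \<le> c'"
    proof (rule upper_env_leI[OF u w(1)])
      show "r - dist z w > 0" using w by simp
      fix v assume v: "v \<in> half_plane" "dist w v < r - dist z w"
      then have "dist z v < r" using dist_triangle[of z v w] by linarith
      then show "u v \<le> c'" using r(2)[OF v(1)] by simp
    qed
    then show ?thesis using c' by simp
  qed
  then show "\<exists>r>0. \<forall>w\<in>half_plane. dist z w < r \<longrightarrow> upper_env u w < c" using r(1) by blast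
qed

lemma lower_env_uminus: "lower_env u z = - upper_env (\<lambda>w. - u w) z"
  unfolding lower_env_def upper_env_def
  by (simp add: ereal_Limsup_uminus flip: real_of_ereal uminus_ereal.simps(1))

lemma locally_bounded_uminus [simp]: "locally_bounded (\<lambda>w. - u w) \<longleftrightarrow> locally_bounded u"
  unfolding locally_bounded_def bounded_iff by auto

lemma lower_env_le: "locally_bounded u \<Longrightarrow> z \<in> half_plane \<Longrightarrow> lower_env u z \<le> u z"
  using le_upper_env[of "\<lambda>w. - u w" z] by (simp add: lower_env_uminus)

lemma usc_uminus_lower_env: "locally_bounded u \<Longrightarrow> usc_on half_plane (\<lambda>z. - lower_env u z)"
  using usc_upper_env[of "\<lambda>w. - u w"] by (simp add: lower_env_uminus[abs_def])

lemma le_lower_envI: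
  assumes "locally_bounded u" "z \<in> half_plane" "r > 0"
    "\<And>w. w \<in> half_plane \<Longrightarrow> dist z w < r \<Longrightarrow> c \<le> u w"
  shows "c \<le> lower_env u z"
  using upper_env_leI[of "\<lambda>w. - u w" z r "- c"] assms by (simp add: lower_env_uminus)

lemma upper_env_le_continuous:
  assumes u: "locally_bounded u" and f: "continuous_on half_plane f"
    and z: "z \<in> half_plane" and r: "r > 0"
    and le: "\<And>w. w \<in> half_plane \<Longrightarrow> dist z w < r \<Longrightarrow> u w \<le> f w"
  shows "upper_env u z \<le> f z"
proof (rule field_le_epsilon)
  fix e :: real assume "e > 0"
  then obtain d where d: "d > 0" "\<forall>w\<in>half_plane. dist w z < d \<longrightarrow> dist (f w) (f z) < e"
    using f z unfolding continuous_on_iff by metis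
  show "upper_env u z \<le> f z + e"
  proof (rule upper_env_leI[OF u z, of "min d r"])
    fix w assume w: "w \<in> half_plane" "dist z w < min d r"
    then have "\<bar>f w - f z\<bar> < e" using d(2) by (force simp: dist_commute dist_real_def)
    then show "u w \<le> f z + e" using le[of w] w by (simp add: abs_less_iff)
  qed (use d r in auto)
qed

lemma upper_env_of_usc:
  assumes u: "locally_bounded u" and z: "z \<in> half_plane" and usc: "usc_on half_plane u"
  shows "upper_env u z = u z"
proof (rule antisym)
  show "upper_env u z \<le> u z"
  proof (rule field_le_epsilon)
    fix e :: real assume "e > 0"
    then obtain r where "r > 0" "\<And>w. w \<in> half_plane \<Longrightarrow> dist z w < r \<Longrightarrow> u w < u z + e"
      using usc_onD[OF usc z, of "u z + e"] by auto
    then show "upper_env u z \<le> u z + e" by (intro upper_env_leI[OF u z, of r]) (auto intro: less_imp_le)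
  qed
qed (rule le_upper_env[OF u z])

lemma upper_env_cong:
  assumes u: "locally_bounded u" "locally_bounded v" and z: "z \<in> half_plane" and r: "r > 0"
    and eq: "\<And>w. w \<in> half_plane \<Longrightarrow> dist z w < r \<Longrightarrow> u w = v w"
  shows "upper_env u z = upper_env v z"
proof -
  have "upper_env u' z \<le> upper_env v' z"
    if lb: "locally_bounded u'" "locally_bounded v'"
      and e: "\<And>w. w \<in> half_plane \<Longrightarrow> dist z w < r \<Longrightarrow> u' w = v' w" for u' v'
  proof (rule dense_ge)
    fix c assume "upper_env v' z < c"
    then obtain s where s: "s > 0" "\<And>w. w \<in> half_plane \<Longrightarrow> dist z w < s \<Longrightarrow> v' w < c"
      using upper_env_lessD[OF lb(2) z] by metis
    show "upper_env u' z \<le> c"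
      by (rule upper_env_leI[OF lb(1) z, of "min r s"]) (use r s e in \<open>auto intro: less_imp_le\<close>)
  qed
  then show ?thesis using u eq by (metis antisym)
qed

lemma lower_env_cong:
  assumes "locally_bounded u" "locally_bounded v" "z \<in> half_plane" "r > 0"
    "\<And>w. w \<in> half_plane \<Longrightarrow> dist z w < r \<Longrightarrow> u w = v w"
  shows "lower_env u z = lower_env v z"
  unfolding lower_env_uminus using assms by (subst upper_env_cong[of _ "\<lambda>w. - v w" z r]) auto

lemma locally_boundedI:
  assumes f: "continuous_on half_plane f" and g: "continuous_on half_plane g"
    and "\<And>z. z \<in> half_plane \<Longrightarrow> f z \<le> u z" "\<And>z. z \<in> half_plane \<Longrightarrow> u z \<le> g z"
  shows "locally_bounded u"
  unfolding locally_bounded_def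
proof (intro ballI exI[of _ 1] conjI)
  fix z :: "real \<times> real"
  have "closed half_plane" unfolding half_plane_def by (intro closed_Times) auto
  then have "compact (cball z 1 \<inter> half_plane)" by auto
  then have "bounded (f ` (cball z 1 \<inter> half_plane))" "bounded (g ` (cball z 1 \<inter> half_plane))"
    by (intro compact_imp_bounded compact_continuous_image continuous_on_subset[OF f]
        continuous_on_subset[OF g]; auto)+
  then obtain B C where "\<And>w. w \<in> cball z 1 \<inter> half_plane \<Longrightarrow> \<bar>f w\<bar> \<le> B"
    "\<And>w. w \<in> cball z 1 \<inter> half_plane \<Longrightarrow> \<bar>g w\<bar> \<le> C"
    unfolding bounded_iff by (metis imageI real_norm_def)
  note BC = this
  have "\<bar>u w\<bar> \<le> max B C" if w: "w \<in> ball z 1 \<inter> half_plane" for w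
  proof -
    have "w \<in> cball z 1 \<inter> half_plane" using w by auto
    from BC[OF this] have "g w \<le> C" "- B \<le> f w" by (auto simp: abs_le_iff)
    then show ?thesis using assms(3,4)[of w] w by (auto simp: abs_le_iff)
  qed
  then show "bounded (u ` (ball z 1 \<inter> half_plane))" unfolding bounded_iff by (metis imageE real_norm_def)
qed auto

lemma eventually_nhds_half_plane:
  assumes "0 < t"
  shows "eventually (\<lambda>w. w \<in> half_plane \<and> 0 < fst w) (nhds (t, x))"
proof -
  have "open {w :: real \<times> real. 0 < fst w}" by (intro open_Collect_less continuous_intros)
  then have "eventually (\<lambda>w. w \<in> {w :: real \<times> real. 0 < fst w}) (nhds (t, x))"
    using assms by (intro eventually_nhds_in_open) auto
  then show ?thesis by eventually_elim (auto simp: half_plane_def)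
qed

section \<open>Test functions\<close>

definition C1_real :: "real set \<Rightarrow> (real \<Rightarrow> real) \<Rightarrow> (real \<Rightarrow> real) \<Rightarrow> bool" where
  "C1_real S f f' \<longleftrightarrow> continuous_on S f' \<and> (\<forall>x\<in>S. (f has_real_derivative f' x) (at x within S))"

lemma C1_realI:
  "\<lbrakk>continuous_on S f'; \<And>x. x \<in> S \<Longrightarrow> (f has_real_derivative f' x) (at x)\<rbrakk> \<Longrightarrow> C1_real S f f'"
  unfolding C1_real_def by (auto intro: has_field_derivative_at_within)

lemma C1_real_subset: "C1_real S f f' \<Longrightarrow> T \<subseteq> S \<Longrightarrow> C1_real T f f'"
  unfolding C1_real_def by (auto intro: continuous_on_subset DERIV_subset)

lemma C1_real_continuous: "C1_real S f f' \<Longrightarrow> continuous_on S f"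
  unfolding C1_real_def using DERIV_continuous_on by blast

lemma C1_real_add:
  "C1_real S f f' \<Longrightarrow> C1_real S g g' \<Longrightarrow> C1_real S (\<lambda>x. f x + g x) (\<lambda>x. f' x + g' x)"
  unfolding C1_real_def by (auto intro!: continuous_intros derivative_intros)

lemma C1_real_uminus: "C1_real S f f' \<Longrightarrow> C1_real S (\<lambda>x. - f x) (\<lambda>x. - f' x)"
  unfolding C1_real_def by (auto intro!: continuous_intros derivative_intros)

lemma C1_real_cmult: "C1_real S f f' \<Longrightarrow> C1_real S (\<lambda>x. c * f x) (\<lambda>x. c * f' x)"
  unfolding C1_real_def by (auto intro!: continuous_intros derivative_eq_intros)

lemma C1_real_quadratic: "C1_real S (\<lambda>x. a * x + k * (x - c)\<^sup>2) (\<lambda>x. a + 2 * k * (x - c))"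
  by (rule C1_realI) (auto intro!: continuous_intros derivative_eq_intros)

lemma DERIV_pos_part_square:
  "((\<lambda>x::real. (max 0 (x - c))\<^sup>2) has_real_derivative 2 * max 0 (x - c)) (at x)"
proof (cases "x = c")
  case False
  have "((\<lambda>x. if x < c then 0 else (x - c)\<^sup>2) has_real_derivative 2 * max 0 (x - c)) (at x)"
  proof (cases "x < c")
    case True
    then show ?thesis
      using has_field_derivative_transform_within_open[of "\<lambda>_. 0" 0 x "{..<c}" "\<lambda>x. if x < c then 0 else (x - c)\<^sup>2"]
      by simp
  next
    case x: False
    then have "c < x" using False by auto
    have "((\<lambda>x. (x - c)\<^sup>2) has_real_derivative 2 * (x - c)) (at x)"
      by (auto intro!: derivative_eq_intros)
    from has_field_derivative_transform_within_open[OF this, of "{c<..}" "\<lambda>x. if x < c then 0 else (x - c)\<^sup>2"]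
    show ?thesis using \<open>c < x\<close> by simp
  qed
  moreover have "(\<lambda>x. if x < c then 0 else (x - c)\<^sup>2) = (\<lambda>x. (max 0 (x - c))\<^sup>2)" by (auto simp: max_def)
  ultimately show ?thesis by simp
next
  case True
  have "(\<lambda>h. (max 0 h)\<^sup>2 / h) \<midarrow>0\<rightarrow> (0::real)"
  proof (rule Lim_null_comparison)
    show "\<forall>\<^sub>F h in at 0. norm ((max 0 h)\<^sup>2 / h) \<le> \<bar>h::real\<bar>"
      by (intro always_eventually allI) (simp add: max_def power2_eq_square)
  qed (auto intro!: tendsto_eq_intros)
  then show ?thesis unfolding DERIV_def True by simp
qed

lemma C1_real_pos_part_square: "C1_real S (\<lambda>x. (max 0 (x - c))\<^sup>2) (\<lambda>x. 2 * max 0 (x - c))"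
  by (intro C1_realI DERIV_pos_part_square continuous_intros)

lemma C1_on_sum:
  assumes f: "C1_real T f f'" and h: "C1_real X h h'"
  shows "C1_on (T \<times> X) (\<lambda>z. f (fst z) + h (snd z)) (\<lambda>z. (f' (fst z), h' (snd z)))"
  unfolding C1_on_def
proof (intro conjI ballI)
  show "continuous_on (T \<times> X) (\<lambda>z. (f' (fst z), h' (snd z)))"
    using f h unfolding C1_real_def
    by (intro continuous_on_Pair continuous_on_compose2[of T f' _ fst] continuous_on_compose2[of X h' _ snd])
       (auto intro!: continuous_intros)
  fix z assume z: "z \<in> T \<times> X"
  have "((f \<circ> fst) has_derivative ((*) (f' (fst z)) \<circ> fst)) (at z within T \<times> X)"
    by (rule diff_chain_within)
       (use f z in \<open>auto simp: C1_real_def has_field_derivative_def intro!: derivative_intros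
          intro: has_derivative_subset\<close>)
  moreover have "((h \<circ> snd) has_derivative ((*) (h' (snd z)) \<circ> snd)) (at z within T \<times> X)"
    by (rule diff_chain_within)
       (use h z in \<open>auto simp: C1_real_def has_field_derivative_def intro!: derivative_intros
          intro: has_derivative_subset\<close>)
  ultimately show "((\<lambda>z. f (fst z) + h (snd z)) has_derivative
      (\<lambda>d. (f' (fst z), h' (snd z)) \<bullet> d)) (at z within T \<times> X)"
    using has_derivative_add[of "f \<circ> fst" _ _ "h \<circ> snd"] by (simp add: o_def inner_prod_def)
qed

lemma C1_on_add:
  "C1_on S \<phi> G \<Longrightarrow> C1_on S \<psi> K \<Longrightarrow> C1_on S (\<lambda>z. \<phi> z + \<psi> z) (\<lambda>z. G z + K z)"
  unfolding C1_on_def inner_add_left by (simp add: continuous_on_add has_derivative_add)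

lemma C1_on_subset: "C1_on S \<phi> G \<Longrightarrow> T \<subseteq> S \<Longrightarrow> C1_on T \<phi> G"
  unfolding C1_on_def by (auto intro: continuous_on_subset has_derivative_subset)

lemma C1_on_continuous: "C1_on S \<phi> G \<Longrightarrow> continuous_on S \<phi>"
  by (rule has_derivative_continuous_on[where f' = "\<lambda>z h. G z \<bullet> h"]) (auto simp: C1_on_def)

lemma C1_on_partial_time:
  assumes "C1_on (T \<times> X) \<phi> G" "t \<in> T" "x \<in> X"
  shows "((\<lambda>s. \<phi> (s, x)) has_real_derivative fst (G (t, x))) (at t within T)"
proof -
  have "(\<phi> has_derivative (\<lambda>h. G (t, x) \<bullet> h)) (at (t, x) within (\<lambda>s. (s, x)) ` T)"
    using assms unfolding C1_on_def by (auto intro: has_derivative_subset)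
  moreover have "((\<lambda>s. (s, x)) has_derivative (\<lambda>d. (d, 0))) (at t within T)"
    by (auto intro!: derivative_eq_intros)
  ultimately have "((\<phi> \<circ> (\<lambda>s. (s, x))) has_derivative ((\<lambda>h. G (t, x) \<bullet> h) \<circ> (\<lambda>d. (d, 0)))) (at t within T)"
    by (intro diff_chain_within) auto
  then show ?thesis by (simp add: o_def has_field_derivative_def inner_prod_def)
qed

lemma C1_on_partial_space:
  assumes "C1_on (T \<times> X) \<phi> G" "t \<in> T" "x \<in> X"
  shows "((\<lambda>y. \<phi> (t, y)) has_real_derivative snd (G (t, x))) (at x within X)"
proof -
  have "(\<phi> has_derivative (\<lambda>h. G (t, x) \<bullet> h)) (at (t, x) within Pair t ` X)"
    using assms unfolding C1_on_def by (auto intro: has_derivative_subset)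
  moreover have "(Pair t has_derivative (\<lambda>d. (0, d))) (at x within X)"
    by (auto intro!: derivative_eq_intros)
  ultimately have "((\<phi> \<circ> Pair t) has_derivative ((\<lambda>h. G (t, x) \<bullet> h) \<circ> (\<lambda>d. (0, d)))) (at x within X)"
    by (intro diff_chain_within) auto
  then show ?thesis by (simp add: o_def has_field_derivative_def inner_prod_def)
qed

lemma C1_on_time_slice:
  assumes "C1_on (T \<times> X) \<phi> G" "x \<in> X"
  shows "C1_real T (\<lambda>t. \<phi> (t, x)) (\<lambda>t. fst (G (t, x)))"
  using assms C1_on_partial_time[OF assms(1) _ assms(2)]
  unfolding C1_real_def C1_on_def
  by (auto intro!: continuous_on_fst continuous_on_compose2[of "T \<times> X" G] continuous_intros)

lemma C1_on_space_estimate: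
  assumes C1: "C1_on ({0<..} \<times> X) \<phi> G" and X: "convex X" "x0 \<in> X" and t0: "0 < t0" and e: "e > 0"
  obtains r where "r > 0" "r \<le> t0"
    "\<And>t y. \<bar>t - t0\<bar> < r \<Longrightarrow> \<bar>y - x0\<bar> < r \<Longrightarrow> y \<in> X \<Longrightarrow>
       \<bar>\<phi> (t, y) - \<phi> (t, x0) - snd (G (t0, x0)) * (y - x0)\<bar> \<le> e * \<bar>y - x0\<bar>"
proof -
  let ?q = "snd (G (t0, x0))"
  have "continuous_on ({0<..} \<times> X) (\<lambda>z. snd (G z))"
    using C1 unfolding C1_on_def by (auto intro: continuous_on_snd)
  then obtain d where d: "d > 0"
    "\<And>z. z \<in> {0<..} \<times> X \<Longrightarrow> dist z (t0, x0) < d \<Longrightarrow> \<bar>snd (G z) - ?q\<bar> < e"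
    using t0 X(2) e unfolding continuous_on_iff dist_real_def by (metis SigmaI greaterThan_iff)
  define r where "r = min (d / 2) t0"
  have r: "r > 0" "r \<le> t0" "r \<le> d / 2" using d t0 by (auto simp: r_def)
  show ?thesis
  proof (rule that[OF r(1,2)])
    fix t y assume t: "\<bar>t - t0\<bar> < r" and y: "\<bar>y - x0\<bar> < r" "y \<in> X"
    have tpos: "0 < t" using t r by linarith
    let ?S = "X \<inter> ball x0 r"
    have "norm ((\<phi> (t, y) - ?q * y) - (\<phi> (t, x0) - ?q * x0)) \<le> e * norm (y - x0)"
    proof (rule field_differentiable_bound[where S = ?S and f' = "\<lambda>z. snd (G (t, z)) - ?q"])
      show "convex ?S" using X by (intro convex_Int) auto
      fix z assume z: "z \<in> ?S"
      have "((\<lambda>z. \<phi> (t, z)) has_real_derivative snd (G (t, z))) (at z within ?S)"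
        using C1_on_partial_space[OF C1, of t z] z tpos by (auto intro: DERIV_subset)
      then show "((\<lambda>z. \<phi> (t, z) - ?q * z) has_real_derivative snd (G (t, z)) - ?q) (at z within ?S)"
        by (auto intro!: derivative_eq_intros)
      have "dist (t, z) (t0, x0) \<le> \<bar>t - t0\<bar> + \<bar>z - x0\<bar>"
        unfolding dist_Pair_Pair dist_real_def by (rule order_trans[OF sqrt_sum_squares_le_sum_abs]) auto
      also have "\<dots> < d" using t z r by (auto simp: dist_real_def)
      finally show "norm (snd (G (t, z)) - ?q) \<le> e" using d(2)[of "(t, z)"] z tpos by auto
    qed (use y r X in \<open>auto simp: dist_real_def\<close>)
    then show "\<bar>\<phi> (t, y) - \<phi> (t, x0) - ?q * (y - x0)\<bar> \<le> e * \<bar>y - x0\<bar>"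
      by (simp add: algebra_simps)
  qed
qed

lemma eventually_nhds_box:
  fixes P :: "real \<times> real \<Rightarrow> bool"
  shows "eventually P (nhds (t, x)) \<longleftrightarrow> (\<exists>r>0. \<forall>s y. \<bar>s - t\<bar> < r \<longrightarrow> \<bar>y - x\<bar> < r \<longrightarrow> P (s, y))"
proof
  assume "eventually P (nhds (t, x))"
  then obtain d where d: "d > 0" "\<And>z. dist z (t, x) < d \<Longrightarrow> P z"
    unfolding eventually_nhds_metric by blast
  have "P (s, y)" if "\<bar>s - t\<bar> < d / 2" "\<bar>y - x\<bar> < d / 2" for s y
  proof (rule d(2))
    have "dist (s, y) (t, x) \<le> \<bar>s - t\<bar> + \<bar>y - x\<bar>"
      unfolding dist_Pair_Pair dist_real_def by (rule order_trans[OF sqrt_sum_squares_le_sum_abs]) auto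
    also have "\<dots> < d" using that by linarith
    finally show "dist (s, y) (t, x) < d" .
  qed
  then show "\<exists>r>0. \<forall>s y. \<bar>s - t\<bar> < r \<longrightarrow> \<bar>y - x\<bar> < r \<longrightarrow> P (s, y)"
    using d(1) by (intro exI[of _ "d/2"]) auto
next
  assume "\<exists>r>0. \<forall>s y. \<bar>s - t\<bar> < r \<longrightarrow> \<bar>y - x\<bar> < r \<longrightarrow> P (s, y)"
  then obtain r where r: "r > 0" "\<And>s y. \<bar>s - t\<bar> < r \<Longrightarrow> \<bar>y - x\<bar> < r \<Longrightarrow> P (s, y)" by blast
  have "P z" if "dist z (t, x) < r" for z
    using r(2)[of "fst z" "snd z"] dist_fst_le[of z "(t,x)"] dist_snd_le[of z "(t,x)"] that
    by (auto simp: dist_real_def)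
  then show "eventually P (nhds (t, x))" unfolding eventually_nhds_metric using r(1) by blast
qed

section \<open>Viscosity inequalities\<close>

text \<open>At the junction either gradient could provide the time derivative
  (\<open>junction_test_time_derivatives\<close> below).\<close>
definition residual ::
  "(real \<Rightarrow> real) \<Rightarrow> (real \<Rightarrow> real) \<Rightarrow> (real \<Rightarrow> real \<Rightarrow> real) \<Rightarrow> (real \<times> real \<Rightarrow> real \<times> real) \<Rightarrow>
    (real \<times> real \<Rightarrow> real \<times> real) \<Rightarrow> real \<times> real \<Rightarrow> real" where
  "residual H1 H2 F GL GR z =
    (if snd z < 0 then fst (GL z) + H1 (snd (GL z))
     else if 0 < snd z then fst (GR z) + H2 (snd (GR z))
     else fst (GL z) + F (snd (GL z)) (snd (GR z)))"

text \<open>The junction conditions for a function that is already semicontinuous, such as an envelope.\<close>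
definition jsub where
  "jsub H1 H2 F U \<longleftrightarrow> (\<forall>\<phi> GL GR z. junction_test \<phi> GL GR \<longrightarrow> 0 < fst z \<longrightarrow> touches_above \<phi> U z \<longrightarrow>
     residual H1 H2 F GL GR z \<le> 0)"

definition jsuper where
  "jsuper H1 H2 F V \<longleftrightarrow> (\<forall>\<phi> GL GR z. junction_test \<phi> GL GR \<longrightarrow> 0 < fst z \<longrightarrow> touches_below \<phi> V z \<longrightarrow>
     0 \<le> residual H1 H2 F GL GR z)"

lemma jsubI:
  assumes "\<And>\<phi> GL GR t x. \<lbrakk>junction_test \<phi> GL GR; 0 < t; touches_above \<phi> U (t, x)\<rbrakk> \<Longrightarrow>
    (x < 0 \<longrightarrow> fst (GL (t, x)) + H1 (snd (GL (t, x))) \<le> 0) \<and>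
    (0 < x \<longrightarrow> fst (GR (t, x)) + H2 (snd (GR (t, x))) \<le> 0) \<and>
    (x = 0 \<longrightarrow> fst (GL (t, 0)) + F (snd (GL (t, 0))) (snd (GR (t, 0))) \<le> 0)"
  shows "jsub H1 H2 F U"
  unfolding jsub_def residual_def
proof (intro allI impI)
  fix \<phi> GL GR and z :: "real \<times> real"
  assume a: "junction_test \<phi> GL GR" "0 < fst z" "touches_above \<phi> U z"
  obtain t x where z: "z = (t, x)" by (cases z)
  show "(if snd z < 0 then fst (GL z) + H1 (snd (GL z))
     else if 0 < snd z then fst (GR z) + H2 (snd (GR z))
     else fst (GL z) + F (snd (GL z)) (snd (GR z))) \<le> 0"
    using assms[of \<phi> GL GR t x] a z by (cases x "0::real" rule: linorder_cases) auto
qed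

lemma jsuperI:
  assumes "\<And>\<phi> GL GR t x. \<lbrakk>junction_test \<phi> GL GR; 0 < t; touches_below \<phi> V (t, x)\<rbrakk> \<Longrightarrow>
    (x < 0 \<longrightarrow> fst (GL (t, x)) + H1 (snd (GL (t, x))) \<ge> 0) \<and>
    (0 < x \<longrightarrow> fst (GR (t, x)) + H2 (snd (GR (t, x))) \<ge> 0) \<and>
    (x = 0 \<longrightarrow> fst (GL (t, 0)) + F (snd (GL (t, 0))) (snd (GR (t, 0))) \<ge> 0)"
  shows "jsuper H1 H2 F V"
  unfolding jsuper_def residual_def
proof (intro allI impI)
  fix \<phi> GL GR and z :: "real \<times> real"
  assume a: "junction_test \<phi> GL GR" "0 < fst z" "touches_below \<phi> V z"
  obtain t x where z: "z = (t, x)" by (cases z)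
  show "0 \<le> (if snd z < 0 then fst (GL z) + H1 (snd (GL z))
     else if 0 < snd z then fst (GR z) + H2 (snd (GR z))
     else fst (GL z) + F (snd (GL z)) (snd (GR z)))"
    using assms[of \<phi> GL GR t x] a z by (cases x "0::real" rule: linorder_cases) auto
qed

lemma junction_subsol_iff:
  "junction_subsol H1 H2 F u \<longleftrightarrow> locally_bounded u \<and> jsub H1 H2 F (upper_env u)"
proof (intro iffI conjI)
  assume "junction_subsol H1 H2 F u"
  then show "locally_bounded u" "jsub H1 H2 F (upper_env u)"
    unfolding junction_subsol_def by (blast, intro jsubI, blast)
next
  assume u: "locally_bounded u \<and> jsub H1 H2 F (upper_env u)"
  show "junction_subsol H1 H2 F u"
    unfolding junction_subsol_def
  proof (rule conjI[OF conjunct1[OF u]], intro allI impI)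
    fix \<phi> GL GR and t x :: real
    assume "junction_test \<phi> GL GR \<and> 0 < t \<and> touches_above \<phi> (upper_env u) (t, x)"
    then have "residual H1 H2 F GL GR (t, x) \<le> 0"
      using u unfolding jsub_def by force
    then show "(x < 0 \<longrightarrow> fst (GL (t, x)) + H1 (snd (GL (t, x))) \<le> 0) \<and>
      (0 < x \<longrightarrow> fst (GR (t, x)) + H2 (snd (GR (t, x))) \<le> 0) \<and>
      (x = 0 \<longrightarrow> fst (GL (t, 0)) + F (snd (GL (t, 0))) (snd (GR (t, 0))) \<le> 0)"
      by (auto simp: residual_def)
  qed
qed

lemma junction_supersol_iff:
  "junction_supersol H1 H2 F u \<longleftrightarrow> locally_bounded u \<and> jsuper H1 H2 F (lower_env u)"
proof (intro iffI conjI)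
  assume "junction_supersol H1 H2 F u"
  then show "locally_bounded u" "jsuper H1 H2 F (lower_env u)"
    unfolding junction_supersol_def by (blast, intro jsuperI, blast)
next
  assume u: "locally_bounded u \<and> jsuper H1 H2 F (lower_env u)"
  show "junction_supersol H1 H2 F u"
    unfolding junction_supersol_def
  proof (rule conjI[OF conjunct1[OF u]], intro allI impI)
    fix \<phi> GL GR and t x :: real
    assume "junction_test \<phi> GL GR \<and> 0 < t \<and> touches_below \<phi> (lower_env u) (t, x)"
    then have "0 \<le> residual H1 H2 F GL GR (t, x)"
      using u unfolding jsuper_def by force
    then show "(x < 0 \<longrightarrow> fst (GL (t, x)) + H1 (snd (GL (t, x))) \<ge> 0) \<and>
      (0 < x \<longrightarrow> fst (GR (t, x)) + H2 (snd (GR (t, x))) \<ge> 0) \<and>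
      (x = 0 \<longrightarrow> fst (GL (t, 0)) + F (snd (GL (t, 0))) (snd (GR (t, 0))) \<ge> 0)"
      by (auto simp: residual_def)
  qed
qed

text \<open>Wherever a test function is constructed, rather than given, a sum \<open>f t + h x\<close> is enough. The set
  \<open>X\<close> is one of the two open sides or, for the Ishii conditions at the junction, a single point.\<close>

definition visc_sub :: "(real \<Rightarrow> real) \<Rightarrow> real set \<Rightarrow> (real \<times> real \<Rightarrow> real) \<Rightarrow> bool" where
  "visc_sub H X U \<longleftrightarrow> (\<forall>f f' h h' t x. 0 < t \<and> x \<in> X \<and> C1_real {0<..} f f' \<and> C1_real UNIV h h' \<and>
     (\<exists>r>0. \<forall>s y. \<bar>s - t\<bar> < r \<longrightarrow> \<bar>y - x\<bar> < r \<longrightarrow>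
        U (s, y) \<le> U (t, x) + (f s - f t) + (h y - h x)) \<longrightarrow> f' t + H (h' x) \<le> 0)"

definition visc_super :: "(real \<Rightarrow> real) \<Rightarrow> real set \<Rightarrow> (real \<times> real \<Rightarrow> real) \<Rightarrow> bool" where
  "visc_super H X V \<longleftrightarrow> (\<forall>f f' h h' t x. 0 < t \<and> x \<in> X \<and> C1_real {0<..} f f' \<and> C1_real UNIV h h' \<and>
     (\<exists>r>0. \<forall>s y. \<bar>s - t\<bar> < r \<longrightarrow> \<bar>y - x\<bar> < r \<longrightarrow>
        V (t, x) + (f s - f t) + (h y - h x) \<le> V (s, y)) \<longrightarrow> 0 \<le> f' t + H (h' x))"

lemma visc_subD:
  assumes "visc_sub H X U" "0 < t" "x \<in> X" "C1_real {0<..} f f'" "C1_real UNIV h h'" "r > 0"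
    "\<And>s y. \<bar>s - t\<bar> < r \<Longrightarrow> \<bar>y - x\<bar> < r \<Longrightarrow> U (s, y) \<le> U (t, x) + (f s - f t) + (h y - h x)"
  shows "f' t + H (h' x) \<le> 0"
  using assms unfolding visc_sub_def by blast

lemma visc_superD:
  assumes "visc_super H X V" "0 < t" "x \<in> X" "C1_real {0<..} f f'" "C1_real UNIV h h'" "r > 0"
    "\<And>s y. \<bar>s - t\<bar> < r \<Longrightarrow> \<bar>y - x\<bar> < r \<Longrightarrow> V (t, x) + (f s - f t) + (h y - h x) \<le> V (s, y)"
  shows "0 \<le> f' t + H (h' x)"
  using assms unfolding visc_super_def by blast

lemma visc_sub_uminus:
  assumes "visc_sub H X U" shows "visc_super (\<lambda>q. - H (- q)) X (\<lambda>z. - U z)"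
  unfolding visc_super_def
proof (intro allI impI, elim conjE exE)
  fix f f' h h' t x r
  assume a: "0 < t" "x \<in> X" "C1_real {0<..} f f'" "C1_real UNIV h h'" "0 < r"
    "\<forall>s y. \<bar>s - t\<bar> < r \<longrightarrow> \<bar>y - x\<bar> < r \<longrightarrow> - U (t, x) + (f s - f t) + (h y - h x) \<le> - U (s, y)"
  have "- f' t + H (- h' x) \<le> 0"
    by (rule visc_subD[OF assms a(1,2) C1_real_uminus[OF a(3)] C1_real_uminus[OF a(4)] a(5)])
       (use a(6) in force)
  then show "0 \<le> f' t + - H (- h' x)" by linarith
qed

lemma junction_test_sum:
  assumes f: "C1_real {0<..} f f'" and h: "C1_real {..0} h hL" "C1_real {0..} h hR"
  shows "junction_test (\<lambda>z. f (fst z) + h (snd z)) (\<lambda>z. (f' (fst z), hL (snd z))) (\<lambda>z. (f' (fst z), hR (snd z)))"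
proof -
  have "continuous_on ({..0} \<union> {0..}) h"
    by (intro continuous_on_closed_Un C1_real_continuous[OF h(1)] C1_real_continuous[OF h(2)]) auto
  moreover have "{..0} \<union> {0..} = (UNIV :: real set)" by auto
  ultimately have "continuous_on UNIV h" by simp
  then have "continuous_on ({0<..} \<times> UNIV) (\<lambda>z. f (fst z) + h (snd z))"
    by (intro continuous_on_add continuous_on_compose2[OF C1_real_continuous[OF f], of _ fst]
        continuous_on_compose2[of UNIV h _ snd]) (auto intro!: continuous_intros)
  then show ?thesis unfolding junction_test_def using C1_on_sum[OF f h(1)] C1_on_sum[OF f h(2)] by auto
qed

lemma junction_test_add:
  assumes "junction_test \<phi> GL GR" "junction_test \<psi> KL KR"
  shows "junction_test (\<lambda>z. \<phi> z + \<psi> z) (\<lambda>z. GL z + KL z) (\<lambda>z. GR z + KR z)"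
  using assms unfolding junction_test_def by (auto intro!: continuous_intros C1_on_add)

lemma C1_on_imp_junction_test: "C1_on ({0<..} \<times> UNIV) \<phi> G \<Longrightarrow> junction_test \<phi> G G"
  unfolding junction_test_def by (auto intro: C1_on_continuous C1_on_subset)

lemma jsub_residual:
  assumes U: "jsub H1 H2 F U" and t: "0 < t"
    and f: "C1_real {0<..} f f'" and h: "C1_real {..0} h hL" "C1_real {0..} h hR"
    and r: "r > 0" "\<And>s y. \<bar>s - t\<bar> < r \<Longrightarrow> \<bar>y - x\<bar> < r \<Longrightarrow> U (s, y) \<le> U (t, x) + (f s - f t) + (h y - h x)"
  shows "(x < 0 \<longrightarrow> f' t + H1 (hL x) \<le> 0) \<and> (0 < x \<longrightarrow> f' t + H2 (hR x) \<le> 0) \<and>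
    (x = 0 \<longrightarrow> f' t + F (hL 0) (hR 0) \<le> 0)"
proof -
  let ?c = "U (t, x) - f t - h x"
  have "C1_real {0<..} (\<lambda>s. ?c + f s) f'" using f unfolding C1_real_def
    by (auto intro!: derivative_eq_intros)
  from junction_test_sum[OF this h] have
    "junction_test (\<lambda>z. ?c + f (fst z) + h (snd z)) (\<lambda>z. (f' (fst z), hL (snd z))) (\<lambda>z. (f' (fst z), hR (snd z)))" .
  moreover have "touches_above (\<lambda>z. ?c + f (fst z) + h (snd z)) U (t, x)"
    unfolding touches_above_def eventually_nhds_box using r by (force intro!: exI[of _ r])
  ultimately have "residual H1 H2 F (\<lambda>z. (f' (fst z), hL (snd z))) (\<lambda>z. (f' (fst z), hR (snd z))) (t, x) \<le> 0"
    using U t unfolding jsub_def by fastforce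
  then show ?thesis by (auto simp: residual_def split: if_splits)
qed

lemma jsuper_residual:
  assumes V: "jsuper H1 H2 F V" and t: "0 < t"
    and f: "C1_real {0<..} f f'" and h: "C1_real {..0} h hL" "C1_real {0..} h hR"
    and r: "r > 0" "\<And>s y. \<bar>s - t\<bar> < r \<Longrightarrow> \<bar>y - x\<bar> < r \<Longrightarrow> V (t, x) + (f s - f t) + (h y - h x) \<le> V (s, y)"
  shows "(x < 0 \<longrightarrow> f' t + H1 (hL x) \<ge> 0) \<and> (0 < x \<longrightarrow> f' t + H2 (hR x) \<ge> 0) \<and>
    (x = 0 \<longrightarrow> f' t + F (hL 0) (hR 0) \<ge> 0)"
proof -
  let ?c = "V (t, x) - f t - h x"
  have "C1_real {0<..} (\<lambda>s. ?c + f s) f'" using f unfolding C1_real_def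
    by (auto intro!: derivative_eq_intros)
  from junction_test_sum[OF this h] have
    "junction_test (\<lambda>z. ?c + f (fst z) + h (snd z)) (\<lambda>z. (f' (fst z), hL (snd z))) (\<lambda>z. (f' (fst z), hR (snd z)))" .
  moreover have "touches_below (\<lambda>z. ?c + f (fst z) + h (snd z)) V (t, x)"
    unfolding touches_below_def eventually_nhds_box using r by (force intro!: exI[of _ r])
  ultimately have "0 \<le> residual H1 H2 F (\<lambda>z. (f' (fst z), hL (snd z))) (\<lambda>z. (f' (fst z), hR (snd z))) (t, x)"
    using V t unfolding jsuper_def by fastforce
  then show ?thesis by (auto simp: residual_def split: if_splits)
qed

lemma jsub_imp_visc_sub:
  assumes "jsub H1 H2 F U" shows "visc_sub H1 {..<0} U" "visc_sub H2 {0<..} U"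
proof -
  show "visc_sub H1 {..<0} U" unfolding visc_sub_def
  proof (intro allI impI, elim conjE exE)
    fix f f' h h' t x r
    assume a: "0 < t" "x \<in> {..<0}" "C1_real {0<..} f f'" "C1_real UNIV h h'" "0 < r"
      and b: "\<forall>s y. \<bar>s - t\<bar> < r \<longrightarrow> \<bar>y - x\<bar> < r \<longrightarrow> U (s, y) \<le> U (t, x) + (f s - f t) + (h y - h x)"
    from jsub_residual[OF assms a(1,3) C1_real_subset[OF a(4) subset_UNIV] C1_real_subset[OF a(4) subset_UNIV] a(5)] b a(2)
    show "f' t + H1 (h' x) \<le> 0" by simp
  qed
  show "visc_sub H2 {0<..} U" unfolding visc_sub_def
  proof (intro allI impI, elim conjE exE)
    fix f f' h h' t x r
    assume a: "0 < t" "x \<in> {0<..}" "C1_real {0<..} f f'" "C1_real UNIV h h'" "0 < r"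
      and b: "\<forall>s y. \<bar>s - t\<bar> < r \<longrightarrow> \<bar>y - x\<bar> < r \<longrightarrow> U (s, y) \<le> U (t, x) + (f s - f t) + (h y - h x)"
    from jsub_residual[OF assms a(1,3) C1_real_subset[OF a(4) subset_UNIV] C1_real_subset[OF a(4) subset_UNIV] a(5)] b a(2)
    show "f' t + H2 (h' x) \<le> 0" by simp
  qed
qed

lemma jsuper_imp_visc_super:
  assumes "jsuper H1 H2 F V" shows "visc_super H1 {..<0} V" "visc_super H2 {0<..} V"
proof -
  show "visc_super H1 {..<0} V" unfolding visc_super_def
  proof (intro allI impI, elim conjE exE)
    fix f f' h h' t x r
    assume a: "0 < t" "x \<in> {..<0}" "C1_real {0<..} f f'" "C1_real UNIV h h'" "0 < r"
      and b: "\<forall>s y. \<bar>s - t\<bar> < r \<longrightarrow> \<bar>y - x\<bar> < r \<longrightarrow> V (t, x) + (f s - f t) + (h y - h x) \<le> V (s, y)"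
    from jsuper_residual[OF assms a(1,3) C1_real_subset[OF a(4) subset_UNIV] C1_real_subset[OF a(4) subset_UNIV] a(5)] b a(2)
    show "0 \<le> f' t + H1 (h' x)" by simp
  qed
  show "visc_super H2 {0<..} V" unfolding visc_super_def
  proof (intro allI impI, elim conjE exE)
    fix f f' h h' t x r
    assume a: "0 < t" "x \<in> {0<..}" "C1_real {0<..} f f'" "C1_real UNIV h h'" "0 < r"
      and b: "\<forall>s y. \<bar>s - t\<bar> < r \<longrightarrow> \<bar>y - x\<bar> < r \<longrightarrow> V (t, x) + (f s - f t) + (h y - h x) \<le> V (s, y)"
    from jsuper_residual[OF assms a(1,3) C1_real_subset[OF a(4) subset_UNIV] C1_real_subset[OF a(4) subset_UNIV] a(5)] b a(2)
    show "0 \<le> f' t + H2 (h' x)" by simp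
  qed
qed

lemma ishii_subsol_imp_visc_sub:
  assumes "ishii_subsol H1 H2 u"
  shows "visc_sub H1 {..<0} (upper_env u)" "visc_sub H2 {0<..} (upper_env u)"
    "visc_sub (\<lambda>q. min (H1 q) (H2 q)) {0} (upper_env u)"
proof -
  let ?U = "upper_env u"
  have *: "(x < 0 \<longrightarrow> f' t + H1 (h' x) \<le> 0) \<and> (0 < x \<longrightarrow> f' t + H2 (h' x) \<le> 0) \<and>
      (x = 0 \<longrightarrow> f' t + min (H1 (h' x)) (H2 (h' x)) \<le> 0)"
    if a: "0 < t" "C1_real {0<..} f f'" "C1_real UNIV h h'" "0 < r"
    "\<forall>s y. \<bar>s - t\<bar> < r \<longrightarrow> \<bar>y - x\<bar> < r \<longrightarrow> ?U (s, y) \<le> ?U (t, x) + (f s - f t) + (h y - h x)"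
    for f f' h h' t x r
  proof -
    let ?c = "?U (t, x) - f t - h x"
    have "C1_real {0<..} (\<lambda>s. ?c + f s) f'" using a(2) unfolding C1_real_def
      by (auto intro!: derivative_eq_intros)
    from C1_on_sum[OF this a(3)] have
      c: "C1_on ({0<..} \<times> UNIV) (\<lambda>z. ?c + f (fst z) + h (snd z)) (\<lambda>z. (f' (fst z), h' (snd z)))" .
    have tt: "touches_above (\<lambda>z. ?c + f (fst z) + h (snd z)) ?U (t, x)"
      unfolding touches_above_def eventually_nhds_box using a(4,5) by (force intro!: exI[of _ r])
    show ?thesis
      using conjunct2[OF assms[unfolded ishii_subsol_def], THEN spec, THEN spec, THEN spec, THEN spec, THEN mp,
        OF conjI[OF c conjI[OF a(1) tt]]]
      by (simp add: Let_def)
  qed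
  show "visc_sub H1 {..<0} ?U" "visc_sub H2 {0<..} ?U"
    "visc_sub (\<lambda>q. min (H1 q) (H2 q)) {0} ?U"
    unfolding visc_sub_def by (intro allI impI, elim conjE exE, frule (4) *, simp)+
qed

lemma ishii_supersol_imp_visc_super:
  assumes "ishii_supersol H1 H2 u"
  shows "visc_super H1 {..<0} (lower_env u)" "visc_super H2 {0<..} (lower_env u)"
    "visc_super (\<lambda>q. max (H1 q) (H2 q)) {0} (lower_env u)"
proof -
  let ?V = "lower_env u"
  have *: "(x < 0 \<longrightarrow> f' t + H1 (h' x) \<ge> 0) \<and> (0 < x \<longrightarrow> f' t + H2 (h' x) \<ge> 0) \<and>
      (x = 0 \<longrightarrow> f' t + max (H1 (h' x)) (H2 (h' x)) \<ge> 0)"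
    if a: "0 < t" "C1_real {0<..} f f'" "C1_real UNIV h h'" "0 < r"
    "\<forall>s y. \<bar>s - t\<bar> < r \<longrightarrow> \<bar>y - x\<bar> < r \<longrightarrow> ?V (t, x) + (f s - f t) + (h y - h x) \<le> ?V (s, y)"
    for f f' h h' t x r
  proof -
    let ?c = "?V (t, x) - f t - h x"
    have "C1_real {0<..} (\<lambda>s. ?c + f s) f'" using a(2) unfolding C1_real_def
      by (auto intro!: derivative_eq_intros)
    from C1_on_sum[OF this a(3)] have
      c: "C1_on ({0<..} \<times> UNIV) (\<lambda>z. ?c + f (fst z) + h (snd z)) (\<lambda>z. (f' (fst z), h' (snd z)))" .
    have tt: "touches_below (\<lambda>z. ?c + f (fst z) + h (snd z)) ?V (t, x)"
      unfolding touches_below_def eventually_nhds_box using a(4,5) by (force intro!: exI[of _ r])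
    show ?thesis
      using conjunct2[OF assms[unfolded ishii_supersol_def], THEN spec, THEN spec, THEN spec, THEN spec, THEN mp,
        OF conjI[OF c conjI[OF a(1) tt]]]
      by (simp add: Let_def)
  qed
  show "visc_super H1 {..<0} ?V" "visc_super H2 {0<..} ?V"
    "visc_super (\<lambda>q. max (H1 q) (H2 q)) {0} ?V"
    unfolding visc_super_def by (intro allI impI, elim conjE exE, frule (4) *, simp)+
qed

section \<open>Moving the slope of a test function\<close>

lemma DERIV_soft_ramp:
  fixes l :: real assumes "l \<ge> 0"
  shows "((\<lambda>y. y / (1 + l * \<bar>y\<bar>)) has_real_derivative 1 / (1 + l * \<bar>y\<bar>)\<^sup>2) (at y)"
proof (cases y "0::real" rule: linorder_cases)
  case less
  have "1 + l * (- y) > 0" using less assms mult_nonneg_nonneg[of l "- y"] by simp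
  then have "((\<lambda>y. y / (1 + l * (- y))) has_real_derivative 1 / (1 + l * (- y))\<^sup>2) (at y)"
    by (auto intro!: derivative_eq_intros simp: power2_eq_square field_simps)
  then show ?thesis
    using less has_field_derivative_transform_within_open[of "\<lambda>y. y / (1 + l * (- y))" _ y "{..<0}"
        "\<lambda>y. y / (1 + l * \<bar>y\<bar>)"] by simp
next
  case greater
  have "1 + l * y > 0" using greater assms by (simp add: add_pos_nonneg)
  then have "((\<lambda>y. y / (1 + l * y)) has_real_derivative 1 / (1 + l * y)\<^sup>2) (at y)"
    by (auto intro!: derivative_eq_intros simp: power2_eq_square field_simps)
  then show ?thesis
    using greater has_field_derivative_transform_within_open[of "\<lambda>y. y / (1 + l * y)" _ y "{0<..}"
        "\<lambda>y. y / (1 + l * \<bar>y\<bar>)"] by simp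
next
  case equal
  have "((\<lambda>h. 1 / (1 + l * \<bar>h\<bar>)) \<longlongrightarrow> 1 / (1 + l * \<bar>0\<bar>)) (at (0::real))"
    by (intro tendsto_intros) auto
  moreover have "eventually (\<lambda>h. 1 / (1 + l * \<bar>h\<bar>) = h / (1 + l * \<bar>h\<bar>) / h) (at (0::real))"
    by (auto simp: eventually_at intro!: exI[of _ 1])
  ultimately have "((\<lambda>h. h / (1 + l * \<bar>h\<bar>) / h) \<longlongrightarrow> 1) (at (0::real))"
    using Lim_transform_eventually by fastforce
  then show ?thesis unfolding DERIV_def equal by simp
qed

text \<open>A super-solution on one side of \<open>x0\<close> cannot leave \<open>x0\<close> with a slope at which the equation is
  strictly violated: if it lies above a function of slope \<open>q\<close>, and the violation persists for all
  slopes from \<open>q\<close> up to \<open>p\<close>, then it lies above one of slope \<open>p\<close>. To see this, it is compared on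
  a small box with functions whose slope decreases from \<open>p\<close> at \<open>x0\<close> to slightly less than \<open>q\<close>;
  such a function is a strict sub-solution, and lies below on the boundary of the box as soon as the
  transition is quick. Here \<open>s\<close> is a sign, and slopes are counted in the direction away from \<open>x0\<close>.\<close>
lemma steepen_super:
  assumes V: "visc_super H X V" and lsc: "usc_on half_plane (\<lambda>z. - V z)"
    and H: "continuous_on UNIV H" and t0: "0 < t0" and s: "s = 1 \<or> s = -1"
    and R: "R > 0" "\<And>y. 0 < y \<Longrightarrow> y < R \<Longrightarrow> x0 + s * y \<in> X"
    and f: "C1_real {0<..} f f'"
    and below: "r0 > 0" "\<And>t y. \<bar>t - t0\<bar> < r0 \<Longrightarrow> 0 \<le> y \<Longrightarrow> y < r0 \<Longrightarrow>
      V (t0, x0) + (f t - f t0) + q * y \<le> V (t, x0 + s * y)"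
    and viol: "\<And>p'. q \<le> p' \<Longrightarrow> p' \<le> p \<Longrightarrow> f' t0 + H (s * p') < 0"
  obtains r K where "r > 0" "K \<ge> 0" "\<And>t y. \<bar>t - t0\<bar> < r \<Longrightarrow> 0 \<le> y \<Longrightarrow> y < r \<Longrightarrow>
      V (t0, x0) + (f t - f t0) - K * (t - t0)\<^sup>2 + p * y - K * y\<^sup>2 \<le> V (t, x0 + s * y)"
proof (cases "q \<le> p")
  case False
  show ?thesis
  proof (rule that[OF below(1) order_refl])
    fix t y assume *: "\<bar>t - t0\<bar> < r0" "0 \<le> y" "y < r0"
    have "p * y \<le> q * y" using False *(2) by (intro mult_right_mono) auto
    then show "V (t0, x0) + (f t - f t0) - 0 * (t - t0)\<^sup>2 + p * y - 0 * y\<^sup>2 \<le> V (t, x0 + s * y)"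
      using below(2)[OF *] by simp
  qed
next
  case qp: True
  define g where "g = (\<lambda>p'. f' t0 + H (s * p'))"
  have g_cont: "continuous_on A g" for A unfolding g_def
    by (intro continuous_intros continuous_on_compose2[OF H]) auto
  obtain m where m: "m > 0" "\<And>p'. q \<le> p' \<Longrightarrow> p' \<le> p \<Longrightarrow> g p' \<le> - m"
  proof -
    obtain c where c: "c \<in> {q..p}" "\<And>p'. p' \<in> {q..p} \<Longrightarrow> g p' \<le> g c"
      using continuous_attains_sup[of "{q..p}" g] g_cont qp by auto
    have "g c < 0" using viol c(1) by (auto simp: g_def)
    then show ?thesis using that[of "- g c"] c(2) by auto
  qed
  obtain e where e: "e > 0" "\<And>p'. q - e \<le> p' \<Longrightarrow> p' \<le> p \<Longrightarrow> g p' \<le> - m / 2"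
  proof -
    obtain d where d: "d > 0" "\<And>p'. \<bar>p' - q\<bar> < d \<Longrightarrow> \<bar>g p' - g q\<bar> < m / 2"
      using g_cont[of UNIV] m(1) unfolding continuous_on_iff dist_real_def by (metis UNIV_I half_gt_zero)
    have "g p' \<le> - m / 2" if "q - d / 2 \<le> p'" "p' \<le> p" for p'
    proof (cases "q \<le> p'")
      case True then show ?thesis using m(1) m(2)[of p'] that by linarith
    next
      case False
      then have "\<bar>p' - q\<bar> < d" using that d(1) by linarith
      then have "g p' < g q + m / 2" using d(2)[of p'] by linarith
      then show ?thesis using m(2)[of q] qp by auto
    qed
    then show ?thesis using that[of "d/2"] d(1) by simp
  qed
  obtain d where d: "d > 0" "\<And>t. 0 < t \<Longrightarrow> \<bar>t - t0\<bar> < d \<Longrightarrow> \<bar>f' t - f' t0\<bar> < m / 8"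
    using f t0 m(1) unfolding C1_real_def continuous_on_iff dist_real_def
    by (metis greaterThan_iff zero_less_divide_iff zero_less_numeral)
  define r where "r = min (min r0 R) (min d t0) / 2"
  have r: "r > 0" "r < r0" "r < R" "r < d" "r < t0" using below(1) R(1) d(1) t0 by (auto simp: r_def)
  define k where "k = m / (16 * r)"
  have k: "k > 0" using m r by (simp add: k_def)
  define D where "D = p - q + e"
  have D: "D > 0" using e qp by (simp add: D_def)
  define c where "c = min (e * r) (k * r\<^sup>2) / 2"
  have c: "c > 0" "c < e * r" "c < k * r\<^sup>2"
  proof -
    have "e * r > 0" "k * r\<^sup>2 > 0" using e r k by auto
    then show "c > 0" "c < e * r" "c < k * r\<^sup>2" unfolding c_def by linarith+
  qed
  define l where "l = D / c"
  have l: "l > 0" "D / l = c" using D c by (auto simp: l_def)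
  define h where "h = (\<lambda>y::real. (q - e) * y + D * (y / (1 + l * \<bar>y\<bar>)))"
  define h' where "h' = (\<lambda>y::real. (q - e) + D * (1 / (1 + l * \<bar>y\<bar>)\<^sup>2))"
  have ramp: "D * (y / (1 + l * \<bar>y\<bar>)) \<le> c" if "0 \<le> y" for y
  proof -
    have "1 + l * y > 0" using that l by (simp add: add_pos_nonneg)
    moreover have "D * y \<le> c * (1 + l * y)" using l c D by (auto simp: l_def field_simps)
    ultimately show ?thesis using that by (simp add: divide_le_eq)
  qed
  have h_C1: "C1_real UNIV (\<lambda>x. h (s * (x - x0))) (\<lambda>x. s * h' (s * (x - x0)))"
  proof (rule C1_realI)
    have "1 + l * \<bar>s * (x - x0)\<bar> \<noteq> 0" for x using l by (smt (verit) abs_ge_zero mult_nonneg_nonneg)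
    then show "continuous_on UNIV (\<lambda>x. s * h' (s * (x - x0)))"
      unfolding h'_def by (intro continuous_intros) auto
    fix x
    have "(h has_real_derivative h' y) (at y)" for y
      unfolding h_def h'_def using DERIV_add[OF DERIV_cmult[OF DERIV_ident] DERIV_cmult[OF DERIV_soft_ramp[of l y]]] l
      by simp
    then have "((\<lambda>x. h (s * (x - x0))) has_real_derivative h' (s * (x - x0)) * s) (at x)"
      by (rule DERIV_chain2) (auto intro!: derivative_eq_intros)
    then show "((\<lambda>x. h (s * (x - x0))) has_real_derivative s * h' (s * (x - x0))) (at x)"
      by (simp add: mult.commute)
  qed
  define N where "N = (\<lambda>t y. V (t, x0 + s * y) - V (t0, x0) - (f t - f t0) + k * (t - t0)\<^sup>2 - h y)"
  let ?B = "{t0 - r..t0 + r} \<times> {0..r}"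
  have pos: "0 < t" if "t \<in> {t0 - r..t0 + r}" for t using that r by auto
  have "usc_on ?B (\<lambda>z. - V (fst z, x0 + s * snd z) + (V (t0, x0) + (f (fst z) - f t0) - k * (fst z - t0)\<^sup>2 + h (snd z)))"
  proof (rule usc_on_add)
    show "usc_on ?B (\<lambda>z. - V (fst z, x0 + s * snd z))"
      by (rule usc_on_compose[OF lsc, of ?B "\<lambda>z. (fst z, x0 + s * snd z)"])
         (use r in \<open>auto intro!: continuous_intros\<close>)
    have "continuous_on ?B (\<lambda>z. f (fst z))"
      by (rule continuous_on_compose2[OF C1_real_continuous[OF f]]) (use r in \<open>auto intro!: continuous_intros\<close>)
    moreover have "1 + l * \<bar>snd z\<bar> \<noteq> 0" for z :: "real \<times> real" using l by (smt (verit) abs_ge_zero mult_nonneg_nonneg)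
    ultimately show "usc_on ?B (\<lambda>z. V (t0, x0) + (f (fst z) - f t0) - k * (fst z - t0)\<^sup>2 + h (snd z))"
      unfolding h_def by (intro continuous_imp_usc_on continuous_intros) auto
  qed
  moreover have "compact ?B" "?B \<noteq> {}" using r by (auto intro!: compact_Times)
  ultimately obtain z1 where "z1 \<in> ?B" and z1: "\<And>w. w \<in> ?B \<Longrightarrow>
    - V (fst w, x0 + s * snd w) + (V (t0, x0) + (f (fst w) - f t0) - k * (fst w - t0)\<^sup>2 + h (snd w))
    \<le> - V (fst z1, x0 + s * snd z1) + (V (t0, x0) + (f (fst z1) - f t0) - k * (fst z1 - t0)\<^sup>2 + h (snd z1))"
    using usc_on_attains_max by blast
  define t1 y1 where "t1 = fst z1" and "y1 = snd z1"
  have t1: "t1 \<in> {t0 - r..t0 + r}" and y1: "y1 \<in> {0..r}"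
    using \<open>z1 \<in> ?B\<close> unfolding t1_def y1_def by (simp_all add: mem_Times_iff)
  have N_min: "N t1 y1 \<le> N t y" if "t \<in> {t0 - r..t0 + r}" "y \<in> {0..r}" for t y
  proof -
    have "(t, y) \<in> ?B" using that by simp
    from z1[OF this] show ?thesis unfolding N_def t1_def y1_def fst_conv snd_conv by linarith
  qed
  have N_ge: "N t y \<ge> k * (t - t0)\<^sup>2 + e * y - D * (y / (1 + l * \<bar>y\<bar>))"
    if "t \<in> {t0 - r..t0 + r}" "y \<in> {0..r}" for t y
    using below(2)[of t y] that r unfolding N_def h_def by (auto simp: algebra_simps)
  have "0 \<le> N t1 y1"
  proof (rule ccontr)
    assume neg: "\<not> 0 \<le> N t1 y1"
    have "k * (t1 - t0)\<^sup>2 \<ge> 0" using k by simp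
    then have "y1 \<noteq> 0" using N_ge[OF t1 y1] neg by auto
    have "y1 \<noteq> r"
    proof
      assume "y1 = r"
      then have "N t1 y1 \<ge> e * r - c" using N_ge[OF t1 y1] ramp[of y1] k r
        by (smt (verit) mult_nonneg_nonneg zero_le_power2)
      then show False using neg c by linarith
    qed
    have "\<bar>t1 - t0\<bar> \<noteq> r"
    proof
      assume "\<bar>t1 - t0\<bar> = r"
      then have "(t1 - t0)\<^sup>2 = r\<^sup>2" by (metis power2_abs)
      then have "N t1 y1 \<ge> k * r\<^sup>2 - c" using N_ge[OF t1 y1] ramp[of y1] e y1
        by (smt (verit) mult_nonneg_nonneg atLeastAtMost_iff)
      then show False using neg c by linarith
    qed
    then have int: "\<bar>t1 - t0\<bar> < r" "0 < y1" "y1 < r"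
      using t1 y1 \<open>y1 \<noteq> 0\<close> \<open>y1 \<noteq> r\<close> by auto
    define \<rho> where "\<rho> = min (r - \<bar>t1 - t0\<bar>) (min y1 (r - y1))"
    have "0 \<le> (f' t1 + (0 + 2 * (-k) * (t1 - t0))) + H (s * h' (s * ((x0 + s * y1) - x0)))"
    proof (rule visc_superD[OF V, where x = "x0 + s * y1" and t = t1 and r = \<rho>
          and f' = "\<lambda>t. f' t + (0 + 2 * (-k) * (t - t0))" and h' = "\<lambda>x. s * h' (s * (x - x0))"])
      show "C1_real {0<..} (\<lambda>t. f t + (0 * t + (-k) * (t - t0)\<^sup>2)) (\<lambda>t. f' t + (0 + 2 * (-k) * (t - t0)))"
        by (intro C1_real_add f C1_real_quadratic)
      show "C1_real UNIV (\<lambda>x. h (s * (x - x0))) (\<lambda>x. s * h' (s * (x - x0)))" by (rule h_C1)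
      show "0 < t1" using pos t1 by blast
      show "x0 + s * y1 \<in> X" using R(2) int r by auto
      show "0 < \<rho>" using int by (auto simp: \<rho>_def)
      fix t x assume *: "\<bar>t - t1\<bar> < \<rho>" "\<bar>x - (x0 + s * y1)\<bar> < \<rho>"
      define y where "y = s * (x - x0)"
      have x: "x = x0 + s * y" using s by (auto simp: y_def)
      have "\<bar>y - y1\<bar> < \<rho>" using *(2) s unfolding x by (auto simp: abs_minus_commute algebra_simps)
      then have "N t1 y1 \<le> N t y" using *(1) unfolding \<rho>_def by (intro N_min) auto
      moreover have s1: "s * (x0 + s * y1 - x0) = y1" using s by auto
      moreover have s2: "s * (x - x0) = y" by (simp add: y_def)
      ultimately show "V (t1, x0 + s * y1) + (f t + (0 * t + - k * (t - t0)\<^sup>2) - (f t1 + (0 * t1 + - k * (t1 - t0)\<^sup>2)))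
         + (h (s * (x - x0)) - h (s * (x0 + s * y1 - x0))) \<le> V (t, x)"
        unfolding s1 s2 unfolding N_def x by linarith
    qed
    moreover have s1: "s * ((x0 + s * y1) - x0) = y1" using s by auto
    ultimately have "0 \<le> (f' t1 + (0 + 2 * (-k) * (t1 - t0))) + H (s * h' y1)" unfolding s1 by blast
    then have ge: "0 \<le> f' t1 - 2 * k * (t1 - t0) + H (s * h' y1)" by simp
    have slope: "q - e \<le> h' y1" "h' y1 \<le> p"
    proof -
      have "1 \<le> (1 + l * \<bar>y1\<bar>)\<^sup>2" using l by (intro one_le_power) auto
      moreover have "1 / Q \<le> 1" if "1 \<le> Q" for Q :: real using that by simp
      ultimately have "1 / (1 + l * \<bar>y1\<bar>)\<^sup>2 \<le> 1" by blast
      then have "D * (1 / (1 + l * \<bar>y1\<bar>)\<^sup>2) \<le> D" using mult_left_le[of "1 / (1 + l * \<bar>y1\<bar>)\<^sup>2" D] D by linarith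
      then show "h' y1 \<le> p" unfolding h'_def D_def by simp
      show "q - e \<le> h' y1" unfolding h'_def using D by simp
    qed
    have "g (h' y1) \<le> - m / 2" using e(2)[OF slope] .
    moreover have "\<bar>f' t1 - f' t0\<bar> < m / 8" using d(2)[of t1] int r pos[OF t1] by simp
    moreover have "\<bar>2 * k * (t1 - t0)\<bar> \<le> m / 8"
    proof -
      have "\<bar>2 * k * (t1 - t0)\<bar> = 2 * k * \<bar>t1 - t0\<bar>" using k by (simp add: abs_mult)
      also have "\<dots> \<le> 2 * k * r" using int k by (intro mult_left_mono) auto
      also have "\<dots> = m / 8" using r by (simp add: k_def)
      finally show ?thesis .
    qed
    ultimately show False using ge m(1) unfolding g_def by (simp add: abs_le_iff abs_less_iff)
  qed
  then have N_nonneg: "0 \<le> N t y" if "\<bar>t - t0\<bar> < r" "0 \<le> y" "y < r" for t y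
    using N_min[of t y] that by force
  show ?thesis
  proof (rule that[OF r(1), of "max k (D * l)"])
    show "0 \<le> max k (D * l)" using k by simp
    fix t y assume *: "\<bar>t - t0\<bar> < r" "0 \<le> y" "y < r"
    have "D * (y / (1 + l * \<bar>y\<bar>)) \<ge> D * y - D * l * y\<^sup>2"
    proof -
      have "y - l * y\<^sup>2 \<le> y / (1 + l * y)"
      proof -
        have "(y - l * y\<^sup>2) * (1 + l * y) \<le> y"
          using *(2) l by (simp add: algebra_simps power2_eq_square)
        moreover have "1 + l * y > 0" using *(2) l by (simp add: add_pos_nonneg)
        ultimately show ?thesis by (simp add: le_divide_eq)
      qed
      then have "D * (y - l * y\<^sup>2) \<le> D * (y / (1 + l * y))" using D by (intro mult_left_mono) auto
      then show ?thesis using *(2) by (simp add: algebra_simps)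
    qed
    then have "h y \<ge> p * y - D * l * y\<^sup>2" unfolding h_def D_def by (simp add: algebra_simps)
    moreover have "D * l * y\<^sup>2 \<le> max k (D * l) * y\<^sup>2" "k * (t - t0)\<^sup>2 \<le> max k (D * l) * (t - t0)\<^sup>2"
      by (intro mult_right_mono; simp)+
    ultimately show "V (t0, x0) + (f t - f t0) - max k (D * l) * (t - t0)\<^sup>2 + p * y - max k (D * l) * y\<^sup>2
        \<le> V (t, x0 + s * y)"
      using N_nonneg[OF *] unfolding N_def by linarith
  qed
qed

lemma steepen_sub:
  assumes U: "visc_sub H X U" and usc: "usc_on half_plane U"
    and H: "continuous_on UNIV H" and t0: "0 < t0" and s: "s = 1 \<or> s = -1"
    and R: "R > 0" "\<And>y. 0 < y \<Longrightarrow> y < R \<Longrightarrow> x0 + s * y \<in> X"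
    and f: "C1_real {0<..} f f'"
    and above: "r0 > 0" "\<And>t y. \<bar>t - t0\<bar> < r0 \<Longrightarrow> 0 \<le> y \<Longrightarrow> y < r0 \<Longrightarrow>
      U (t, x0 + s * y) \<le> U (t0, x0) + (f t - f t0) + q * y"
    and viol: "\<And>p'. p \<le> p' \<Longrightarrow> p' \<le> q \<Longrightarrow> 0 < f' t0 + H (s * p')"
  obtains r K where "r > 0" "K \<ge> 0" "\<And>t y. \<bar>t - t0\<bar> < r \<Longrightarrow> 0 \<le> y \<Longrightarrow> y < r \<Longrightarrow>
      U (t, x0 + s * y) \<le> U (t0, x0) + (f t - f t0) + K * (t - t0)\<^sup>2 + p * y + K * y\<^sup>2"
proof -
  have b: "- U (t0, x0) + (- f t - - f t0) + - q * y \<le> - U (t, x0 + s * y)"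
    if "\<bar>t - t0\<bar> < r0" "0 \<le> y" "y < r0" for t y using above(2)[OF that] by simp
  have v: "- f' t0 + - H (- (s * p')) < 0" if "- q \<le> p'" "p' \<le> - p" for p'
    using viol[of "- p'"] that by simp
  have c: "continuous_on UNIV (\<lambda>q. - H (- q))"
    by (intro continuous_intros continuous_on_compose2[OF H]) auto
  have l: "usc_on half_plane (\<lambda>z. - (- U z))" using usc by simp
  from steepen_super[OF visc_sub_uminus[OF U] l c t0 s R C1_real_uminus[OF f] above(1) b v]
  obtain r K where "r > 0" "K \<ge> 0" and *: "\<And>t y. \<bar>t - t0\<bar> < r \<Longrightarrow> 0 \<le> y \<Longrightarrow> y < r \<Longrightarrow>
      - U (t0, x0) + (- f t - - f t0) - K * (t - t0)\<^sup>2 + - p * y - K * y\<^sup>2 \<le> - U (t, x0 + s * y)"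
    by blast
  show ?thesis
  proof (rule that[OF \<open>r > 0\<close> \<open>K \<ge> 0\<close>])
    fix t y assume "\<bar>t - t0\<bar> < r" "0 \<le> y" "y < r"
    from *[OF this]
    show "U (t, x0 + s * y) \<le> U (t0, x0) + (f t - f t0) + K * (t - t0)\<^sup>2 + p * y + K * y\<^sup>2" by linarith
  qed
qed

lemma two_sided_super:
  assumes V: "visc_super H {x0} V" and t0: "0 < t0" and f: "C1_real {0<..} f f'"
    and right: "r1 > 0" "K1 \<ge> 0" "\<And>t y. \<bar>t - t0\<bar> < r1 \<Longrightarrow> 0 \<le> y \<Longrightarrow> y < r1 \<Longrightarrow>
      V (t0, x0) + (f t - f t0) - K1 * (t - t0)\<^sup>2 + p * y - K1 * y\<^sup>2 \<le> V (t, x0 + 1 * y)"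
    and left: "r2 > 0" "K2 \<ge> 0" "\<And>t y. \<bar>t - t0\<bar> < r2 \<Longrightarrow> 0 \<le> y \<Longrightarrow> y < r2 \<Longrightarrow>
      V (t0, x0) + (f t - f t0) - K2 * (t - t0)\<^sup>2 + (- p) * y - K2 * y\<^sup>2 \<le> V (t, x0 + (-1) * y)"
  shows "0 \<le> f' t0 + H p"
proof -
  define K where "K = max K1 K2"
  have "0 \<le> (f' t0 + (0 + 2 * (-K) * (t0 - t0))) + H (p + 2 * (-K) * (x0 - x0))"
  proof (rule visc_superD[OF V t0, where x = x0 and r = "min r1 r2"
        and f' = "\<lambda>t. f' t + (0 + 2 * (-K) * (t - t0))" and h' = "\<lambda>x. p + 2 * (-K) * (x - x0)"])
    show "C1_real {0<..} (\<lambda>t. f t + (0 * t + (-K) * (t - t0)\<^sup>2)) (\<lambda>t. f' t + (0 + 2 * (-K) * (t - t0)))"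
      by (intro C1_real_add f C1_real_quadratic)
    show "C1_real UNIV (\<lambda>x. p * x + (-K) * (x - x0)\<^sup>2) (\<lambda>x. p + 2 * (-K) * (x - x0))"
      by (rule C1_real_quadratic)
    fix t x assume *: "\<bar>t - t0\<bar> < min r1 r2" "\<bar>x - x0\<bar> < min r1 r2"
    have K: "K1 * (t - t0)\<^sup>2 \<le> K * (t - t0)\<^sup>2" "K1 * (x - x0)\<^sup>2 \<le> K * (x - x0)\<^sup>2"
      "K2 * (t - t0)\<^sup>2 \<le> K * (t - t0)\<^sup>2" "K2 * (x - x0)\<^sup>2 \<le> K * (x - x0)\<^sup>2"
      unfolding K_def by (intro mult_right_mono; simp)+
    have "V (t0, x0) + (f t - f t0) - K * (t - t0)\<^sup>2 + p * (x - x0) - K * (x - x0)\<^sup>2 \<le> V (t, x)"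
    proof (cases "x0 \<le> x")
      case True
      then show ?thesis using right(3)[of t "x - x0"] * K by simp
    next
      case False
      then have "V (t0, x0) + (f t - f t0) - K2 * (t - t0)\<^sup>2 + (- p) * (x0 - x) - K2 * (x0 - x)\<^sup>2 \<le> V (t, x)"
        using left(3)[of t "x0 - x"] * by simp
      then show ?thesis using K by (simp add: algebra_simps power2_commute[of x x0])
    qed
    then show "V (t0, x0) + (f t + (0 * t + - K * (t - t0)\<^sup>2) - (f t0 + (0 * t0 + - K * (t0 - t0)\<^sup>2))) +
        (p * x + - K * (x - x0)\<^sup>2 - (p * x0 + - K * (x0 - x0)\<^sup>2)) \<le> V (t, x)"
      by (simp add: algebra_simps)
  qed (use right(1) left(1) in auto)
  then show ?thesis by simp
qed

lemma two_sided_sub: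
  assumes U: "visc_sub H {x0} U" and t0: "0 < t0" and f: "C1_real {0<..} f f'"
    and right: "r1 > 0" "K1 \<ge> 0" "\<And>t y. \<bar>t - t0\<bar> < r1 \<Longrightarrow> 0 \<le> y \<Longrightarrow> y < r1 \<Longrightarrow>
      U (t, x0 + 1 * y) \<le> U (t0, x0) + (f t - f t0) + K1 * (t - t0)\<^sup>2 + p * y + K1 * y\<^sup>2"
    and left: "r2 > 0" "K2 \<ge> 0" "\<And>t y. \<bar>t - t0\<bar> < r2 \<Longrightarrow> 0 \<le> y \<Longrightarrow> y < r2 \<Longrightarrow>
      U (t, x0 + (-1) * y) \<le> U (t0, x0) + (f t - f t0) + K2 * (t - t0)\<^sup>2 + (- p) * y + K2 * y\<^sup>2"
  shows "f' t0 + H p \<le> 0"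
proof -
  have "0 \<le> - f' t0 + - H (- (- p))"
  proof (rule two_sided_super[OF visc_sub_uminus[OF U] t0 C1_real_uminus[OF f] right(1,2) _ left(1,2)])
    fix t y assume "\<bar>t - t0\<bar> < r1" "0 \<le> y" "y < r1"
    from right(3)[OF this] show "- U (t0, x0) + (- f t - - f t0) - K1 * (t - t0)\<^sup>2 + - p * y - K1 * y\<^sup>2 \<le> - U (t, x0 + 1 * y)"
      by simp
  next
    fix t y assume "\<bar>t - t0\<bar> < r2" "0 \<le> y" "y < r2"
    from left(3)[OF this] show "- U (t0, x0) + (- f t - - f t0) - K2 * (t - t0)\<^sup>2 + - (- p) * y - K2 * y\<^sup>2 \<le> - U (t, x0 + - 1 * y)"
      by simp
  qed
  then show ?thesis by simp
qed

section \<open>Ishii conditions and junction conditions\<close>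

lemma half_line: "s = 1 \<or> s = -1 \<Longrightarrow> convex {x::real. 0 \<le> s * x}"
  by (elim disjE) (simp_all add: convex_real_interval flip: atLeast_def atMost_def)

text \<open>Turns contact with a test function into the one-sided bound by \<open>\<phi> (t, 0) + q * y\<close> from which
  slopes can be moved. The slope is strict to absorb the variation of the space derivative.\<close>
lemma touches_below_slope:
  assumes C1: "C1_on ({0<..} \<times> {x. 0 \<le> s * x}) \<phi> G" and s: "s = 1 \<or> s = -1"
    and touch: "touches_below \<phi> V (t0, 0)" and t0: "0 < t0" and q: "q < s * snd (G (t0, 0))"
  obtains r where "r > 0" "\<And>t y. \<bar>t - t0\<bar> < r \<Longrightarrow> 0 \<le> y \<Longrightarrow> y < r \<Longrightarrow>
      V (t0, 0) + (\<phi> (t, 0) - \<phi> (t0, 0)) + q * y \<le> V (t, 0 + s * y)"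
proof -
  define e where "e = s * snd (G (t0, 0)) - q"
  have e: "e > 0" using q by (simp add: e_def)
  obtain r1 where r1: "r1 > 0" "\<And>t y. \<bar>t - t0\<bar> < r1 \<Longrightarrow> \<bar>y - 0\<bar> < r1 \<Longrightarrow> y \<in> {x. 0 \<le> s * x} \<Longrightarrow>
       \<bar>\<phi> (t, y) - \<phi> (t, 0) - snd (G (t0, 0)) * (y - 0)\<bar> \<le> e * \<bar>y - 0\<bar>"
    using C1_on_space_estimate[OF C1 half_line[OF s] _ t0 e] by (metis mem_Collect_eq mult_zero_right order_refl)
  obtain r2 where r2: "r2 > 0" "\<And>t y. \<bar>t - t0\<bar> < r2 \<Longrightarrow> \<bar>y - 0\<bar> < r2 \<Longrightarrow> \<phi> (t, y) \<le> V (t, y)"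
    using touch unfolding touches_below_def eventually_nhds_box by blast
  have eq: "\<phi> (t0, 0) = V (t0, 0)" using touch by (simp add: touches_below_def)
  show ?thesis
  proof (rule that[of "min r1 r2"])
    fix t y assume *: "\<bar>t - t0\<bar> < min r1 r2" "0 \<le> y" "y < min r1 r2"
    have "\<bar>s * y\<bar> = y" "0 \<le> s * (s * y)" using s *(2) by auto
    then have "\<bar>\<phi> (t, s * y) - \<phi> (t, 0) - snd (G (t0, 0)) * (s * y)\<bar> \<le> e * y"
      and "\<phi> (t, s * y) \<le> V (t, s * y)"
      using r1(2)[of t "s * y"] r2(2)[of t "s * y"] * by auto
    moreover have "snd (G (t0, 0)) * (s * y) - e * y = q * y" by (simp add: e_def algebra_simps)
    ultimately show "V (t0, 0) + (\<phi> (t, 0) - \<phi> (t0, 0)) + q * y \<le> V (t, 0 + s * y)"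
      unfolding eq by (simp add: abs_le_iff)
  qed (use r1 r2 in auto)
qed

lemma C1_on_uminus: "C1_on S \<phi> G \<Longrightarrow> C1_on S (\<lambda>z. - \<phi> z) (\<lambda>z. - G z)"
  unfolding C1_on_def inner_minus_left by (simp add: continuous_on_minus has_derivative_minus)

lemma touches_above_slope:
  assumes C1: "C1_on ({0<..} \<times> {x. 0 \<le> s * x}) \<phi> G" and s: "s = 1 \<or> s = -1"
    and touch: "touches_above \<phi> U (t0, 0)" and t0: "0 < t0" and q: "s * snd (G (t0, 0)) < q"
  obtains r where "r > 0" "\<And>t y. \<bar>t - t0\<bar> < r \<Longrightarrow> 0 \<le> y \<Longrightarrow> y < r \<Longrightarrow>
      U (t, 0 + s * y) \<le> U (t0, 0) + (\<phi> (t, 0) - \<phi> (t0, 0)) + q * y"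
proof -
  have "touches_below (\<lambda>z. - \<phi> z) (\<lambda>z. - U z) (t0, 0)"
    using touch by (simp add: touches_above_def touches_below_def)
  moreover have "- q < s * snd (- G (t0, 0))" using q by simp
  ultimately obtain r where r: "r > 0" "\<And>t y. \<bar>t - t0\<bar> < r \<Longrightarrow> 0 \<le> y \<Longrightarrow> y < r \<Longrightarrow>
      - U (t0, 0) + (- \<phi> (t, 0) - - \<phi> (t0, 0)) + - q * y \<le> - U (t, 0 + s * y)"
    using touches_below_slope[OF C1_on_uminus[OF C1] s _ t0, of "\<lambda>z. - U z" "- q"] by blast
  show ?thesis
  proof (rule that[OF r(1)])
    fix t y assume "\<bar>t - t0\<bar> < r" "0 \<le> y" "y < r"
    from r(2)[OF this] show "U (t, 0 + s * y) \<le> U (t0, 0) + (\<phi> (t, 0) - \<phi> (t0, 0)) + q * y" by linarith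
  qed
qed

lemma junction_test_sides:
  assumes "junction_test \<phi> GL GR"
  shows "C1_on ({0<..} \<times> {x. 0 \<le> 1 * x}) \<phi> GR" "C1_on ({0<..} \<times> {x. 0 \<le> (-1) * x}) \<phi> GL"
    "C1_real {0<..} (\<lambda>t. \<phi> (t, 0)) (\<lambda>t. fst (GL (t, 0)))"
    "C1_real {0<..} (\<lambda>t. \<phi> (t, 0)) (\<lambda>t. fst (GR (t, 0)))"
proof -
  have J: "C1_on ({0<..} \<times> {..0}) \<phi> GL" "C1_on ({0<..} \<times> {0..}) \<phi> GR"
    using assms by (auto simp: junction_test_def)
  show "C1_on ({0<..} \<times> {x. 0 \<le> 1 * x}) \<phi> GR" "C1_on ({0<..} \<times> {x. 0 \<le> (-1) * x}) \<phi> GL"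
    using J by (simp_all add: atLeast_def atMost_def)
  show "C1_real {0<..} (\<lambda>t. \<phi> (t, 0)) (\<lambda>t. fst (GL (t, 0)))"
    "C1_real {0<..} (\<lambda>t. \<phi> (t, 0)) (\<lambda>t. fst (GR (t, 0)))"
    using C1_on_time_slice[OF J(1), of 0] C1_on_time_slice[OF J(2), of 0] by auto
qed

lemma junction_test_time_derivatives:
  assumes "junction_test \<phi> GL GR" "0 < t"
  shows "fst (GL (t, 0)) = fst (GR (t, 0))"
proof -
  have "at t within {0<..} = at t" using assms(2) by (intro at_within_open) auto
  then have "((\<lambda>t. \<phi> (t, 0)) has_real_derivative fst (GL (t, 0))) (at t)"
    "((\<lambda>t. \<phi> (t, 0)) has_real_derivative fst (GR (t, 0))) (at t)"
    using junction_test_sides(3,4)[OF assms(1)] assms(2) unfolding C1_real_def by force+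
  then show ?thesis by (rule DERIV_unique)
qed

text \<open>Whenever the slopes of a kinked test function can be moved to a common slope \<open>p\<close> on both
  sides, the condition with \<open>C\<^sup>1\<close> test functions at the junction applies with the slope \<open>p\<close>.\<close>
lemma super_at_common_slope:
  assumes lsc: "usc_on half_plane (\<lambda>z. - V z)"
    and V: "visc_super H1 {..<0} V" "visc_super H2 {0<..} V" "visc_super H {0} V"
    and H: "continuous_on UNIV H1" "continuous_on UNIV H2"
    and \<phi>: "junction_test \<phi> GL GR" "0 < t0" "touches_below \<phi> V (t0, 0)" and e: "e > 0"
    and right: "\<And>p'. snd (GR (t0, 0)) - e \<le> p' \<Longrightarrow> p' \<le> p \<Longrightarrow> fst (GL (t0, 0)) + H2 p' < 0"
    and left: "\<And>p'. p \<le> p' \<Longrightarrow> p' \<le> snd (GL (t0, 0)) + e \<Longrightarrow> fst (GL (t0, 0)) + H1 p' < 0"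
  shows "0 \<le> fst (GL (t0, 0)) + H p"
proof -
  note J = junction_test_sides[OF \<phi>(1)]
  have sign: "(1::real) = 1 \<or> (1::real) = -1" "(-1::real) = 1 \<or> (-1::real) = -1" by auto
  have sides: "\<And>y::real. 0 < y \<Longrightarrow> y < 1 \<Longrightarrow> 0 + 1 * y \<in> {0<..}"
    "\<And>y::real. 0 < y \<Longrightarrow> y < 1 \<Longrightarrow> 0 + (-1) * y \<in> {..<0}" by auto
  have "snd (GR (t0, 0)) - e < 1 * snd (GR (t0, 0))" using e by simp
  from touches_below_slope[OF J(1) sign(1) \<phi>(3,2) this] obtain r where
    r: "r > 0" "\<And>t y. \<bar>t - t0\<bar> < r \<Longrightarrow> 0 \<le> y \<Longrightarrow> y < r \<Longrightarrow>
      V (t0, 0) + (\<phi> (t, 0) - \<phi> (t0, 0)) + (snd (GR (t0, 0)) - e) * y \<le> V (t, 0 + 1 * y)"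
    by blast
  have v: "fst (GL (t0, 0)) + H2 (1 * p') < 0" if "snd (GR (t0, 0)) - e \<le> p'" "p' \<le> p" for p'
    using right[OF that] by simp
  from steepen_super[where p = p, OF V(2) lsc H(2) \<phi>(2) sign(1) zero_less_one sides(1) J(3) r v] obtain r1 K1 where
    1: "r1 > 0" "K1 \<ge> 0" "\<And>t y. \<bar>t - t0\<bar> < r1 \<Longrightarrow> 0 \<le> y \<Longrightarrow> y < r1 \<Longrightarrow>
      V (t0, 0) + (\<phi> (t, 0) - \<phi> (t0, 0)) - K1 * (t - t0)\<^sup>2 + p * y - K1 * y\<^sup>2 \<le> V (t, 0 + 1 * y)"
    by blast
  have "- snd (GL (t0, 0)) - e < -1 * snd (GL (t0, 0))" using e by simp
  from touches_below_slope[OF J(2) sign(2) \<phi>(3,2) this] obtain r' where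
    r': "r' > 0" "\<And>t y. \<bar>t - t0\<bar> < r' \<Longrightarrow> 0 \<le> y \<Longrightarrow> y < r' \<Longrightarrow>
      V (t0, 0) + (\<phi> (t, 0) - \<phi> (t0, 0)) + (- snd (GL (t0, 0)) - e) * y \<le> V (t, 0 + (-1) * y)"
    by blast
  have v': "fst (GL (t0, 0)) + H1 ((-1) * p') < 0" if "- snd (GL (t0, 0)) - e \<le> p'" "p' \<le> - p" for p'
    using left[of "- p'"] that by simp
  from steepen_super[where p = "- p", OF V(1) lsc H(1) \<phi>(2) sign(2) zero_less_one sides(2) J(3) r' v'] obtain r2 K2 where
    2: "r2 > 0" "K2 \<ge> 0" "\<And>t y. \<bar>t - t0\<bar> < r2 \<Longrightarrow> 0 \<le> y \<Longrightarrow> y < r2 \<Longrightarrow>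
      V (t0, 0) + (\<phi> (t, 0) - \<phi> (t0, 0)) - K2 * (t - t0)\<^sup>2 + (- p) * y - K2 * y\<^sup>2 \<le> V (t, 0 + (-1) * y)"
    by blast
  show ?thesis by (rule two_sided_super[OF V(3) \<phi>(2) J(3) 1 2])
qed

lemma sub_at_common_slope:
  assumes usc: "usc_on half_plane U"
    and U: "visc_sub H1 {..<0} U" "visc_sub H2 {0<..} U" "visc_sub H {0} U"
    and H: "continuous_on UNIV H1" "continuous_on UNIV H2"
    and \<phi>: "junction_test \<phi> GL GR" "0 < t0" "touches_above \<phi> U (t0, 0)" and e: "e > 0"
    and right: "\<And>p'. p \<le> p' \<Longrightarrow> p' \<le> snd (GR (t0, 0)) + e \<Longrightarrow> 0 < fst (GL (t0, 0)) + H2 p'"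
    and left: "\<And>p'. snd (GL (t0, 0)) - e \<le> p' \<Longrightarrow> p' \<le> p \<Longrightarrow> 0 < fst (GL (t0, 0)) + H1 p'"
  shows "fst (GL (t0, 0)) + H p \<le> 0"
proof -
  note J = junction_test_sides[OF \<phi>(1)]
  have sign: "(1::real) = 1 \<or> (1::real) = -1" "(-1::real) = 1 \<or> (-1::real) = -1" by auto
  have sides: "\<And>y::real. 0 < y \<Longrightarrow> y < 1 \<Longrightarrow> 0 + 1 * y \<in> {0<..}"
    "\<And>y::real. 0 < y \<Longrightarrow> y < 1 \<Longrightarrow> 0 + (-1) * y \<in> {..<0}" by auto
  have "1 * snd (GR (t0, 0)) < snd (GR (t0, 0)) + e" using e by simp
  from touches_above_slope[OF J(1) sign(1) \<phi>(3,2) this] obtain r where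
    r: "r > 0" "\<And>t y. \<bar>t - t0\<bar> < r \<Longrightarrow> 0 \<le> y \<Longrightarrow> y < r \<Longrightarrow>
      U (t, 0 + 1 * y) \<le> U (t0, 0) + (\<phi> (t, 0) - \<phi> (t0, 0)) + (snd (GR (t0, 0)) + e) * y"
    by blast
  have v: "0 < fst (GL (t0, 0)) + H2 (1 * p')" if "p \<le> p'" "p' \<le> snd (GR (t0, 0)) + e" for p'
    using right[OF that] by simp
  from steepen_sub[where p = p, OF U(2) usc H(2) \<phi>(2) sign(1) zero_less_one sides(1) J(3) r v] obtain r1 K1 where
    1: "r1 > 0" "K1 \<ge> 0" "\<And>t y. \<bar>t - t0\<bar> < r1 \<Longrightarrow> 0 \<le> y \<Longrightarrow> y < r1 \<Longrightarrow>
      U (t, 0 + 1 * y) \<le> U (t0, 0) + (\<phi> (t, 0) - \<phi> (t0, 0)) + K1 * (t - t0)\<^sup>2 + p * y + K1 * y\<^sup>2"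
    by blast
  have "-1 * snd (GL (t0, 0)) < - snd (GL (t0, 0)) + e" using e by simp
  from touches_above_slope[OF J(2) sign(2) \<phi>(3,2) this] obtain r' where
    r': "r' > 0" "\<And>t y. \<bar>t - t0\<bar> < r' \<Longrightarrow> 0 \<le> y \<Longrightarrow> y < r' \<Longrightarrow>
      U (t, 0 + (-1) * y) \<le> U (t0, 0) + (\<phi> (t, 0) - \<phi> (t0, 0)) + (- snd (GL (t0, 0)) + e) * y"
    by blast
  have v': "0 < fst (GL (t0, 0)) + H1 ((-1) * p')" if "- p \<le> p'" "p' \<le> - snd (GL (t0, 0)) + e" for p'
    using left[of "- p'"] that by simp
  from steepen_sub[where p = "- p", OF U(1) usc H(1) \<phi>(2) sign(2) zero_less_one sides(2) J(3) r' v'] obtain r2 K2 where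
    2: "r2 > 0" "K2 \<ge> 0" "\<And>t y. \<bar>t - t0\<bar> < r2 \<Longrightarrow> 0 \<le> y \<Longrightarrow> y < r2 \<Longrightarrow>
      U (t, 0 + (-1) * y) \<le> U (t0, 0) + (\<phi> (t, 0) - \<phi> (t0, 0)) + K2 * (t - t0)\<^sup>2 + (- p) * y + K2 * y\<^sup>2"
    by blast
  show ?thesis by (rule two_sided_sub[OF U(3) \<phi>(2) J(3) 1 2])
qed

text \<open>A test function on one closed side agrees near any point off the junction with one defined
  everywhere: compose it with a \<open>C\<^sup>1\<close> retraction onto that side which is the identity near the point.\<close>
lemma C1_on_extend:
  assumes C1: "C1_on ({0<..} \<times> {x. 0 \<le> s * x}) \<phi> G" and s: "s = 1 \<or> s = -1" and x0: "0 < s * x0"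
  obtains \<psi> K r where "C1_on ({0<..} \<times> UNIV) \<psi> K" "\<And>t. K (t, x0) = G (t, x0)" "r > 0"
    "\<And>t x. \<bar>x - x0\<bar> < r \<Longrightarrow> \<psi> (t, x) = \<phi> (t, x)"
proof -
  define c where "c = s * x0 / 2"
  have c: "c > 0" using x0 by (simp add: c_def)
  define \<kappa> where "\<kappa> = (\<lambda>x. x + s / (4 * c) * (max 0 (- s * x - (- c)))\<^sup>2)"
  define \<kappa>' where "\<kappa>' = (\<lambda>x. 1 + s / (4 * c) * (2 * max 0 (- s * x - (- c)) * (- s)))"
  have \<kappa>_deriv: "(\<kappa> has_real_derivative \<kappa>' x) (at x)" for x
    unfolding \<kappa>_def \<kappa>'_def
    by (intro DERIV_add DERIV_ident DERIV_cmult DERIV_chain2[OF DERIV_pos_part_square])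
       (auto intro!: derivative_eq_intros)
  have \<kappa>_side: "0 \<le> s * \<kappa> x" for x
  proof -
    define y where "y = s * x"
    have "s * s = 1" using s by auto
    then have eq: "s * \<kappa> x = y + (max 0 (c - y))\<^sup>2 / (4 * c)"
      unfolding \<kappa>_def y_def by (simp add: algebra_simps)
    have "0 \<le> y + (c - y)\<^sup>2 / (4 * c)"
    proof -
      have "y + (c - y)\<^sup>2 / (4 * c) = (c + y)\<^sup>2 / (4 * c)"
        using c by (simp add: field_simps power2_eq_square)
      then show ?thesis using c by simp
    qed
    then show ?thesis unfolding eq using c by (cases "y \<le> c") (auto simp: max_def)
  qed
  have \<kappa>_id: "\<kappa> x = x" "\<kappa>' x = 1" if "\<bar>x - x0\<bar> < c" for x
  proof -
    have "\<bar>s * x - s * x0\<bar> < c" using that s by auto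
    then have "c < s * x" unfolding c_def by linarith
    then have "max 0 (- s * x - (- c)) = 0" by simp
    then show "\<kappa> x = x" "\<kappa>' x = 1" by (auto simp: \<kappa>_def \<kappa>'_def)
  qed
  define m where "m = (\<lambda>z::real \<times> real. (fst z, \<kappa> (snd z)))"
  define K where "K = (\<lambda>z. (fst (G (m z)), \<kappa>' (snd z) * snd (G (m z))))"
  have \<kappa>_cont: "continuous_on A \<kappa>" for A
    using \<kappa>_deriv by (meson DERIV_isCont continuous_at_imp_continuous_on)
  have m_cont: "continuous_on A m" for A
    unfolding m_def by (intro continuous_intros continuous_on_compose2[OF \<kappa>_cont[of UNIV]]) auto
  have m_in: "m ` ({0<..} \<times> UNIV) \<subseteq> {0<..} \<times> {x. 0 \<le> s * x}" using \<kappa>_side by (auto simp: m_def)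
  have "C1_on ({0<..} \<times> UNIV) (\<lambda>z. \<phi> (m z)) K"
    unfolding C1_on_def
  proof (intro conjI ballI)
    have "continuous_on ({0<..} \<times> UNIV) (\<lambda>z. G (m z))"
      using C1 m_in unfolding C1_on_def by (intro continuous_on_compose2[OF _ m_cont]) auto
    moreover have "continuous_on A \<kappa>'" for A
      unfolding \<kappa>'_def by (intro continuous_intros)
    ultimately show "continuous_on ({0<..} \<times> UNIV) K"
      unfolding K_def by (intro continuous_intros continuous_on_compose2[of UNIV \<kappa>' _ snd]) auto
    fix z :: "real \<times> real" assume z: "z \<in> {0<..} \<times> UNIV"
    have "(\<phi> has_derivative (\<lambda>h. G (m z) \<bullet> h)) (at (m z) within m ` ({0<..} \<times> UNIV))"
      using C1 m_in z unfolding C1_on_def by (blast intro: has_derivative_subset)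
    moreover have "(m has_derivative (\<lambda>h. (fst h, \<kappa>' (snd z) * snd h))) (at z within {0<..} \<times> UNIV)"
    proof -
      have "((\<lambda>z. \<kappa> (snd z)) has_derivative (\<lambda>h. \<kappa>' (snd z) * snd h)) (at z within {0<..} \<times> UNIV)"
        by (rule has_derivative_compose[OF has_derivative_snd[OF has_derivative_ident]
              \<kappa>_deriv[unfolded has_field_derivative_def]])
      then show ?thesis unfolding m_def by (intro has_derivative_Pair derivative_intros)
    qed
    ultimately have "((\<phi> \<circ> m) has_derivative ((\<lambda>h. G (m z) \<bullet> h) \<circ> (\<lambda>h. (fst h, \<kappa>' (snd z) * snd h))))
        (at z within {0<..} \<times> UNIV)"
      by (intro diff_chain_within)
    then show "((\<lambda>z. \<phi> (m z)) has_derivative (\<lambda>h. K z \<bullet> h)) (at z within {0<..} \<times> UNIV)"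
      by (simp add: o_def K_def inner_prod_def mult_ac)
  qed
  moreover have "K (t, x0) = G (t, x0)" for t using \<kappa>_id[of x0] c by (simp add: K_def m_def)
  moreover have "\<phi> (m (t, x)) = \<phi> (t, x)" if "\<bar>x - x0\<bar> < c" for t x using \<kappa>_id[OF that] by (simp add: m_def)
  ultimately show ?thesis using that[of "\<lambda>z. \<phi> (m z)" K c] c by blast
qed

lemma touches_local:
  assumes "r > 0" "\<And>t x. \<bar>x - x0\<bar> < r \<Longrightarrow> \<psi> (t, x) = \<phi> (t, x)"
  shows "touches_above \<phi> U (t0, x0) \<Longrightarrow> touches_above \<psi> U (t0, x0)"
    and "touches_below \<phi> U (t0, x0) \<Longrightarrow> touches_below \<psi> U (t0, x0)"
proof -
  have "eventually (\<lambda>z. \<psi> z = \<phi> z) (nhds (t0, x0))"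
    unfolding eventually_nhds_box using assms by (intro exI[of _ r]) auto
  then show "touches_above \<phi> U (t0, x0) \<Longrightarrow> touches_above \<psi> U (t0, x0)"
    and "touches_below \<phi> U (t0, x0) \<Longrightarrow> touches_below \<psi> U (t0, x0)"
    using assms(2)[of x0 t0] assms(1) unfolding touches_above_def touches_below_def
    by (auto elim: eventually_elim2)
qed

context hamiltonian begin

lemma isCont_H_minus: "isCont (H_minus H p) q" and isCont_H_plus: "isCont (H_plus H p) q"
proof -
  have "continuous_on UNIV (\<lambda>q. H (min q p))" "continuous_on UNIV (\<lambda>q. H (max q p))"
    by (auto intro!: continuous_on_compose2[OF continuous] continuous_intros)
  then show "isCont (H_minus H p) q" "isCont (H_plus H p) q"
    by (simp_all add: H_minus_eq[abs_def] H_plus_eq[abs_def] continuous_on_eq_continuous_at)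
qed

end

lemma isCont_strict:
  fixes f :: "real \<Rightarrow> real"
  assumes f: "isCont f q"
  shows "f q < c \<Longrightarrow> \<exists>e>0. f (q - e) < c \<and> f (q + e) < c"
    and "c < f q \<Longrightarrow> \<exists>e>0. c < f (q - e) \<and> c < f (q + e)"
proof -
  have *: "\<exists>e>0. \<bar>f (q - e) - f q\<bar> < d \<and> \<bar>f (q + e) - f q\<bar> < d" if d: "d > 0" for d
  proof -
    obtain s where s: "s > 0" "\<forall>x. \<bar>x - q\<bar> < s \<longrightarrow> \<bar>f x - f q\<bar> < d"
      using f[unfolded continuous_at_eps_delta, THEN spec, of d] d unfolding dist_real_def by blast
    then show ?thesis by (intro exI[of _ "s/2"]) auto
  qed
  show "\<exists>e>0. f (q - e) < c \<and> f (q + e) < c" if "f q < c"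
  proof -
    obtain e where "e > 0" "\<bar>f (q - e) - f q\<bar> < c - f q" "\<bar>f (q + e) - f q\<bar> < c - f q"
      using *[of "c - f q"] \<open>f q < c\<close> by auto
    then show ?thesis by (intro exI[of _ e]) linarith
  qed
  show "\<exists>e>0. c < f (q - e) \<and> c < f (q + e)" if "c < f q"
  proof -
    obtain e where "e > 0" "\<bar>f (q - e) - f q\<bar> < f q - c" "\<bar>f (q + e) - f q\<bar> < f q - c"
      using *[of "f q - c"] \<open>c < f q\<close> by auto
    then show ?thesis by (intro exI[of _ e]) linarith
  qed
qed

context junction begin

text \<open>If the junction condition for \<open>Aplus\<close> failed for a kinked test function, its slopes could be moved
  to any \<open>p\<close> at which both Hamiltonians are below the level given by the time derivative. That level
  exceeds \<open>Aplus\<close>, so such a \<open>p\<close> exists, and the Ishii condition fails for it.\<close>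
lemma super_flux_Aplus:
  assumes lsc: "usc_on half_plane (\<lambda>z. - V z)"
    and V: "visc_super H1 {..<0} V" "visc_super H2 {0<..} V" "visc_super (\<lambda>q. max (H1 q) (H2 q)) {0} V"
    and \<phi>: "junction_test \<phi> GL GR" "0 < t0" "touches_below \<phi> V (t0, 0)"
  shows "0 \<le> fst (GL (t0, 0)) + F Aplus (snd (GL (t0, 0))) (snd (GR (t0, 0)))"
proof (rule ccontr)
  define a q1 q2 where "a = fst (GL (t0, 0))" and "q1 = snd (GL (t0, 0))" and "q2 = snd (GR (t0, 0))"
  assume "\<not> ?thesis"
  then have "F Aplus q1 q2 < - a" by (simp add: a_def q1_def q2_def)
  then have B: "Aplus < - a" "H_plus H1 p1 q1 < - a" "H_minus H2 p2 q2 < - a" by (auto simp: flux_less_iff)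
  obtain e1 where e1: "e1 > 0" "H_plus H1 p1 (q1 + e1) < - a"
    using isCont_strict(1)[OF H1.isCont_H_plus B(2)] by blast
  obtain e2 where e2: "e2 > 0" "H_minus H2 p2 (q2 - e2) < - a"
    using isCont_strict(1)[OF H2.isCont_H_minus B(3)] by blast
  obtain p where p: "H1 p < - a" "H2 p < - a" using common_sublevel[OF B(1)] by blast
  \<comment> \<open>All slopes between \<open>p\<close> and those of the test function stay in the sublevel sets.\<close>
  have right: "a + H2 p' < 0" if "q2 - e2 \<le> p'" "p' \<le> p" for p'
  proof (cases "p' \<le> p2")
    case True
    then have "H2 p' = H_minus H2 p2 p'" by (auto simp: H2.H_minus_eq)
    then show ?thesis using H2.H_minus_antimono[OF that(1)] e2 by simp
  next
    case False then show ?thesis using H2.increasing[of p' p] that p by auto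
  qed
  have left: "a + H1 p' < 0" if "p \<le> p'" "p' \<le> q1 + e1" for p'
  proof (cases "p1 \<le> p'")
    case True
    then have "H1 p' = H_plus H1 p1 p'" by (auto simp: H1.H_plus_eq max_def)
    then show ?thesis using H1.H_plus_mono[OF that(2)] e1 by simp
  next
    case False then show ?thesis using H1.decreasing[of p p'] that p by auto
  qed
  have "0 \<le> fst (GL (t0, 0)) + max (H1 p) (H2 p)"
    using super_at_common_slope[OF lsc V H1.continuous H2.continuous \<phi>, of "min e1 e2" p]
      e1 e2 left right unfolding a_def q1_def q2_def by force
  then show False using p unfolding a_def by auto
qed

text \<open>Here a common slope \<open>p\<close> at which both Hamiltonians are above the level \<open>- a\<close> given by the time
  derivative is excluded by the Ishii condition, as soon as the slopes of the test function can be
  moved to \<open>p\<close>. If a monotone part of one Hamiltonian is above the level, its slope can be moved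
  arbitrarily far, where coercivity makes the other Hamiltonian large as well. This leaves the case
  \<open>p2 < p1\<close>, in which a point where \<open>Astar\<close> is attained serves as \<open>p\<close>.\<close>
lemma sub_flux_Aminus:
  assumes usc: "usc_on half_plane U"
    and U: "visc_sub H1 {..<0} U" "visc_sub H2 {0<..} U" "visc_sub (\<lambda>q. min (H1 q) (H2 q)) {0} U"
    and \<phi>: "junction_test \<phi> GL GR" "0 < t0" "touches_above \<phi> U (t0, 0)"
  shows "fst (GL (t0, 0)) + F Aminus (snd (GL (t0, 0))) (snd (GR (t0, 0))) \<le> 0"
proof -
  define a q1 q2 where "a = fst (GL (t0, 0))" and "q1 = snd (GL (t0, 0))" and "q2 = snd (GR (t0, 0))"
  have no_slope: False
    if "e > 0" "\<And>p'. p \<le> p' \<Longrightarrow> p' \<le> q2 + e \<Longrightarrow> - a < H2 p'" "\<And>p'. q1 - e \<le> p' \<Longrightarrow> p' \<le> p \<Longrightarrow> - a < H1 p'"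
      "- a < H1 p" "- a < H2 p" for e p
  proof -
    have "a + min (H1 p) (H2 p) \<le> 0" unfolding a_def
    proof (rule sub_at_common_slope[OF usc U H1.continuous H2.continuous \<phi> \<open>e > 0\<close>])
      show "0 < fst (GL (t0, 0)) + H2 p'" if "p \<le> p'" "p' \<le> snd (GR (t0, 0)) + e" for p'
        using \<open>\<And>p'. p \<le> p' \<Longrightarrow> p' \<le> q2 + e \<Longrightarrow> - a < H2 p'\<close>[of p'] that unfolding a_def q2_def by linarith
      show "0 < fst (GL (t0, 0)) + H1 p'" if "snd (GL (t0, 0)) - e \<le> p'" "p' \<le> p" for p'
        using \<open>\<And>p'. q1 - e \<le> p' \<Longrightarrow> p' \<le> p \<Longrightarrow> - a < H1 p'\<close>[of p'] that unfolding a_def q1_def by linarith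
    qed
    then show False using that by auto
  qed
  obtain R1 where R1: "R1 > 0" "\<And>q. R1 \<le> \<bar>q\<bar> \<Longrightarrow> - a < H1 q" using H1.large_outside[of "- a"] by metis
  obtain R2 where R2: "R2 > 0" "\<And>q. R2 \<le> \<bar>q\<bar> \<Longrightarrow> - a < H2 q" using H2.large_outside[of "- a"] by metis
  have minus: "H_minus H2 p2 q2 \<le> - a"
  proof (rule ccontr)
    assume "\<not> ?thesis"
    then obtain e where e: "e > 0" "- a < H_minus H2 p2 (q2 + e)"
      using isCont_strict(2)[OF H2.isCont_H_minus, of "- a" q2] by auto
    \<comment> \<open>The right slope can be lowered indefinitely, in particular below the left one.\<close>
    define p where "p = - (R1 + R2 + \<bar>q1\<bar> + e)"
    show False
    proof (rule no_slope[OF e(1), of p])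
      fix p' assume "p' \<le> q2 + e"
      then show "- a < H2 p'" using H2.H_minus_antimono[of p' "q2 + e"] H2.H_minus_bounds(2)[of p'] e(2) by linarith
    next
      fix p' assume "q1 - e \<le> p'" "p' \<le> p"
      then show "- a < H1 p'" using R1(1) R2(1) unfolding p_def by linarith
    qed (use R1 R2 e in \<open>auto simp: p_def\<close>)
  qed
  have plus: "H_plus H1 p1 q1 \<le> - a"
  proof (rule ccontr)
    assume "\<not> ?thesis"
    then obtain e where e: "e > 0" "- a < H_plus H1 p1 (q1 - e)"
      using isCont_strict(2)[OF H1.isCont_H_plus, of "- a" q1] by auto
    define p where "p = R1 + R2 + \<bar>q2\<bar> + e"
    show False
    proof (rule no_slope[OF e(1), of p])
      fix p' assume "q1 - e \<le> p'"
      then show "- a < H1 p'" using H1.H_plus_mono[of "q1 - e" p'] H1.H_plus_bounds(2)[of p'] e(2) by linarith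
    next
      fix p' assume "p \<le> p'" "p' \<le> q2 + e"
      then show "- a < H2 p'" using R1(1) R2(1) unfolding p_def by linarith
    qed (use R1 R2 e in \<open>auto simp: p_def\<close>)
  qed
  have "Aminus \<le> - a"
  proof (rule ccontr)
    assume *: "\<not> ?thesis"
    have A0: "A0 \<le> - a"
      using minus plus H1.H_plus_bounds(1)[of q1] H2.H_minus_bounds(1)[of q2] by (auto simp: A_zero_def)
    then have p: "p2 < p1" "- a < Astar" using * by (auto simp: AI_minus_def AI_plus_def split: if_splits)
    obtain q where q: "p2 \<le> q" "q \<le> p1" "Astar = min (H1 q) (H2 q)"
      using A_star_attained p(1) by (metis less_imp_le max.absorb1 min.absorb2)
    \<comment> \<open>Left of \<open>q\<close> the first Hamiltonian is above its value at \<open>q\<close>, and right of \<open>q\<close> the second.\<close>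
    show False
    proof (rule no_slope[OF zero_less_one, of q])
      fix p' assume "q \<le> p'"
      then show "- a < H2 p'" using H2.increasing[of q p'] q p(2) by auto
    next
      fix p' assume "p' \<le> q"
      then show "- a < H1 p'" using H1.decreasing[of p' q] q p(2) by auto
    qed (use q p in auto)
  qed
  then have "F Aminus q1 q2 \<le> - a" using minus plus by (simp add: flux_le_iff)
  then show ?thesis by (simp add: a_def q1_def q2_def)
qed

theorem ishii_subsol_imp_junction_subsol:
  assumes u: "ishii_subsol H1 H2 u" shows "junction_subsol H1 H2 (F Aminus) u"
proof -
  have lb: "locally_bounded u" using u by (simp add: ishii_subsol_def)
  have tests: "(x < 0 \<longrightarrow> fst (G (t, x)) + H1 (snd (G (t, x))) \<le> 0) \<and> (0 < x \<longrightarrow> fst (G (t, x)) + H2 (snd (G (t, x))) \<le> 0)"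
    if "C1_on ({0<..} \<times> UNIV) \<phi> G" "0 < t" "touches_above \<phi> (upper_env u) (t, x)" for \<phi> G t x
    using u that unfolding ishii_subsol_def Let_def by metis
  have "jsub H1 H2 (F Aminus) (upper_env u)"
  proof (rule jsubI, intro conjI impI)
    fix \<phi> GL GR and t x :: real
    assume \<phi>: "junction_test \<phi> GL GR" "0 < t" "touches_above \<phi> (upper_env u) (t, x)"
    note J = junction_test_sides[OF \<phi>(1)]
    show "fst (GL (t, x)) + H1 (snd (GL (t, x))) \<le> 0" if x: "x < 0"
    proof -
      obtain \<psi> K r where "C1_on ({0<..} \<times> UNIV) \<psi> K" "\<And>t. K (t, x) = GL (t, x)" "r > 0"
        "\<And>t y. \<bar>y - x\<bar> < r \<Longrightarrow> \<psi> (t, y) = \<phi> (t, y)"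
        using C1_on_extend[OF J(2), of x] x by auto
      then show ?thesis using tests[of \<psi> K t x] touches_local(1)[of r x \<psi> \<phi>] \<phi>(2,3) x by metis
    qed
    show "fst (GR (t, x)) + H2 (snd (GR (t, x))) \<le> 0" if x: "0 < x"
    proof -
      obtain \<psi> K r where "C1_on ({0<..} \<times> UNIV) \<psi> K" "\<And>t. K (t, x) = GR (t, x)" "r > 0"
        "\<And>t y. \<bar>y - x\<bar> < r \<Longrightarrow> \<psi> (t, y) = \<phi> (t, y)"
        using C1_on_extend[OF J(1), of x] x by auto
      then show ?thesis using tests[of \<psi> K t x] touches_local(1)[of r x \<psi> \<phi>] \<phi>(2,3) x by metis
    qed
    show "fst (GL (t, 0)) + F Aminus (snd (GL (t, 0))) (snd (GR (t, 0))) \<le> 0" if "x = 0"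
      using sub_flux_Aminus[OF usc_upper_env[OF lb] ishii_subsol_imp_visc_sub[OF u] \<phi>(1,2)] \<phi>(3) that by simp
  qed
  then show ?thesis using lb by (simp add: junction_subsol_iff)
qed

theorem ishii_supersol_imp_junction_supersol:
  assumes u: "ishii_supersol H1 H2 u" shows "junction_supersol H1 H2 (F Aplus) u"
proof -
  have lb: "locally_bounded u" using u by (simp add: ishii_supersol_def)
  have tests: "(x < 0 \<longrightarrow> fst (G (t, x)) + H1 (snd (G (t, x))) \<ge> 0) \<and> (0 < x \<longrightarrow> fst (G (t, x)) + H2 (snd (G (t, x))) \<ge> 0)"
    if "C1_on ({0<..} \<times> UNIV) \<phi> G" "0 < t" "touches_below \<phi> (lower_env u) (t, x)" for \<phi> G t x
    using u that unfolding ishii_supersol_def Let_def by metis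
  have "jsuper H1 H2 (F Aplus) (lower_env u)"
  proof (rule jsuperI, intro conjI impI)
    fix \<phi> GL GR and t x :: real
    assume \<phi>: "junction_test \<phi> GL GR" "0 < t" "touches_below \<phi> (lower_env u) (t, x)"
    note J = junction_test_sides[OF \<phi>(1)]
    show "fst (GL (t, x)) + H1 (snd (GL (t, x))) \<ge> 0" if x: "x < 0"
    proof -
      obtain \<psi> K r where "C1_on ({0<..} \<times> UNIV) \<psi> K" "\<And>t. K (t, x) = GL (t, x)" "r > 0"
        "\<And>t y. \<bar>y - x\<bar> < r \<Longrightarrow> \<psi> (t, y) = \<phi> (t, y)"
        using C1_on_extend[OF J(2), of x] x by auto
      then show ?thesis using tests[of \<psi> K t x] touches_local(2)[of r x \<psi> \<phi>] \<phi>(2,3) x by metis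
    qed
    show "fst (GR (t, x)) + H2 (snd (GR (t, x))) \<ge> 0" if x: "0 < x"
    proof -
      obtain \<psi> K r where "C1_on ({0<..} \<times> UNIV) \<psi> K" "\<And>t. K (t, x) = GR (t, x)" "r > 0"
        "\<And>t y. \<bar>y - x\<bar> < r \<Longrightarrow> \<psi> (t, y) = \<phi> (t, y)"
        using C1_on_extend[OF J(1), of x] x by auto
      then show ?thesis using tests[of \<psi> K t x] touches_local(2)[of r x \<psi> \<phi>] \<phi>(2,3) x by metis
    qed
    show "fst (GL (t, 0)) + F Aplus (snd (GL (t, 0))) (snd (GR (t, 0))) \<ge> 0" if "x = 0"
      using super_flux_Aplus[OF usc_uminus_lower_env[OF lb] ishii_supersol_imp_visc_super[OF u] \<phi>(1,2)] \<phi>(3) that by simp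
  qed
  then show ?thesis using lb by (simp add: junction_supersol_iff)
qed

text \<open>A \<open>C\<^sup>1\<close> test function has the same slope \<open>q\<close> on both sides of the junction, so junction conditions
  imply Ishii conditions as soon as \<open>F A q q\<close> lies between the smaller and the larger of \<open>H1 q\<close> and
  \<open>H2 q\<close>. The lower bound can only fail for \<open>q\<close> on the branches that the flux does not see, which
  overlap between \<open>p2\<close> and \<open>p1\<close>; there \<open>Astar\<close> dominates the minimum. The upper bound can only fail
  if \<open>A\<close> exceeds both values.\<close>

lemma min_le_flux:
  assumes "Aminus \<le> A" shows "min (H1 q) (H2 q) \<le> F A q q"
proof (rule ccontr)
  assume "\<not> ?thesis"
  then have *: "A < min (H1 q) (H2 q)" "H_plus H1 p1 q < H1 q" "H_minus H2 p2 q < H2 q"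
    by (auto simp: flux_less_iff not_le)
  then have q: "p2 \<le> q" "q \<le> p1" by (auto simp: H_plus_def H_minus_def split: if_splits)
  show False
  proof (cases "p2 < p1")
    case True
    then have "min (H1 q) (H2 q) \<le> Astar" using A_star_attained q by (metis less_imp_le max.absorb1 min.absorb2)
    then show False using assms * True by (auto simp: AI_minus_def AI_plus_def)
  next
    case False
    then have "q = p1" using q by auto
    then show False using * H1.H_plus_bounds(1)[of q] by simp
  qed
qed

lemma flux_le_max:
  assumes "A \<le> Aplus" shows "F A q q \<le> max (H1 q) (H2 q)"
proof (rule ccontr)
  assume "\<not> ?thesis"
  then have "max (H1 q) (H2 q) < A"
    using H1.H_plus_bounds(2)[of q] H2.H_minus_bounds(2)[of q] by (auto simp: flux_def max_def split: if_splits)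
  then have B: "H1 q < Aplus" "H2 q < Aplus" using assms by auto
  then have star: "Astar = Aplus" using H1.minimal[of q] H2.minimal[of q] by (auto simp: AI_plus_def A_zero_def max_def split: if_splits)
  obtain c where c: "min p1 p2 \<le> c" "c \<le> max p1 p2" "Astar = min (H1 c) (H2 c)" by (rule A_star_attained)
  then have B: "H1 q < H1 c" "H2 q < H2 c" using B star by auto
  \<comment> \<open>Between \<open>p1\<close> and \<open>p2\<close> the two Hamiltonians vary in opposite directions.\<close>
  show False
    using B c(1,2) H1.increasing[of p1 c] H1.increasing[of c q] H2.decreasing[of q c] H1.decreasing[of q c] H2.increasing[of c q]
    by (cases "p1 \<le> p2"; cases "q \<le> c") (auto simp: min_def max_def split: if_splits)
qed

theorem junction_sol_imp_ishii_sol: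
  assumes A: "Aminus \<le> A" "A \<le> Aplus" and u: "junction_sol H1 H2 (F A) u"
  shows "ishii_sol H1 H2 u"
proof -
  have sub: "junction_subsol H1 H2 (F A) u" and super: "junction_supersol H1 H2 (F A) u"
    using u by (auto simp: junction_sol_def)
  have "ishii_subsol H1 H2 u"
    unfolding ishii_subsol_def Let_def
  proof (intro conjI allI impI)
    show "locally_bounded u" using sub by (simp add: junction_subsol_def)
    fix \<phi> G and t x :: real
    assume "C1_on ({0<..} \<times> UNIV) \<phi> G \<and> 0 < t \<and> touches_above \<phi> (upper_env u) (t, x)"
    then have *: "(x < 0 \<longrightarrow> fst (G (t, x)) + H1 (snd (G (t, x))) \<le> 0) \<and>
      (0 < x \<longrightarrow> fst (G (t, x)) + H2 (snd (G (t, x))) \<le> 0) \<and>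
      (x = 0 \<longrightarrow> fst (G (t, 0)) + F A (snd (G (t, 0))) (snd (G (t, 0))) \<le> 0)"
      using sub C1_on_imp_junction_test[of \<phi> G] unfolding junction_subsol_def by blast
    then show "x < 0 \<Longrightarrow> fst (G (t, x)) + H1 (snd (G (t, x))) \<le> 0"
      "0 < x \<Longrightarrow> fst (G (t, x)) + H2 (snd (G (t, x))) \<le> 0" by auto
    show "fst (G (t, x)) + min (H1 (snd (G (t, x)))) (H2 (snd (G (t, x)))) \<le> 0" if "x = 0"
      using min_le_flux[OF A(1), of "snd (G (t, 0))"] * that by auto
  qed
  moreover have "ishii_supersol H1 H2 u"
    unfolding ishii_supersol_def Let_def
  proof (intro conjI allI impI)
    show "locally_bounded u" using super by (simp add: junction_supersol_def)
    fix \<phi> G and t x :: real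
    assume "C1_on ({0<..} \<times> UNIV) \<phi> G \<and> 0 < t \<and> touches_below \<phi> (lower_env u) (t, x)"
    then have *: "(x < 0 \<longrightarrow> fst (G (t, x)) + H1 (snd (G (t, x))) \<ge> 0) \<and>
      (0 < x \<longrightarrow> fst (G (t, x)) + H2 (snd (G (t, x))) \<ge> 0) \<and>
      (x = 0 \<longrightarrow> fst (G (t, 0)) + F A (snd (G (t, 0))) (snd (G (t, 0))) \<ge> 0)"
      using super C1_on_imp_junction_test[of \<phi> G] unfolding junction_supersol_def by blast
    then show "x < 0 \<Longrightarrow> fst (G (t, x)) + H1 (snd (G (t, x))) \<ge> 0"
      "0 < x \<Longrightarrow> fst (G (t, x)) + H2 (snd (G (t, x))) \<ge> 0" by auto
    show "fst (G (t, x)) + max (H1 (snd (G (t, x)))) (H2 (snd (G (t, x)))) \<ge> 0" if "x = 0"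
      using flux_le_max[OF A(2), of "snd (G (t, 0))"] * that by auto
  qed
  ultimately show ?thesis by (simp add: ishii_sol_def)
qed

end

section \<open>Barriers\<close>

text \<open>A maximum over a time interval could sit at the final time, where nothing can be tested. It is kept
  away from there by a penalty that starts at \<open>tt\<close>. The penalty increases in time and thereby only
  strengthens what a sub-solution has to satisfy.\<close>
lemma positive_part_touches:
  assumes usc: "usc_on half_plane U" and f: "continuous_on {0..} f" and h: "continuous_on UNIV h"
    and init: "\<And>x. U (0, x) \<le> f 0 + h x"
    and pos: "0 \<le> tt" "f tt + h xx < U (tt, xx)"
    and bounded: "\<And>t x. 0 \<le> t \<Longrightarrow> t \<le> tt + 1 \<Longrightarrow> f t + h x \<le> U (t, x) \<Longrightarrow> \<bar>x\<bar> \<le> R"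
  obtains K t0 x0 r where "0 \<le> K" "0 < t0" "0 < r"
    "\<And>s y. \<bar>s - t0\<bar> < r \<Longrightarrow> \<bar>y - x0\<bar> < r \<Longrightarrow>
      U (s, y) \<le> U (t0, x0) + ((f s + K * (max 0 (s - tt))\<^sup>2) - (f t0 + K * (max 0 (t0 - tt))\<^sup>2)) + (h y - h x0)"
proof -
  define R' where "R' = \<bar>R\<bar> + \<bar>xx\<bar> + 1"
  let ?B = "{0..tt + 1} \<times> {- R'..R'}"
  have comp: "compact ?B" by (intro compact_Times) auto
  have in_B: "(tt, xx) \<in> ?B" using pos by (auto simp: R'_def)
  define Z0 where "Z0 = (\<lambda>z. U z + - (f (fst z) + h (snd z)))"
  have fh: "continuous_on ?B (\<lambda>z. f (fst z))" "continuous_on ?B (\<lambda>z. h (snd z))"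
    by (intro continuous_on_compose2[OF f, of _ fst] continuous_on_compose2[OF h, of _ snd];
        auto intro!: continuous_intros)+
  have Z0: "usc_on ?B Z0" unfolding Z0_def
    by (intro usc_on_add usc_on_subset[OF usc] continuous_imp_usc_on continuous_intros fh) auto
  obtain m where m: "\<And>w. w \<in> ?B \<Longrightarrow> Z0 w \<le> m"
    using usc_on_attains_max[OF Z0 comp] in_B by blast
  have m0: "0 < m" using m[OF in_B] pos(2) by (simp add: Z0_def)
  define K where "K = m + 1"
  define Z where "Z = (\<lambda>z. Z0 z + - (K * (max 0 (fst z - tt))\<^sup>2))"
  have "usc_on ?B Z" unfolding Z_def
    by (intro usc_on_add Z0 continuous_imp_usc_on continuous_intros)
  then obtain z0 where z0: "z0 \<in> ?B" "\<And>w. w \<in> ?B \<Longrightarrow> Z w \<le> Z z0"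
    using usc_on_attains_max[OF _ comp] in_B by blast
  obtain t0 x0 where z0_eq: "z0 = (t0, x0)" by (cases z0)
  have "0 < Z (tt, xx)" using pos(2) by (simp add: Z_def Z0_def)
  then have Zpos: "0 < Z (t0, x0)" using z0(2)[OF in_B] unfolding z0_eq by linarith
  have K: "0 \<le> K" using m0 by (simp add: K_def)
  then have Z0pos: "0 < Z0 (t0, x0)" using Zpos unfolding Z_def by (smt (verit) mult_nonneg_nonneg zero_le_power2)
  have t0: "0 \<le> t0" "t0 \<le> tt + 1" using z0(1) by (auto simp: z0_eq)
  have "t0 \<noteq> 0" using Z0pos init[of x0] by (auto simp: Z0_def)
  moreover have "t0 \<noteq> tt + 1"
  proof
    assume "t0 = tt + 1"
    then have "Z (t0, x0) = Z0 (t0, x0) - K" by (simp add: Z_def)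
    then show False using Zpos m[OF z0(1)] by (simp add: z0_eq K_def)
  qed
  moreover have "\<bar>x0\<bar> \<le> R" using bounded[OF t0] Z0pos by (simp add: Z0_def)
  ultimately have int: "0 < t0" "t0 < tt + 1" "\<bar>x0\<bar> < R'" using t0 by (auto simp: R'_def)
  show ?thesis
  proof (rule that[OF K int(1), of "min (min t0 (tt + 1 - t0)) (R' - \<bar>x0\<bar>)"])
    fix s y assume *: "\<bar>s - t0\<bar> < min (min t0 (tt + 1 - t0)) (R' - \<bar>x0\<bar>)"
      "\<bar>y - x0\<bar> < min (min t0 (tt + 1 - t0)) (R' - \<bar>x0\<bar>)"
    then have "(s, y) \<in> ?B" by auto
    from z0(2)[OF this] show "U (s, y) \<le> U (t0, x0) +
        ((f s + K * (max 0 (s - tt))\<^sup>2) - (f t0 + K * (max 0 (t0 - tt))\<^sup>2)) + (h y - h x0)"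
      unfolding z0_eq Z_def Z0_def by simp
  qed (use int in auto)
qed

lemma C1_real_hypot:
  fixes R :: real assumes "R \<noteq> 0"
  shows "C1_real S (\<lambda>x. sqrt (R\<^sup>2 + x\<^sup>2)) (\<lambda>x. x / sqrt (R\<^sup>2 + x\<^sup>2))"
proof (rule C1_realI)
  have pos: "0 < R\<^sup>2 + x\<^sup>2" for x using assms by (simp add: sum_power2_gt_zero_iff)
  then have "sqrt (R\<^sup>2 + x\<^sup>2) \<noteq> 0" for x by (metis less_irrefl real_sqrt_eq_zero_cancel_iff)
  then show "continuous_on S (\<lambda>x. x / sqrt (R\<^sup>2 + x\<^sup>2))" by (intro continuous_intros) auto
  fix x show "((\<lambda>x. sqrt (R\<^sup>2 + x\<^sup>2)) has_real_derivative x / sqrt (R\<^sup>2 + x\<^sup>2)) (at x)"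
    using pos[of x] by (auto intro!: derivative_eq_intros simp: field_simps)
qed

lemma abs_div_hypot_le: "\<bar>x / sqrt (R\<^sup>2 + x\<^sup>2)\<bar> \<le> (1::real)"
proof -
  have "\<bar>x\<bar> \<le> sqrt (R\<^sup>2 + x\<^sup>2)" by (rule real_le_rsqrt) simp
  moreover have "\<bar>x / s\<bar> \<le> 1" if "\<bar>x\<bar> \<le> s" for s
    using that by (cases "s = 0") (auto simp: divide_le_eq)
  ultimately show ?thesis by blast
qed

lemma hypot_lipschitz: "\<bar>sqrt (R\<^sup>2 + x\<^sup>2) - sqrt (R\<^sup>2 + y\<^sup>2)\<bar> \<le> \<bar>x - y :: real\<bar>"
  using norm_triangle_ineq3[of "(R, x)" "(R, y)"] by (simp add: norm_Pair)

lemma C1_real_linear: "C1_real S (\<lambda>t. c * t) (\<lambda>t. c)"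
  by (rule C1_realI) (auto intro!: derivative_eq_intros)

lemma linear_bound_of_lipschitz:
  assumes "C1_real UNIV G G'" "\<And>x. \<bar>G' x\<bar> \<le> L"
  shows "\<bar>G x\<bar> \<le> (\<bar>G 0\<bar> + L) * (1 + \<bar>x\<bar>)"
proof -
  have "norm (G x - G 0) \<le> L * norm (x - 0)"
    by (rule field_differentiable_bound[of UNIV G G']) (use assms in \<open>auto simp: C1_real_def\<close>)
  then have 1: "\<bar>G x - G 0\<bar> \<le> L * \<bar>x\<bar>" by simp
  have 2: "0 \<le> L" "0 \<le> \<bar>G 0\<bar> * \<bar>x\<bar>" using assms(2)[of 0] by auto
  have "(\<bar>G 0\<bar> + L) * (1 + \<bar>x\<bar>) = \<bar>G 0\<bar> + L + \<bar>G 0\<bar> * \<bar>x\<bar> + L * \<bar>x\<bar>"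
    by (simp add: algebra_simps)
  then show ?thesis using 1 2 by linarith
qed

lemma C1_real_shift: "C1_real S f f' \<Longrightarrow> C1_real S (\<lambda>x. f x + c) f'"
  using C1_real_add[OF _ C1_realI[of S "\<lambda>_. 0" "\<lambda>_. c"]] by force

text \<open>Mollification by a moving average.\<close>
lemma uniformly_continuous_approx:
  fixes g :: "real \<Rightarrow> real"
  assumes g: "uniformly_continuous_on UNIV g" and e: "e > 0"
  obtains G G' L where "C1_real UNIV G G'" "\<And>x. \<bar>G' x\<bar> \<le> L" "\<And>x. \<bar>G x - g x\<bar> \<le> e"
proof -
  obtain d where d: "d > 0" "\<And>x y. \<bar>x - y\<bar> < d \<Longrightarrow> \<bar>g x - g y\<bar> < e"
    using g e unfolding uniformly_continuous_on_def dist_real_def by (metis UNIV_I)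
  have g_cont: "continuous_on S g" for S
    using uniformly_continuous_imp_continuous[OF g] continuous_on_subset by blast
  define I where "I = (\<lambda>u. LBINT y=ereal 0..ereal u. g y)"
  have I: "(I has_real_derivative g x) (at x)" for x
  proof -
    let ?a = "- \<bar>x\<bar> - 1" and ?b = "\<bar>x\<bar> + 1"
    have "(I has_vector_derivative g x) (at x within {?a..?b})"
      unfolding I_def by (rule interval_integral_FTC2) (auto intro: g_cont)
    moreover have "at x within {?a..?b} = at x" by (rule at_within_interior) auto
    ultimately show ?thesis by (simp add: has_real_derivative_iff_has_vector_derivative)
  qed
  define r where "r = d / 2"
  have r: "r > 0" "r < d" using d by (auto simp: r_def)
  define G where "G = (\<lambda>x. (1 / r) * (I (x + r) - I x))"
  define G' where "G' = (\<lambda>x. (1 / r) * (g (x + r) - g x))"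
  show ?thesis
  proof (rule that)
    show "C1_real UNIV G G'"
    proof (rule C1_realI)
      show "continuous_on UNIV G'" unfolding G'_def
        by (intro continuous_intros g_cont continuous_on_compose2[OF g_cont[of UNIV]]) auto
      fix x
      have "((\<lambda>x. I (x + r)) has_real_derivative g (x + r)) (at x)"
        using I[of "x + r"] by (simp add: DERIV_shift)
      then show "(G has_real_derivative G' x) (at x)"
        unfolding G_def G'_def by (intro DERIV_cmult DERIV_diff I)
    qed
    fix x
    have "\<bar>g (x + r) - g x\<bar> \<le> e" using d(2)[of "x + r" x] r by simp
    then show "\<bar>G' x\<bar> \<le> (1 / r) * e" unfolding G'_def abs_mult using r
      by (intro mult_mono) auto
    obtain z where z: "x < z" "z < x + r" "I (x + r) - I x = (x + r - x) * g z"
      using MVT2[of x "x + r" I g] I r by auto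
    then have "G x = g z" using r by (simp add: G_def)
    then show "\<bar>G x - g x\<bar> \<le> e" using d(2)[of z x] z r by simp
  qed
qed

definition growth_above :: "(real \<times> real \<Rightarrow> real) \<Rightarrow> bool" where
  "growth_above U \<longleftrightarrow> (\<forall>T>0. \<exists>C. \<forall>t x. 0 \<le> t \<and> t < T \<longrightarrow> U (t, x) \<le> C * (1 + \<bar>x\<bar>))"

context junction begin

text \<open>A smooth function that increases in time faster than the minima of the Hamiltonians and the flux
  limiter allow is a strict super-solution whatever its slopes are. This makes it possible to use a
  quadratic penalty in space.\<close>
lemma upper_barrier_smooth:
  assumes usc: "usc_on half_plane U" and U: "jsub H1 H2 (F A) U" and growth: "growth_above U"
    and G: "C1_real UNIV G G'" "\<And>x. \<bar>G x\<bar> \<le> C' * (1 + \<bar>x\<bar>)" and init: "\<And>x. U (0, x) \<le> G x"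
    and c: "0 < c + H1 p1" "0 < c + H2 p2" "0 < c + A" and t: "0 \<le> t"
  shows "U (t, x) \<le> G x + c * t"
proof (rule ccontr)
  assume "\<not> ?thesis"
  then have d: "0 < U (t, x) - G x - c * t" by simp
  define k where "k = (U (t, x) - G x - c * t) / (2 * (1 + x\<^sup>2))"
  have q: "0 < 1 + x\<^sup>2" by (simp add: add_pos_nonneg)
  have k: "0 < k" "k * x\<^sup>2 < U (t, x) - G x - c * t"
  proof -
    show k0: "0 < k" using d q by (simp add: k_def)
    have "d / (2 * Q) * Q = d / 2" if "0 < Q" for d Q :: real using that by simp
    from this[OF q] have "k * (1 + x\<^sup>2) = (U (t, x) - G x - c * t) / 2" unfolding k_def by blast
    then have "k + k * x\<^sup>2 = (U (t, x) - G x - c * t) / 2" by (simp add: algebra_simps)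
    moreover have "b < d" if "k + b = d / 2" "0 < d" for b d using that k0 by linarith
    ultimately show "k * x\<^sup>2 < U (t, x) - G x - c * t" using d by blast
  qed
  define h where "h = (\<lambda>y. G y + (0 * y + k * (y - 0)\<^sup>2))"
  define h' where "h' = (\<lambda>y. G' y + (0 + 2 * k * (y - 0)))"
  have h: "C1_real UNIV h h'"
    unfolding h_def h'_def by (intro C1_real_add G C1_real_quadratic)
  obtain C where C: "\<And>s y. 0 \<le> s \<Longrightarrow> s < t + 2 \<Longrightarrow> U (s, y) \<le> C * (1 + \<bar>y\<bar>)"
    using growth t unfolding growth_above_def by (metis add_nonneg_pos zero_less_numeral)
  define a where "a = \<bar>C\<bar> + \<bar>C'\<bar> + \<bar>c\<bar> * (t + 1)"
  have bound: "\<bar>y\<bar> \<le> max 1 (2 * a / k)"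
    if s: "0 \<le> s" "s \<le> t + 1" and le: "c * s + h y \<le> U (s, y)" for s y
  proof (cases "\<bar>y\<bar> \<le> 1")
    case False
    have "U (s, y) \<le> \<bar>C\<bar> * (1 + \<bar>y\<bar>)" using C[of s y] s
      by (smt (verit) abs_ge_self mult_right_mono abs_ge_zero)
    moreover have "- (\<bar>C'\<bar> * (1 + \<bar>y\<bar>)) \<le> G y" using G(2)[of y]
      by (smt (verit) abs_ge_self mult_right_mono abs_ge_zero)
    moreover have "- (\<bar>c\<bar> * (t + 1)) \<le> c * s"
    proof -
      have "\<bar>c * s\<bar> \<le> \<bar>c\<bar> * (t + 1)" unfolding abs_mult using s by (intro mult_left_mono) auto
      then show ?thesis by linarith
    qed
    moreover have "\<bar>c\<bar> * (t + 1) \<le> \<bar>c\<bar> * (t + 1) * (1 + \<bar>y\<bar>)"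
      using t mult_left_mono[of 1 "1 + \<bar>y\<bar>" "\<bar>c\<bar> * (t + 1)"] by simp
    ultimately have "k * y\<^sup>2 \<le> a * (1 + \<bar>y\<bar>)" using le unfolding h_def a_def by (simp add: algebra_simps)
    also have "\<dots> \<le> a * (2 * \<bar>y\<bar>)" using False t by (intro mult_left_mono) (auto simp: a_def)
    finally have "(k * \<bar>y\<bar>) * \<bar>y\<bar> \<le> (2 * a) * \<bar>y\<bar>" by (simp add: power2_eq_square mult_ac)
    then have "k * \<bar>y\<bar> \<le> 2 * a" using False by (simp add: mult_le_cancel_right)
    then show ?thesis using k by (simp add: field_simps le_max_iff_disj)
  qed auto
  have less: "c * t + h x < U (t, x)" using k(2) by (simp add: h_def)
  have init': "U (0, y) \<le> c * 0 + h y" for y using init[of y] k(1) by (simp add: h_def add_increasing2)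
  have lin: "continuous_on {0..} (\<lambda>s. c * s)" by (intro continuous_intros)
  obtain K t0 x0 r where K: "0 \<le> K" "0 < t0" "0 < r"
    "\<And>s y. \<bar>s - t0\<bar> < r \<Longrightarrow> \<bar>y - x0\<bar> < r \<Longrightarrow>
      U (s, y) \<le> U (t0, x0) + ((c * s + K * (max 0 (s - t))\<^sup>2) - (c * t0 + K * (max 0 (t0 - t))\<^sup>2)) + (h y - h x0)"
    by (rule positive_part_touches[OF usc lin C1_real_continuous[OF h] init' t less]) (rule bound, assumption+, rule that)
  have f: "C1_real {0<..} (\<lambda>s. c * s + K * (max 0 (s - t))\<^sup>2) (\<lambda>s. c + K * (2 * max 0 (s - t)))"
    by (intro C1_real_add C1_real_linear C1_real_cmult C1_real_pos_part_square)
  have ge: "c \<le> c + K * (2 * max 0 (t0 - t))" using K(1) by simp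
  have res: "(x0 < 0 \<longrightarrow> c + K * (2 * max 0 (t0 - t)) + H1 (h' x0) \<le> 0) \<and>
      (0 < x0 \<longrightarrow> c + K * (2 * max 0 (t0 - t)) + H2 (h' x0) \<le> 0) \<and>
      (x0 = 0 \<longrightarrow> c + K * (2 * max 0 (t0 - t)) + F A (h' 0) (h' 0) \<le> 0)"
    by (rule jsub_residual[OF U K(2) f C1_real_subset[OF h subset_UNIV] C1_real_subset[OF h subset_UNIV] K(3)])
       (rule K(4))
  show False
  proof (cases x0 "0::real" rule: linorder_cases)
    case less
    have "c + K * (2 * max 0 (t0 - t)) + H1 (h' x0) \<le> 0" by (rule conjunct1[OF res, THEN mp, OF less])
    then show False using ge c(1) H1.minimal[of "h' x0"] by linarith
  next
    case greater
    have "c + K * (2 * max 0 (t0 - t)) + H2 (h' x0) \<le> 0" by (rule conjunct1[OF conjunct2[OF res], THEN mp, OF greater])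
    then show False using ge c(2) H2.minimal[of "h' x0"] by linarith
  next
    case equal
    have "c + K * (2 * max 0 (t0 - t)) + F A (h' 0) (h' 0) \<le> 0" by (rule conjunct2[OF conjunct2[OF res], THEN mp, OF equal])
    then show False using ge c(3) flux_ge(1)[of A "h' 0" "h' 0"] by linarith
  qed
qed

text \<open>A strict sub-solution has to have bounded slopes, so the penalty in space may only grow linearly.
  Its slope \<open>b\<close> is fixed by the growth of \<open>V\<close>, not small; but it can be made to start far away.\<close>
lemma lower_barrier_smooth:
  assumes lsc: "usc_on half_plane (\<lambda>z. - V z)" and V: "jsuper H1 H2 (F A) V"
    and growth: "growth_above (\<lambda>z. - V z)"
    and G: "C1_real UNIV G G'" "\<And>x. \<bar>G' x\<bar> \<le> L" and init: "\<And>x. G x \<le> V (0, x)" and T: "0 < T"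
  obtains c where "0 \<le> c" "\<And>t x. 0 \<le> t \<Longrightarrow> t < T \<Longrightarrow> G x - c * t \<le> V (t, x)"
proof -
  define C' where "C' = \<bar>G 0\<bar> + L"
  have G_bound: "\<bar>G x\<bar> \<le> C' * (1 + \<bar>x\<bar>)" for x unfolding C'_def by (rule linear_bound_of_lipschitz[OF G])
  obtain C where C: "\<And>s y. 0 \<le> s \<Longrightarrow> s < T + 1 \<Longrightarrow> - V (s, y) \<le> C * (1 + \<bar>y\<bar>)"
    using growth T unfolding growth_above_def by (metis add_pos_pos zero_less_one)
  define a where "a = \<bar>C\<bar> + \<bar>C'\<bar>"
  define b where "b = a + 1"
  have b: "0 < b" by (simp add: b_def a_def)
  obtain c1 where c1: "\<And>q. \<bar>q\<bar> \<le> L + b \<Longrightarrow> H1 q \<le> c1" using H1.bounded_slopes_bound by blast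
  obtain c2 where c2: "\<And>q. \<bar>q\<bar> \<le> L + b \<Longrightarrow> H2 q \<le> c2" using H2.bounded_slopes_bound by blast
  define c where "c = \<bar>c1\<bar> + \<bar>c2\<bar> + \<bar>A\<bar> + 1"
  have "G x - c * t \<le> V (t, x)" if t: "0 \<le> t" "t < T" for t x
  proof (rule ccontr)
    assume "\<not> ?thesis"
    then have d: "0 < G x - c * t - V (t, x)" by simp
    define R where "R = 1 + b * x\<^sup>2 / (G x - c * t - V (t, x))"
    have R: "1 \<le> R" "R \<noteq> 0" using d b by (auto simp: R_def add_nonneg_eq_0_iff)
    \<comment> \<open>A penalty of slope less than \<open>b\<close> that grows linearly and is small at \<open>x\<close>.\<close>
    define h where "h = (\<lambda>y. - G y + (b * sqrt (R\<^sup>2 + y\<^sup>2) + - (b * R)))"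
    define h' where "h' = (\<lambda>y. - G' y + b * (y / sqrt (R\<^sup>2 + y\<^sup>2)))"
    have h: "C1_real UNIV h h'"
    proof -
      have "C1_real UNIV (\<lambda>y. - G y + b * sqrt (R\<^sup>2 + y\<^sup>2)) h'"
        unfolding h'_def by (intro C1_real_add C1_real_uminus G C1_real_cmult C1_real_hypot R)
      from C1_real_shift[OF this, of "- (b * R)"] show ?thesis unfolding h_def by (simp only: add.assoc)
    qed
    have slope: "\<bar>- h' y\<bar> \<le> L + b" for y
    proof -
      have "\<bar>b * (y / sqrt (R\<^sup>2 + y\<^sup>2))\<bar> \<le> b * 1"
        unfolding abs_mult using b abs_div_hypot_le[of y R] by (intro mult_mono) auto
      then show ?thesis using G(2)[of y] unfolding h'_def by linarith
    qed
    have bound: "\<bar>y\<bar> \<le> a + b * R"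
      if s: "0 \<le> s" "s \<le> t + 1" and le: "c * s + h y \<le> - V (s, y)" for s y
    proof -
      have "- V (s, y) \<le> \<bar>C\<bar> * (1 + \<bar>y\<bar>)" using C[of s y] s t
        by (smt (verit) abs_ge_self mult_right_mono abs_ge_zero)
      moreover have "- G y \<ge> - (\<bar>C'\<bar> * (1 + \<bar>y\<bar>))" using G_bound[of y]
        by (smt (verit) abs_ge_self mult_right_mono abs_ge_zero)
      moreover have "0 \<le> c * s" using s by (simp add: c_def)
      ultimately have "b * sqrt (R\<^sup>2 + y\<^sup>2) - b * R \<le> a * (1 + \<bar>y\<bar>)"
        using le unfolding h_def a_def by (simp add: algebra_simps)
      moreover have "\<bar>y\<bar> \<le> sqrt (R\<^sup>2 + y\<^sup>2)" by (rule real_le_rsqrt) simp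
      then have "b * \<bar>y\<bar> \<le> b * sqrt (R\<^sup>2 + y\<^sup>2)" using b by (intro mult_left_mono) auto
      ultimately show ?thesis by (simp add: b_def algebra_simps)
    qed
    have less: "c * t + h x < - V (t, x)"
    proof -
      let ?d = "G x - c * t - V (t, x)"
      have "sqrt (R\<^sup>2 + x\<^sup>2) \<le> R + x\<^sup>2 / (2 * R)"
      proof (rule real_le_lsqrt)
        have "(R + x\<^sup>2 / (2 * R))\<^sup>2 = R\<^sup>2 + x\<^sup>2 + (x\<^sup>2 / (2 * R))\<^sup>2"
          using R by (simp add: power2_sum)
        then show "R\<^sup>2 + x\<^sup>2 \<le> (R + x\<^sup>2 / (2 * R))\<^sup>2" by simp
      qed (use R in auto)
      then have "b * sqrt (R\<^sup>2 + x\<^sup>2) - b * R \<le> b * (x\<^sup>2 / (2 * R))"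
        using mult_left_mono[of "sqrt (R\<^sup>2 + x\<^sup>2)" "R + x\<^sup>2 / (2 * R)" b] b unfolding distrib_left by linarith
      also have "\<dots> < ?d"
      proof -
        have "D * (1 + e / D) = D + e" if "0 < D" for D e :: real using that by (simp add: distrib_left)
        from this[OF d, of "b * x\<^sup>2"] have "b * x\<^sup>2 < ?d * R" unfolding R_def using d by linarith
        moreover have "0 < ?d * R" using d R by simp
        ultimately have "b * x\<^sup>2 < ?d * (2 * R)" by simp
        then show ?thesis using R by (simp add: divide_less_eq)
      qed
      finally show ?thesis by (simp add: h_def)
    qed
    have init': "- V (0, y) \<le> c * 0 + h y" for y
    proof -
      have "R \<le> sqrt (R\<^sup>2 + y\<^sup>2)" by (rule real_le_rsqrt) simp
      then have "b * R \<le> b * sqrt (R\<^sup>2 + y\<^sup>2)" using b by (intro mult_left_mono) auto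
      then show ?thesis using init[of y] by (simp add: h_def)
    qed
    have lin: "continuous_on {0..} (\<lambda>s. c * s)" by (intro continuous_intros)
    obtain K t0 x0 r where K: "0 \<le> K" "0 < t0" "0 < r"
      "\<And>s y. \<bar>s - t0\<bar> < r \<Longrightarrow> \<bar>y - x0\<bar> < r \<Longrightarrow>
        - V (s, y) \<le> - V (t0, x0) + ((c * s + K * (max 0 (s - t))\<^sup>2) - (c * t0 + K * (max 0 (t0 - t))\<^sup>2)) + (h y - h x0)"
      by (rule positive_part_touches[OF lsc lin C1_real_continuous[OF h] init' t(1) less]) (rule bound, assumption+, rule that)
    have f: "C1_real {0<..} (\<lambda>s. - (c * s + K * (max 0 (s - t))\<^sup>2)) (\<lambda>s. - (c + K * (2 * max 0 (s - t))))"
      by (intro C1_real_add C1_real_linear C1_real_cmult C1_real_pos_part_square C1_real_uminus)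
    have le: "- (c + K * (2 * max 0 (t0 - t))) \<le> - c" using K(1) by simp
    note h_neg = C1_real_uminus[OF h]
    have touch: "V (t0, x0) + (- (c * s + K * (max 0 (s - t))\<^sup>2) - - (c * t0 + K * (max 0 (t0 - t))\<^sup>2)) + (- h y - - h x0) \<le> V (s, y)"
      if "\<bar>s - t0\<bar> < r" "\<bar>y - x0\<bar> < r" for s y using K(4)[OF that] by linarith
    have vals: "H1 (- h' x0) < c" "H2 (- h' x0) < c" "F A (- h' 0) (- h' 0) < c"
      using c1[OF slope, of x0] c2[OF slope, of x0] c1[OF slope, of 0] c2[OF slope, of 0]
        H1.H_plus_bounds(2)[of "- h' 0"] H2.H_minus_bounds(2)[of "- h' 0"]
      unfolding c_def flux_less_iff by linarith+
    have res: "(x0 < 0 \<longrightarrow> - (c + K * (2 * max 0 (t0 - t))) + H1 (- h' x0) \<ge> 0) \<and>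
        (0 < x0 \<longrightarrow> - (c + K * (2 * max 0 (t0 - t))) + H2 (- h' x0) \<ge> 0) \<and>
        (x0 = 0 \<longrightarrow> - (c + K * (2 * max 0 (t0 - t))) + F A (- h' 0) (- h' 0) \<ge> 0)"
      by (rule jsuper_residual[OF V K(2) f C1_real_subset[OF h_neg subset_UNIV] C1_real_subset[OF h_neg subset_UNIV] K(3)])
         (rule touch)
    show False
    proof (cases x0 "0::real" rule: linorder_cases)
      case less
      have "0 \<le> - (c + K * (2 * max 0 (t0 - t))) + H1 (- h' x0)" by (rule conjunct1[OF res, THEN mp, OF less])
      then show False using le vals(1) by linarith
    next
      case greater
      have "0 \<le> - (c + K * (2 * max 0 (t0 - t))) + H2 (- h' x0)" by (rule conjunct1[OF conjunct2[OF res], THEN mp, OF greater])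
      then show False using le vals(2) by linarith
    next
      case equal
      have "0 \<le> - (c + K * (2 * max 0 (t0 - t))) + F A (- h' 0) (- h' 0)" by (rule conjunct2[OF conjunct2[OF res], THEN mp, OF equal])
      then show False using le vals(3) by linarith
    qed
  qed
  then show ?thesis using that[of c] by (simp add: c_def)
qed

lemma upper_barrier:
  assumes usc: "usc_on half_plane U" and U: "jsub H1 H2 (F A) U" and growth: "growth_above U"
    and g: "uniformly_continuous_on UNIV g" and init: "\<And>x. U (0, x) \<le> g x"
    and c: "0 < c + H1 p1" "0 < c + H2 p2" "0 < c + A" and t: "0 \<le> t"
  shows "U (t, x) \<le> g x + c * t"
proof (rule field_le_epsilon)
  fix e :: real assume e: "e > 0"
  obtain G G' L where G: "C1_real UNIV G G'" "\<And>x. \<bar>G' x\<bar> \<le> L" "\<And>x. \<bar>G x - g x\<bar> \<le> e / 2"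
    using uniformly_continuous_approx[OF g, of "e/2"] e by auto
  have Ge: "C1_real UNIV (\<lambda>x. G x + e / 2) G'"
    by (rule C1_real_shift[OF G(1)])
  have "U (t, x) \<le> (G x + e / 2) + c * t"
  proof (rule upper_barrier_smooth[OF usc U growth Ge linear_bound_of_lipschitz[OF Ge G(2)] _ c t])
    show "U (0, y) \<le> G y + e / 2" for y using init[of y] G(3)[of y] by linarith
  qed
  then show "U (t, x) \<le> g x + c * t + e" using G(3)[of x] by linarith
qed

lemma lower_barrier:
  assumes lsc: "usc_on half_plane (\<lambda>z. - V z)" and V: "jsuper H1 H2 (F A) V"
    and growth: "growth_above (\<lambda>z. - V z)"
    and g: "uniformly_continuous_on UNIV g" and init: "\<And>x. g x \<le> V (0, x)" and T: "0 < T" and e: "0 < e"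
  obtains c where "0 \<le> c" "\<And>t x. 0 \<le> t \<Longrightarrow> t < T \<Longrightarrow> g x - e - c * t \<le> V (t, x)"
proof -
  obtain G G' L where G: "C1_real UNIV G G'" "\<And>x. \<bar>G' x\<bar> \<le> L" "\<And>x. \<bar>G x - g x\<bar> \<le> e / 2"
    using uniformly_continuous_approx[OF g, of "e/2"] e by auto
  have Ge: "C1_real UNIV (\<lambda>x. G x + - (e / 2)) G'"
    by (rule C1_real_shift[OF G(1)])
  have "G y + - (e / 2) \<le> V (0, y)" for y using init[of y] G(3)[of y] by linarith
  from lower_barrier_smooth[OF lsc V growth Ge G(2) this T]
  obtain c where c: "0 \<le> c" "\<And>t x. 0 \<le> t \<Longrightarrow> t < T \<Longrightarrow> G x + - (e / 2) - c * t \<le> V (t, x)" by blast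
  show ?thesis
  proof (rule that[OF c(1)])
    fix t x :: real assume "0 \<le> t" "t < T"
    from c(2)[OF this, of x] show "g x - e - c * t \<le> V (t, x)" using G(3)[of x] by linarith
  qed
qed

end

section \<open>Comparison\<close>

text \<open>The function \<open>\<lambda>t. U (t, x0) - k s0 t\<close> is smaller at \<open>t0 - r\<close> and \<open>t0 + r\<close> than at \<open>t0\<close>. By
  semicontinuity this persists for nearby parameters \<open>\<tau>\<close> and points. Hence, for spatial profiles \<open>h\<close>
  that do not decrease too fast, a maximum of \<open>U - k \<tau> - h\<close> over a flat box is interior or at one of
  the ends of the space interval; a steep \<open>h\<close> excludes one end or both.\<close>
lemma box_maximum:
  fixes U :: "real \<times> real \<Rightarrow> real" and k :: "real \<Rightarrow> real \<Rightarrow> real" and \<sigma> t0 s0 x0 :: real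
  defines "D \<equiv> \<lambda>\<tau> t z. (U (t, x0 + \<sigma> * z) - k \<tau> t) - (U (t0, x0) - k \<tau> t0)"
  assumes usc: "usc_on half_plane U" and k: "continuous_on UNIV (\<lambda>w. k (fst w) (snd w))"
    and r: "0 < r" "r < t0" and m: "0 \<le> m"
    and strict: "U (t0 - r, x0) - k s0 (t0 - r) < U (t0, x0) - k s0 t0"
      "U (t0 + r, x0) - k s0 (t0 + r) < U (t0, x0) - k s0 t0"
  obtains \<rho> B where "0 < \<rho>" "\<rho> \<le> r"
    "\<And>\<tau> t z. \<bar>\<tau> - s0\<bar> \<le> \<rho> \<Longrightarrow> \<bar>t - t0\<bar> \<le> r \<Longrightarrow> \<bar>z\<bar> \<le> \<rho> \<Longrightarrow> D \<tau> t z < B"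
    "\<And>h \<tau> y. \<lbrakk>continuous_on UNIV h; h 0 = 0; \<And>z. - m * \<bar>z\<bar> \<le> h z; B \<le> h (- \<rho>); \<bar>\<tau> - s0\<bar> \<le> \<rho>; 0 \<le> y; y \<le> \<rho>\<rbrakk> \<Longrightarrow>
      (\<exists>t' z' \<delta>. \<bar>t' - t0\<bar> < r \<and> \<bar>z'\<bar> < \<rho> \<and> 0 < \<delta> \<and> (\<forall>t z. \<bar>t - t'\<bar> < \<delta> \<longrightarrow> \<bar>z - z'\<bar> < \<delta> \<longrightarrow>
          U (t, x0 + \<sigma> * z) \<le> U (t', x0 + \<sigma> * z') + (k \<tau> t - k \<tau> t') + (h z - h z'))) \<or>
      (\<exists>t'. \<bar>t' - t0\<bar> \<le> r \<and> h y \<le> D \<tau> t' y)"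
proof -
  let ?I = "{t0 - r..t0 + r}"
  define D3 where "D3 = (\<lambda>w::real \<times> real \<times> real. D (fst w) (fst (snd w)) (snd (snd w)))"
  have D3: "usc_on (UNIV \<times> (?I \<times> UNIV)) D3"
  proof -
    have 1: "usc_on (UNIV \<times> (?I \<times> UNIV)) (\<lambda>w. U (fst (snd w), x0 + \<sigma> * snd (snd w)))"
      by (rule usc_on_compose[OF usc, of _ "\<lambda>w. (fst (snd w), x0 + \<sigma> * snd (snd w))"])
         (use r in \<open>auto intro!: continuous_intros\<close>)
    have "continuous_on (UNIV \<times> (?I \<times> UNIV)) (\<lambda>w::real \<times> real \<times> real. k (fst w) (fst (snd w)))"
      "continuous_on (UNIV \<times> (?I \<times> UNIV)) (\<lambda>w::real \<times> real \<times> real. k (fst w) t0)"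
      by (rule continuous_on_compose2[OF k, of _ "\<lambda>w. (fst w, fst (snd w))", simplified],
          intro continuous_intros)
         (rule continuous_on_compose2[OF k, of _ "\<lambda>w. (fst w, t0)", simplified], intro continuous_intros)
    then have "usc_on (UNIV \<times> (?I \<times> UNIV)) (\<lambda>w. U (fst (snd w), x0 + \<sigma> * snd (snd w)) +
        (- k (fst w) (fst (snd w)) - (U (t0, x0) - k (fst w) t0)))"
      by (intro usc_on_add 1 continuous_imp_usc_on continuous_intros)
    then show ?thesis unfolding D3_def D_def by (simp add: algebra_simps)
  qed
  \<comment> \<open>Near the two ends of the time interval \<open>D\<close> stays below a negative number.\<close>
  have side: "\<exists>d>0. \<forall>\<tau> z. \<bar>\<tau> - s0\<bar> < d \<longrightarrow> \<bar>z\<bar> < d \<longrightarrow> D \<tau> t z < D s0 t 0 / 2"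
    if t: "t \<in> ?I" and neg: "D s0 t 0 < 0" for t
  proof -
    have "D3 (s0, t, 0) < D s0 t 0 / 2" using neg by (simp add: D3_def)
    then obtain e where e: "e > 0" "\<And>w. w \<in> UNIV \<times> (?I \<times> UNIV) \<Longrightarrow> dist (s0, t, 0) w < e \<Longrightarrow> D3 w < D s0 t 0 / 2"
      using usc_onD[OF D3, of "(s0, t, 0)"] t by (metis SigmaI UNIV_I)
    have "D \<tau> t z < D s0 t 0 / 2" if "\<bar>\<tau> - s0\<bar> < e / 2" "\<bar>z\<bar> < e / 2" for \<tau> z
    proof -
      have "dist (s0, t, 0) (\<tau>, t, z) \<le> \<bar>\<tau> - s0\<bar> + \<bar>z\<bar>"
        unfolding dist_Pair_Pair by (rule order_trans[OF sqrt_sum_squares_le_sum_abs]) (auto simp: dist_real_def)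
      then have "dist (s0, t, 0) (\<tau>, t, z) < e" using that by linarith
      then show ?thesis using e(2)[of "(\<tau>, t, z)"] t by (simp add: D3_def)
    qed
    then show ?thesis using e(1) by (intro exI[of _ "e/2"]) auto
  qed
  obtain d1 where d1: "d1 > 0" "\<And>\<tau> z. \<bar>\<tau> - s0\<bar> < d1 \<Longrightarrow> \<bar>z\<bar> < d1 \<Longrightarrow> D \<tau> (t0 - r) z < D s0 (t0 - r) 0 / 2"
    using side[of "t0 - r"] strict(1) r by (auto simp: D_def)
  obtain d2 where d2: "d2 > 0" "\<And>\<tau> z. \<bar>\<tau> - s0\<bar> < d2 \<Longrightarrow> \<bar>z\<bar> < d2 \<Longrightarrow> D \<tau> (t0 + r) z < D s0 (t0 + r) 0 / 2"
    using side[of "t0 + r"] strict(2) r by (auto simp: D_def)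
  define c where "c = min (- D s0 (t0 - r) 0 / 2) (- D s0 (t0 + r) 0 / 2)"
  have c: "0 < c" using strict by (auto simp: c_def D_def)
  define \<rho> where "\<rho> = min (min r (c / (m + 1))) (min d1 d2) / 2"
  have \<rho>: "0 < \<rho>" "\<rho> \<le> r" "\<rho> < d1" "\<rho> < d2" "\<rho> < c / (m + 1)"
  proof -
    have "0 < c / (m + 1)" using c m by simp
    moreover define X where "X = min (min r (c / (m + 1))) (min d1 d2)"
    ultimately have "0 < X" "X \<le> r" "X \<le> d1" "X \<le> d2" "X \<le> c / (m + 1)" using r(1) d1(1) d2(1) by auto
    then show "0 < \<rho>" "\<rho> \<le> r" "\<rho> < d1" "\<rho> < d2" "\<rho> < c / (m + 1)"
      unfolding \<rho>_def X_def[symmetric] by linarith+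
  qed
  have m\<rho>: "m * \<rho> < c"
  proof -
    have "(m + 1) * \<rho> < c" using \<rho>(5) m by (simp add: field_simps)
    then show ?thesis using \<rho>(1) by (simp add: algebra_simps)
  qed
  have ends: "D \<tau> t z < - c" if "\<bar>t - t0\<bar> = r" "\<bar>\<tau> - s0\<bar> \<le> \<rho>" "\<bar>z\<bar> \<le> \<rho>" for \<tau> t z
  proof -
    have "t = t0 - r \<or> t = t0 + r" using that(1) by auto
    then show ?thesis using d1(2)[of \<tau> z] d2(2)[of \<tau> z] that \<rho> unfolding c_def by auto
  qed
  obtain B where B: "\<And>\<tau> t z. \<bar>\<tau> - s0\<bar> \<le> \<rho> \<Longrightarrow> \<bar>t - t0\<bar> \<le> r \<Longrightarrow> \<bar>z\<bar> \<le> \<rho> \<Longrightarrow> D \<tau> t z < B"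
  proof -
    let ?K = "{s0 - \<rho>..s0 + \<rho>} \<times> (?I \<times> {- \<rho>..\<rho>})"
    have "compact ?K" "?K \<noteq> {}" using \<rho> r by (auto intro!: compact_Times)
    moreover have "usc_on ?K D3" by (rule usc_on_subset[OF D3]) auto
    ultimately obtain w where w: "\<And>v. v \<in> ?K \<Longrightarrow> D3 v \<le> D3 w" using usc_on_attains_max by blast
    show ?thesis
    proof (rule that[of "D3 w + 1"])
      fix \<tau> t z assume "\<bar>\<tau> - s0\<bar> \<le> \<rho>" "\<bar>t - t0\<bar> \<le> r" "\<bar>z\<bar> \<le> \<rho>"
      then have "(\<tau>, t, z) \<in> ?K" by auto
      from w[OF this] show "D \<tau> t z < D3 w + 1" by (simp add: D3_def)
    qed
  qed
  show ?thesis
  proof (rule that[OF \<rho>(1,2)])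
    fix \<tau> t z assume "\<bar>\<tau> - s0\<bar> \<le> \<rho>" "\<bar>t - t0\<bar> \<le> r" "\<bar>z\<bar> \<le> \<rho>"
    then show "D \<tau> t z < B" by (rule B)
  next
    fix h \<tau> y
    assume h: "continuous_on UNIV h" "h 0 = (0::real)" "\<And>z. - m * \<bar>z\<bar> \<le> h z" "B \<le> h (- \<rho>)"
      and \<tau>: "\<bar>\<tau> - s0\<bar> \<le> \<rho>" and y: "0 \<le> y" "y \<le> \<rho>"
    let ?K = "?I \<times> {- \<rho>..y}"
    have comp: "compact ?K" "?K \<noteq> {}" using \<rho> r y by (auto intro!: compact_Times)
    have "usc_on ?K (\<lambda>w. D3 (\<tau>, fst w, snd w))"
      by (rule usc_on_compose[OF D3, of _ "\<lambda>w. (\<tau>, fst w, snd w)"]) (auto intro!: continuous_intros)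
    then have "usc_on ?K (\<lambda>w. D3 (\<tau>, fst w, snd w) + - h (snd w))"
      by (rule usc_on_add)
         (intro continuous_imp_usc_on continuous_intros continuous_on_compose2[OF h(1), of _ snd], auto)
    then obtain w1 where w1: "w1 \<in> ?K" "\<And>w. w \<in> ?K \<Longrightarrow> D3 (\<tau>, fst w, snd w) + - h (snd w) \<le> D3 (\<tau>, fst w1, snd w1) + - h (snd w1)"
      using usc_on_attains_max[OF _ comp] by blast
    obtain t1 z1 where w1_eq: "w1 = (t1, z1)" by (cases w1)
    have in_K: "t1 \<in> ?I" "z1 \<in> {- \<rho>..y}" using w1(1) by (auto simp: w1_eq)
    have max: "D \<tau> t z - h z \<le> D \<tau> t1 z1 - h z1" if "t \<in> ?I" "z \<in> {- \<rho>..y}" for t z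
      using w1(2)[of "(t, z)"] that by (simp add: w1_eq D3_def)
    have "D \<tau> t0 0 = 0" by (simp add: D_def)
    then have pos: "h z1 \<le> D \<tau> t1 z1" using max[of t0 0] h(2) r \<rho> y by simp
    have z1_abs: "\<bar>z1\<bar> \<le> \<rho>" using in_K y by auto
    show "(\<exists>t' z' \<delta>. \<bar>t' - t0\<bar> < r \<and> \<bar>z'\<bar> < \<rho> \<and> 0 < \<delta> \<and> (\<forall>t z. \<bar>t - t'\<bar> < \<delta> \<longrightarrow> \<bar>z - z'\<bar> < \<delta> \<longrightarrow>
          U (t, x0 + \<sigma> * z) \<le> U (t', x0 + \<sigma> * z') + (k \<tau> t - k \<tau> t') + (h z - h z'))) \<or>
      (\<exists>t'. \<bar>t' - t0\<bar> \<le> r \<and> h y \<le> D \<tau> t' y)"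
    proof (cases "z1 = y")
      case True
      then show ?thesis using pos in_K(1) by (intro disjI2 exI[of _ t1]) auto
    next
      case False
      have "\<bar>t1 - t0\<bar> \<le> r" using in_K(1) by auto
      then have "z1 \<noteq> - \<rho>" using B[OF \<tau> _ z1_abs, of t1] pos h(4) by auto
      moreover have "\<bar>t1 - t0\<bar> \<noteq> r"
      proof
        assume "\<bar>t1 - t0\<bar> = r"
        from ends[OF this \<tau> z1_abs] have "h z1 < - c" using pos by linarith
        moreover have "m * \<bar>z1\<bar> \<le> m * \<rho>" using z1_abs m by (intro mult_left_mono)
        ultimately show False using h(3)[of z1] m\<rho> by linarith
      qed
      ultimately have int: "\<bar>t1 - t0\<bar> < r" "- \<rho> < z1" "z1 < y" using in_K False by auto
      define \<delta> where "\<delta> = min (r - \<bar>t1 - t0\<bar>) (min (z1 + \<rho>) (y - z1))"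
      have "U (t, x0 + \<sigma> * z) \<le> U (t1, x0 + \<sigma> * z1) + (k \<tau> t - k \<tau> t1) + (h z - h z1)"
        if "\<bar>t - t1\<bar> < \<delta>" "\<bar>z - z1\<bar> < \<delta>" for t z
      proof -
        have "t \<in> ?I" "z \<in> {- \<rho>..y}" using that unfolding \<delta>_def by auto
        from max[OF this] show ?thesis unfolding D_def by linarith
      qed
      moreover have "0 < \<delta>" using int by (auto simp: \<delta>_def)
      moreover have "\<bar>z1\<bar> < \<rho>" using int y by auto
      ultimately show ?thesis using int(1) by blast
    qed
  qed
qed

definition kink :: "real \<Rightarrow> real \<Rightarrow> real \<Rightarrow> real" where
  "kink l r x = (if x < 0 then l * x else r * x)"

lemma C1_real_kink: "C1_real {..0} (kink l r) (\<lambda>_. l)" "C1_real {0..} (kink l r) (\<lambda>_. r)"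
proof -
  have "(kink l r has_real_derivative l) (at x within {..0})" if "x \<in> {..0}" for x
    by (rule has_field_derivative_transform_within[of "\<lambda>x. l * x" _ _ _ 1])
       (use that in \<open>auto simp: kink_def intro!: derivative_eq_intros\<close>)
  then show "C1_real {..0} (kink l r) (\<lambda>_. l)" by (auto simp: C1_real_def)
  have "(kink l r has_real_derivative r) (at x within {0..})" if "x \<in> {0..}" for x
    by (rule has_field_derivative_transform_within[of "\<lambda>x. r * x" _ _ _ 1])
       (use that in \<open>auto simp: kink_def intro!: derivative_eq_intros\<close>)
  then show "C1_real {0..} (kink l r) (\<lambda>_. r)" by (auto simp: C1_real_def)
qed

lemma continuous_kink: "continuous_on S (kink l r)"
proof -
  have "kink l r = (\<lambda>x. l * min x 0 + r * max x 0)" by (auto simp: kink_def)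
  then show ?thesis by (auto intro!: continuous_intros)
qed

lemma kink_uminus: "kink l r (- x) = kink (- r) (- l) x"
  by (auto simp: kink_def)

text \<open>A sub-solution and a super-solution with the time variable doubled, near a maximum of the
  penalized difference. The time derivative of the penalty is the slope in time of test functions
  for \<open>V\<close>, while those for \<open>U\<close> gain \<open>\<eta>\<close>.\<close>
locale doubling =
  fixes U V :: "real \<times> real \<Rightarrow> real" and \<delta> \<eta> K \<beta> tt t0 s0 x0 r0 :: real
  assumes usc: "usc_on half_plane U" and lsc: "usc_on half_plane (\<lambda>z. - V z)"
    and pos: "0 < \<delta>" "0 < \<eta>" "0 \<le> K" "0 \<le> \<beta>" "0 < t0" "0 < s0" "0 < r0"
    and maximum: "\<And>t \<tau> x. \<lbrakk>\<bar>t - t0\<bar> < r0; \<bar>\<tau> - s0\<bar> < r0; \<bar>x - x0\<bar> < r0\<rbrakk> \<Longrightarrow>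
      U (t, x) - V (\<tau>, x) - (1 / (2 * \<delta>) * (t - \<tau>)\<^sup>2 + \<eta> * t + K * (max 0 (t - tt))\<^sup>2) - \<beta> * sqrt (1\<^sup>2 + x\<^sup>2)
      \<le> U (t0, x0) - V (s0, x0) - (1 / (2 * \<delta>) * (t0 - s0)\<^sup>2 + \<eta> * t0 + K * (max 0 (t0 - tt))\<^sup>2) - \<beta> * sqrt (1\<^sup>2 + x0\<^sup>2)"
begin

definition "a = (t0 - s0) / \<delta>"

text \<open>The penalty as a function of the time of \<open>U\<close>, made strict at \<open>t0\<close>. The last summand has the
  form of \<open>C1_real_quadratic\<close>.\<close>
definition "k \<tau> t = \<eta> * t + 1 / (2 * \<delta>) * (t - \<tau>)\<^sup>2 + K * (max 0 (t - tt))\<^sup>2 + (0 * t + 1 * (t - t0)\<^sup>2)"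
definition "k' \<tau> t = \<eta> + 2 * (1 / (2 * \<delta>)) * (t - \<tau>) + K * (2 * max 0 (t - tt)) + (0 + 2 * 1 * (t - t0))"

lemma k_C1: "C1_real S (k \<tau>) (k' \<tau>)"
  unfolding k_def k'_def
  by (intro C1_real_add C1_real_quadratic C1_real_cmult C1_real_pos_part_square)

lemma k'_lower_bound:
  obtains r1 where "0 < r1" "r1 < r0" "r1 < t0" "r1 < s0"
    "\<And>\<tau> t. \<bar>t - t0\<bar> \<le> r1 \<Longrightarrow> \<bar>\<tau> - s0\<bar> \<le> r1 \<Longrightarrow> a + 3 * \<eta> / 4 \<le> k' \<tau> t"
proof -
  define r1 where "r1 = min (min (r0 / 2) (t0 / 2)) (min (s0 / 2) (\<eta> / (4 * (2 / \<delta> + 2))))"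
  have q: "0 < 2 / \<delta> + 2" using pos by (simp add: add_pos_pos)
  have "0 < \<eta> / (4 * (2 / \<delta> + 2))" using pos q by simp
  then have r1: "0 < r1" "r1 < r0" "r1 < t0" "r1 < s0" "r1 \<le> \<eta> / (4 * (2 / \<delta> + 2))"
    using pos unfolding r1_def by linarith+
  then have "r1 * (2 / \<delta> + 2) \<le> \<eta> / 4" using q by (simp add: pos_le_divide_eq algebra_simps)
  then have small: "2 * r1 / \<delta> + 2 * r1 \<le> \<eta> / 4" by (simp add: algebra_simps)
  show ?thesis
  proof (rule that[OF r1(1-4)])
    fix \<tau> t assume *: "\<bar>t - t0\<bar> \<le> r1" "\<bar>\<tau> - s0\<bar> \<le> r1"
    then have "- (2 * r1) / \<delta> \<le> ((t - \<tau>) - (t0 - s0)) / \<delta>" using pos by (intro divide_right_mono) auto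
    then have "a - 2 * r1 / \<delta> \<le> (t - \<tau>) / \<delta>" by (simp add: a_def diff_divide_distrib)
    moreover have "k' \<tau> t = \<eta> + (t - \<tau>) / \<delta> + K * (2 * max 0 (t - tt)) + 2 * (t - t0)"
      unfolding k'_def using pos by simp
    moreover have "0 \<le> K * (2 * max 0 (t - tt))" using pos by simp
    ultimately have "\<eta> + (a - 2 * r1 / \<delta>) + 2 * (t - t0) \<le> k' \<tau> t" by (smt (verit))
    moreover have "- r1 \<le> t - t0" using *(1) by (simp add: abs_le_iff)
    moreover have "A + 3 * E / 4 \<le> k'" if "E + (A - X) + 2 * D \<le> k'" "- R \<le> D" "X + 2 * R \<le> E / 4"
      for A E X D R k' :: real using that by argo
    ultimately show "a + 3 * \<eta> / 4 \<le> k' \<tau> t" using small by blast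
  qed
qed

lemma k_continuous: "continuous_on UNIV (\<lambda>w. k (fst w) (snd w))"
  unfolding k_def by (intro continuous_intros)

lemma k_strict:
  assumes "\<bar>t - t0\<bar> < r0" "t \<noteq> t0"
  shows "U (t, x0) - k s0 t < U (t0, x0) - k s0 t0"
proof -
  have "0 < (t - t0)\<^sup>2" using assms(2) by simp
  moreover have "\<bar>s0 - s0\<bar> < r0" "\<bar>x0 - x0\<bar> < r0" using pos by auto
  note maximum[OF assms(1) this]
  moreover have "(t0 - t0)\<^sup>2 = 0" by simp
  ultimately show ?thesis unfolding k_def by linarith
qed

lemma V_lower_bound:
  assumes "\<bar>t' - t0\<bar> < r0" "\<bar>\<tau> - s0\<bar> < r0" "\<bar>x - x0\<bar> < r0"
    and "h \<le> (U (t', x) - k \<tau> t') - (U (t0, x0) - k \<tau> t0)"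
  shows "V (s0, x0) + a * (\<tau> - s0) - 1 / (2 * \<delta>) * (\<tau> - s0)\<^sup>2 + h - \<beta> * (sqrt (1\<^sup>2 + x\<^sup>2) - sqrt (1\<^sup>2 + x0\<^sup>2)) \<le> V (\<tau>, x)"
proof -
  have "1 / (2 * \<delta>) * (t0 - \<tau>)\<^sup>2 - 1 / (2 * \<delta>) * (t0 - s0)\<^sup>2 = - (a * (\<tau> - s0)) + 1 / (2 * \<delta>) * (\<tau> - s0)\<^sup>2"
    unfolding a_def using pos by (simp add: field_simps power2_eq_square)
  moreover have "0 \<le> 1 * (t' - t0)\<^sup>2" by simp
  moreover have "(t0 - t0)\<^sup>2 = 0" by simp
  ultimately show ?thesis
    using maximum[OF assms(1-3)] assms(4)
      right_diff_distrib[of \<beta> "sqrt (1\<^sup>2 + x\<^sup>2)" "sqrt (1\<^sup>2 + x0\<^sup>2)"] unfolding k_def by linarith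
qed

text \<open>If no \<open>U - k \<tau> - h\<close> with \<open>h\<close> increasing along a ray with slope \<open>p\<close>, and steep in the opposite
  direction, has an interior maximum near \<open>(t0, x0)\<close>, then \<open>V\<close> leaves \<open>x0\<close> along the ray with slope at
  least \<open>p\<close>.\<close>
lemma V_slope:
  fixes h :: "real \<Rightarrow> real \<Rightarrow> real"
  assumes \<sigma>: "\<sigma> = 1 \<or> \<sigma> = -1" and r1: "0 < r1" "r1 < r0" "r1 < t0"
    and h: "\<And>L. continuous_on UNIV (h L)" "\<And>L z. 0 \<le> L \<Longrightarrow> - \<bar>p\<bar> * \<bar>z\<bar> \<le> h L z" "\<And>L y. 0 \<le> y \<Longrightarrow> h L y = p * y"
      "\<And>\<rho> B. 0 < \<rho> \<Longrightarrow> \<exists>L\<ge>Lmin. B \<le> h L (- \<rho>)" and Lmin: "0 \<le> Lmin"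
    and no_touch: "\<And>L \<tau> t' z' e. \<lbrakk>Lmin \<le> L; \<bar>\<tau> - s0\<bar> \<le> r1; \<bar>t' - t0\<bar> < r1; \<bar>z'\<bar> < r1; 0 < e;
      \<forall>t z. \<bar>t - t'\<bar> < e \<longrightarrow> \<bar>z - z'\<bar> < e \<longrightarrow>
         U (t, x0 + \<sigma> * z) \<le> U (t', x0 + \<sigma> * z') + (k \<tau> t - k \<tau> t') + (h L z - h L z')\<rbrakk> \<Longrightarrow> False"
  obtains \<rho> where "0 < \<rho>" "\<And>\<tau> y. \<bar>\<tau> - s0\<bar> < \<rho> \<Longrightarrow> 0 \<le> y \<Longrightarrow> y < \<rho> \<Longrightarrow>
      V (s0, x0) + a * (\<tau> - s0) - 1 / (2 * \<delta>) * (\<tau> - s0)\<^sup>2 + p * y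
        - \<beta> * (sqrt (1\<^sup>2 + (x0 + \<sigma> * y)\<^sup>2) - sqrt (1\<^sup>2 + x0\<^sup>2)) \<le> V (\<tau>, x0 + \<sigma> * y)"
proof -
  have strict: "U (t0 - r1, x0) - k s0 (t0 - r1) < U (t0, x0) - k s0 t0"
    "U (t0 + r1, x0) - k s0 (t0 + r1) < U (t0, x0) - k s0 t0"
    using r1 by (intro k_strict; simp)+
  obtain \<rho> B where \<rho>: "0 < \<rho>" "\<rho> \<le> r1" and alt: "\<And>h \<tau> y. \<lbrakk>continuous_on UNIV h; h 0 = 0; \<And>z. - \<bar>p\<bar> * \<bar>z\<bar> \<le> h z; B \<le> h (- \<rho>); \<bar>\<tau> - s0\<bar> \<le> \<rho>; 0 \<le> y; y \<le> \<rho>\<rbrakk> \<Longrightarrow>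
      (\<exists>t' z' \<delta>. \<bar>t' - t0\<bar> < r1 \<and> \<bar>z'\<bar> < \<rho> \<and> 0 < \<delta> \<and> (\<forall>t z. \<bar>t - t'\<bar> < \<delta> \<longrightarrow> \<bar>z - z'\<bar> < \<delta> \<longrightarrow>
          U (t, x0 + \<sigma> * z) \<le> U (t', x0 + \<sigma> * z') + (k \<tau> t - k \<tau> t') + (h z - h z'))) \<or>
      (\<exists>t'. \<bar>t' - t0\<bar> \<le> r1 \<and> h y \<le> (U (t', x0 + \<sigma> * y) - k \<tau> t') - (U (t0, x0) - k \<tau> t0))"
    by (rule box_maximum[OF usc k_continuous r1(1,3) abs_ge_zero[of p] strict, of \<sigma>]) blast
  obtain L where L: "Lmin \<le> L" "B \<le> h L (- \<rho>)" using h(4)[OF \<rho>(1)] by blast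
  show ?thesis
  proof (rule that[OF \<rho>(1)])
    fix \<tau> y assume *: "\<bar>\<tau> - s0\<bar> < \<rho>" "0 \<le> y" "y < \<rho>"
    have h0: "h L 0 = 0" using h(3)[of 0] by simp
    have hL: "- \<bar>p\<bar> * \<bar>z\<bar> \<le> h L z" for z using h(2) L(1) Lmin by auto
    have \<tau>: "\<bar>\<tau> - s0\<bar> \<le> \<rho>" and y: "y \<le> \<rho>" using * by auto
    from alt[OF h(1) h0 hL L(2) \<tau> *(2) y] no_touch[OF L(1)] \<rho>(2) \<tau>
    obtain t' where t': "\<bar>t' - t0\<bar> \<le> r1" "h L y \<le> (U (t', x0 + \<sigma> * y) - k \<tau> t') - (U (t0, x0) - k \<tau> t0)"
      by (meson less_le_trans order_trans)
    show "V (s0, x0) + a * (\<tau> - s0) - 1 / (2 * \<delta>) * (\<tau> - s0)\<^sup>2 + p * y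
        - \<beta> * (sqrt (1\<^sup>2 + (x0 + \<sigma> * y)\<^sup>2) - sqrt (1\<^sup>2 + x0\<^sup>2)) \<le> V (\<tau>, x0 + \<sigma> * y)"
    proof (rule V_lower_bound[of t'])
      show "p * y \<le> U (t', x0 + \<sigma> * y) - k \<tau> t' - (U (t0, x0) - k \<tau> t0)" using t'(2) h(3)[OF *(2)] by simp
    qed (use t'(1) * \<rho> r1 \<sigma> in auto)
  qed
qed

lemma touch_exists:
  fixes h :: "real \<Rightarrow> real \<Rightarrow> real"
  assumes r1: "0 < r1" "r1 < r0" "r1 < t0"
    and h: "\<And>L. continuous_on UNIV (h L)" "\<And>L z. 0 \<le> L \<Longrightarrow> 0 \<le> h L z" "\<And>L. h L 0 = 0" "\<And>L z. h L (- z) = h L z"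
      "\<And>\<rho> B. 0 < \<rho> \<Longrightarrow> \<exists>L\<ge>Lmin. B \<le> h L \<rho>" and Lmin: "0 \<le> Lmin"
  obtains L t' z' e where "Lmin \<le> L" "\<bar>t' - t0\<bar> < r1" "\<bar>z'\<bar> < r1" "0 < e"
    "\<And>t z. \<bar>t - t'\<bar> < e \<Longrightarrow> \<bar>z - z'\<bar> < e \<Longrightarrow>
       U (t, x0 + z) \<le> U (t', x0 + z') + (k s0 t - k s0 t') + (h L z - h L z')"
proof -
  have strict: "U (t0 - r1, x0) - k s0 (t0 - r1) < U (t0, x0) - k s0 t0"
    "U (t0 + r1, x0) - k s0 (t0 + r1) < U (t0, x0) - k s0 t0"
    using r1 by (intro k_strict; simp)+
  obtain \<rho> B where \<rho>: "0 < \<rho>" "\<rho> \<le> r1" and bound: "\<And>\<tau> t z. \<bar>\<tau> - s0\<bar> \<le> \<rho> \<Longrightarrow> \<bar>t - t0\<bar> \<le> r1 \<Longrightarrow> \<bar>z\<bar> \<le> \<rho> \<Longrightarrow>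
      (U (t, x0 + 1 * z) - k \<tau> t) - (U (t0, x0) - k \<tau> t0) < B"
    and alt: "\<And>h \<tau> y. \<lbrakk>continuous_on UNIV h; h 0 = 0; \<And>z. - 0 * \<bar>z\<bar> \<le> h z; B \<le> h (- \<rho>); \<bar>\<tau> - s0\<bar> \<le> \<rho>; 0 \<le> y; y \<le> \<rho>\<rbrakk> \<Longrightarrow>
      (\<exists>t' z' \<delta>. \<bar>t' - t0\<bar> < r1 \<and> \<bar>z'\<bar> < \<rho> \<and> 0 < \<delta> \<and> (\<forall>t z. \<bar>t - t'\<bar> < \<delta> \<longrightarrow> \<bar>z - z'\<bar> < \<delta> \<longrightarrow>
          U (t, x0 + 1 * z) \<le> U (t', x0 + 1 * z') + (k \<tau> t - k \<tau> t') + (h z - h z'))) \<or>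
      (\<exists>t'. \<bar>t' - t0\<bar> \<le> r1 \<and> h y \<le> (U (t', x0 + 1 * y) - k \<tau> t') - (U (t0, x0) - k \<tau> t0))"
    by (rule box_maximum[OF usc k_continuous r1(1,3) order_refl strict, of 1]) blast
  obtain L where L: "Lmin \<le> L" "B \<le> h L \<rho>" using h(5)[OF \<rho>(1)] by blast
  have 1: "B \<le> h L (- \<rho>)" "- 0 * \<bar>z\<bar> \<le> h L z" for z using L Lmin h(2,4) by auto
  have 2: "\<bar>s0 - s0\<bar> \<le> \<rho>" "0 \<le> \<rho>" "\<rho> \<le> \<rho>" "\<bar>\<rho>\<bar> \<le> \<rho>" using \<rho> by auto
  have "\<not> h L \<rho> \<le> (U (t', x0 + 1 * \<rho>) - k s0 t') - (U (t0, x0) - k s0 t0)" if "\<bar>t' - t0\<bar> \<le> r1" for t'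
    using bound[OF 2(1) that 2(4)] L(2) by linarith
  then obtain t' z' e where "\<bar>t' - t0\<bar> < r1" "\<bar>z'\<bar> < \<rho>" "0 < e"
    "\<forall>t z. \<bar>t - t'\<bar> < e \<longrightarrow> \<bar>z - z'\<bar> < e \<longrightarrow>
       U (t, x0 + 1 * z) \<le> U (t', x0 + 1 * z') + (k s0 t - k s0 t') + (h L z - h L z')"
    using alt[OF h(1,3) 1(2,1) 2(1-3)] by blast
  then show ?thesis using that[OF L(1), of t' z' e] \<rho>(2) by simp
qed

end

lemma C1_real_neg_part_square:
  "C1_real S (\<lambda>z. p * z + L * (max 0 (- z))\<^sup>2) (\<lambda>z. p - 2 * L * max 0 (- z))"
proof (rule C1_realI)
  show "continuous_on S (\<lambda>z. p - 2 * L * max 0 (- z))" by (intro continuous_intros)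
  fix x
  have "((\<lambda>z. (max 0 (- z - 0))\<^sup>2) has_real_derivative (2 * max 0 (- x - 0)) * (- 1)) (at x)"
    by (rule DERIV_chain2[OF DERIV_pos_part_square]) (auto intro!: derivative_eq_intros)
  then have "((\<lambda>z. (max 0 (- z))\<^sup>2) has_real_derivative - (2 * max 0 (- x))) (at x)" by simp
  from DERIV_add[OF DERIV_cmult[OF DERIV_ident, of p] DERIV_cmult[OF this, of L]]
  show "((\<lambda>z. p * z + L * (max 0 (- z))\<^sup>2) has_real_derivative p - 2 * L * max 0 (- x)) (at x)"
    by (simp add: algebra_simps)
qed

lemma C1_real_reflect:
  assumes "C1_real UNIV h h'" shows "C1_real UNIV (\<lambda>x. h (\<sigma> * (x - x0))) (\<lambda>x. \<sigma> * h' (\<sigma> * (x - x0)))"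
proof (rule C1_realI)
  have h': "continuous_on UNIV h'" "\<And>x. (h has_real_derivative h' x) (at x)" using assms by (auto simp: C1_real_def)
  show "continuous_on UNIV (\<lambda>x. \<sigma> * h' (\<sigma> * (x - x0)))"
    by (intro continuous_intros continuous_on_compose2[OF h'(1)]) auto
  fix x
  have "((\<lambda>x. h (\<sigma> * (x - x0))) has_real_derivative h' (\<sigma> * (x - x0)) * \<sigma>) (at x)"
    by (rule DERIV_chain2[OF h'(2)]) (auto intro!: derivative_eq_intros)
  then show "((\<lambda>x. h (\<sigma> * (x - x0))) has_real_derivative \<sigma> * h' (\<sigma> * (x - x0))) (at x)"
    by (simp add: mult.commute)
qed

lemma penalty_unbounded: "0 < (\<rho>::real) \<Longrightarrow> \<exists>L\<ge>Lmin. B \<le> c + L * \<rho>"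
  by (rule exI[of _ "max Lmin ((B - c) / \<rho>)"]) (auto simp: field_simps max_def)

context doubling begin

lemma touch_slope:
  assumes U: "visc_sub H X U" and \<sigma>: "\<sigma> = 1 \<or> \<sigma> = -1" and h: "C1_real UNIV h h'"
    and t': "0 < t'" "x0 + \<sigma> * z' \<in> X" and e: "0 < e"
    and touch: "\<forall>t z. \<bar>t - t'\<bar> < e \<longrightarrow> \<bar>z - z'\<bar> < e \<longrightarrow>
      U (t, x0 + \<sigma> * z) \<le> U (t', x0 + \<sigma> * z') + (k \<tau> t - k \<tau> t') + (h z - h z')"
  shows "k' \<tau> t' + H (\<sigma> * h' z') \<le> 0"
proof -
  have \<sigma>\<sigma>: "\<sigma> * ((x0 + \<sigma> * z') - x0) = z'" using \<sigma> by auto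
  have "k' \<tau> t' + H (\<sigma> * h' (\<sigma> * ((x0 + \<sigma> * z') - x0))) \<le> 0"
  proof (rule visc_subD[OF U t' k_C1 C1_real_reflect[OF h] e])
    fix s y assume *: "\<bar>s - t'\<bar> < e" "\<bar>y - (x0 + \<sigma> * z')\<bar> < e"
    have y: "x0 + \<sigma> * (\<sigma> * (y - x0)) = y" using \<sigma> by auto
    have "\<bar>\<sigma> * (y - x0) - z'\<bar> < e" using *(2) \<sigma> by auto
    with touch *(1) have "U (s, x0 + \<sigma> * (\<sigma> * (y - x0))) \<le>
        U (t', x0 + \<sigma> * z') + (k \<tau> s - k \<tau> t') + (h (\<sigma> * (y - x0)) - h z')" by blast
    then show "U (s, y) \<le> U (t', x0 + \<sigma> * z') + (k \<tau> s - k \<tau> t') +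
        (h (\<sigma> * (y - x0)) - h (\<sigma> * ((x0 + \<sigma> * z') - x0)))" unfolding y \<sigma>\<sigma> .
  qed
  then show ?thesis unfolding \<sigma>\<sigma> .
qed

text \<open>At the maximum the equation for \<open>U\<close> confines the slopes of \<open>U\<close> to a sublevel set of the
  Hamiltonian, an interval around its minimum point \<open>p0\<close>. As \<open>V\<close> lies above \<open>U\<close> up to the penalties, it
  leaves the maximum point to the right with slope at least the left end \<open>p\<close> of such an interval, and
  to the left with slope at most the right end \<open>q\<close>. Between \<open>p\<close> and \<open>q\<close> the equation for \<open>V\<close> is
  violated because of the gain \<open>\<eta>\<close>, so both slopes can be moved on to \<open>p0\<close>, and there a \<open>C\<^sup>1\<close> test
  function contradicts the equation for \<open>V\<close>.\<close>
lemma no_interior_maximum: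
  assumes H: "hamiltonian H p0" and U: "visc_sub H X U" and V: "visc_super H X V"
    and X: "open X" "x0 \<in> X"
    and \<beta>: "\<And>q q'. H q \<le> - a \<Longrightarrow> \<bar>q' - q\<bar> \<le> \<beta> \<Longrightarrow> H q' < H q + \<eta> / 2"
  shows False
proof -
  interpret H: hamiltonian H p0 by (rule H)
  obtain \<epsilon> where \<epsilon>: "0 < \<epsilon>" "\<And>x. \<bar>x - x0\<bar> < \<epsilon> \<Longrightarrow> x \<in> X"
    using X unfolding open_dist dist_real_def by blast
  obtain r1 where r1: "0 < r1" "r1 < r0" "r1 < t0" "r1 < s0"
    "\<And>\<tau> t. \<bar>t - t0\<bar> \<le> r1 \<Longrightarrow> \<bar>\<tau> - s0\<bar> \<le> r1 \<Longrightarrow> a + 3 * \<eta> / 4 \<le> k' \<tau> t" using k'_lower_bound by metis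
  define r where "r = min r1 \<epsilon>"
  have r: "0 < r" "r < r0" "r < t0" "r \<le> r1" "r \<le> \<epsilon>" using r1 \<epsilon> by (auto simp: r_def)
  have slope: "a + 3 * \<eta> / 4 + H (\<sigma> * h' z') \<le> 0"
    if "\<sigma> = 1 \<or> \<sigma> = -1" "C1_real UNIV h h'" "\<bar>\<tau> - s0\<bar> \<le> r" "\<bar>t' - t0\<bar> < r" "\<bar>z'\<bar> < r" "0 < e"
      "\<forall>t z. \<bar>t - t'\<bar> < e \<longrightarrow> \<bar>z - z'\<bar> < e \<longrightarrow>
      U (t, x0 + \<sigma> * z) \<le> U (t', x0 + \<sigma> * z') + (k \<tau> t - k \<tau> t') + (h z - h z')" for \<sigma> h h' \<tau> t' z' e
  proof -
    have "0 < t'" "x0 + \<sigma> * z' \<in> X" using that r by (auto intro!: \<epsilon>(2))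
    from touch_slope[OF U that(1,2) this that(6,7)] r1(5)[of t' \<tau>] that(3,4) r(4) show ?thesis by simp
  qed
  have min: "a + 3 * \<eta> / 4 + H p0 \<le> 0"
  proof -
    let ?h = "\<lambda>L z. 0 * z + L * (z - 0)\<^sup>2 :: real"
    obtain L t' z' e where "0 \<le> L" "\<bar>t' - t0\<bar> < r" "\<bar>z'\<bar> < r" "0 < e"
      "\<And>t z. \<bar>t - t'\<bar> < e \<Longrightarrow> \<bar>z - z'\<bar> < e \<Longrightarrow>
         U (t, x0 + z) \<le> U (t', x0 + z') + (k s0 t - k s0 t') + (?h L z - ?h L z')"
    proof (rule touch_exists[OF r(1-3), of ?h 0])
      show "continuous_on UNIV (?h L)" for L by (intro continuous_intros)
      show "\<exists>L\<ge>0. B \<le> ?h L \<rho>" if "0 < \<rho>" for \<rho> B using penalty_unbounded[of "\<rho>\<^sup>2" 0 B 0] that by simp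
    qed auto
    then have "a + 3 * \<eta> / 4 + H (1 * (0 + 2 * L * (z' - 0))) \<le> 0"
      using r by (intro slope[OF _ C1_real_quadratic, of 1 s0 t' z' e]) auto
    then show ?thesis using H.minimal[of "1 * (0 + 2 * L * (z' - 0))"] by linarith
  qed
  define c where "c = - a - \<eta> / 2"
  have c: "H p0 \<le> c" "c < - a" "0 < a + 3 * \<eta> / 4 + c" using min pos by (auto simp: c_def)
  obtain p where p: "p \<le> p0" "H p = c" using H.level_left[OF c(1)] by blast
  obtain q where q: "p0 \<le> q" "H q = c" using H.level_right[OF c(1)] by blast
  have pen: "\<exists>L\<ge>0. B \<le> s * (- \<rho>) + L * (max 0 (- (- \<rho>)))\<^sup>2" if "0 < \<rho>" for \<rho> B s :: real
    using penalty_unbounded[of "\<rho>\<^sup>2" 0 B "s * (- \<rho>)"] that by simp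
  have low: "- \<bar>s\<bar> * \<bar>z\<bar> \<le> s * z + L * (max 0 (- z))\<^sup>2" if "0 \<le> L" for s z L :: real
  proof -
    have "0 \<le> L * (max 0 (- z))\<^sup>2" using that by simp
    then show ?thesis using abs_ge_minus_self[of "s * z"] by (simp add: abs_mult)
  qed
  have cont: "continuous_on UNIV (\<lambda>z. s * z + L * (max 0 (- z))\<^sup>2)" for s L :: real by (intro continuous_intros)
  obtain \<rho>1 where \<rho>1: "0 < \<rho>1" "\<And>\<tau> y. \<bar>\<tau> - s0\<bar> < \<rho>1 \<Longrightarrow> 0 \<le> y \<Longrightarrow> y < \<rho>1 \<Longrightarrow>
      V (s0, x0) + a * (\<tau> - s0) - 1 / (2 * \<delta>) * (\<tau> - s0)\<^sup>2 + p * y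
        - \<beta> * (sqrt (1\<^sup>2 + (x0 + 1 * y)\<^sup>2) - sqrt (1\<^sup>2 + x0\<^sup>2)) \<le> V (\<tau>, x0 + 1 * y)"
  proof (rule V_slope[where \<sigma> = 1 and p = p and Lmin = 0 and h = "\<lambda>L z. p * z + L * (max 0 (- z))\<^sup>2", OF _ r(1-3) cont low])
    fix L \<tau> t' z' e
    assume *: "0 \<le> L" "\<bar>\<tau> - s0\<bar> \<le> r" "\<bar>t' - t0\<bar> < r" "\<bar>z'\<bar> < r" "0 < e" and
      touch: "\<forall>t z. \<bar>t - t'\<bar> < e \<longrightarrow> \<bar>z - z'\<bar> < e \<longrightarrow> U (t, x0 + 1 * z)
         \<le> U (t', x0 + 1 * z') + (k \<tau> t - k \<tau> t') + (p * z + L * (max 0 (- z))\<^sup>2 - (p * z' + L * (max 0 (- z'))\<^sup>2))"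
    from slope[OF _ C1_real_neg_part_square *(2-5) touch]
    have "a + 3 * \<eta> / 4 + H (1 * (p - 2 * L * max 0 (- z'))) \<le> 0" by simp
    moreover have "H p \<le> H (1 * (p - 2 * L * max 0 (- z')))" using *(1) p(1) by (intro H.decreasing) auto
    ultimately show False using p(2) c(3) by linarith
  qed (use pen in auto)
  obtain \<rho>2 where \<rho>2: "0 < \<rho>2" "\<And>\<tau> y. \<bar>\<tau> - s0\<bar> < \<rho>2 \<Longrightarrow> 0 \<le> y \<Longrightarrow> y < \<rho>2 \<Longrightarrow>
      V (s0, x0) + a * (\<tau> - s0) - 1 / (2 * \<delta>) * (\<tau> - s0)\<^sup>2 + (- q) * y
        - \<beta> * (sqrt (1\<^sup>2 + (x0 + (-1) * y)\<^sup>2) - sqrt (1\<^sup>2 + x0\<^sup>2)) \<le> V (\<tau>, x0 + (-1) * y)"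
  proof (rule V_slope[where \<sigma> = "-1" and p = "- q" and Lmin = 0 and h = "\<lambda>L z. (- q) * z + L * (max 0 (- z))\<^sup>2", OF _ r(1-3) cont low])
    fix L \<tau> t' z' e
    assume *: "0 \<le> L" "\<bar>\<tau> - s0\<bar> \<le> r" "\<bar>t' - t0\<bar> < r" "\<bar>z'\<bar> < r" "0 < e" and
      touch: "\<forall>t z. \<bar>t - t'\<bar> < e \<longrightarrow> \<bar>z - z'\<bar> < e \<longrightarrow> U (t, x0 + (-1) * z)
         \<le> U (t', x0 + (-1) * z') + (k \<tau> t - k \<tau> t') + ((- q) * z + L * (max 0 (- z))\<^sup>2 - ((- q) * z' + L * (max 0 (- z'))\<^sup>2))"
    from slope[OF _ C1_real_neg_part_square *(2-5) touch]
    have "a + 3 * \<eta> / 4 + H ((-1) * (- q - 2 * L * max 0 (- z'))) \<le> 0" by simp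
    moreover have "H q \<le> H ((-1) * (- q - 2 * L * max 0 (- z')))" using *(1) q(1) by (intro H.increasing) auto
    ultimately show False using q(2) c(3) by linarith
  next
    show "\<exists>L\<ge>0. B \<le> - q * (- \<rho>) + L * (max 0 (- (- \<rho>)))\<^sup>2" if "0 < \<rho>" for \<rho> B by (rule pen[OF that])
  qed auto
  define f where "f = (\<lambda>\<tau>. a * \<tau> + (- (1 / (2 * \<delta>))) * (\<tau> - s0)\<^sup>2)"
  have f: "C1_real {0<..} f (\<lambda>\<tau>. a + 2 * (- (1 / (2 * \<delta>))) * (\<tau> - s0))"
    unfolding f_def by (rule C1_real_quadratic)
  have \<beta>_pen: "\<beta> * (sqrt (1\<^sup>2 + (x0 + \<sigma> * y)\<^sup>2) - sqrt (1\<^sup>2 + x0\<^sup>2)) \<le> \<beta> * y"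
    if "\<sigma> = 1 \<or> \<sigma> = -1" "0 \<le> y" for \<sigma> y
  proof (rule mult_left_mono[OF _ pos(4)])
    have "\<bar>x0 + \<sigma> * y - x0\<bar> = y" using that by auto
    then show "sqrt (1\<^sup>2 + (x0 + \<sigma> * y)\<^sup>2) - sqrt (1\<^sup>2 + x0\<^sup>2) \<le> y"
      using hypot_lipschitz[of 1 "x0 + \<sigma> * y" x0] by linarith
  qed
  have f_diff: "f \<tau> - f s0 = a * (\<tau> - s0) - 1 / (2 * \<delta>) * (\<tau> - s0)\<^sup>2" for \<tau>
    by (simp add: f_def algebra_simps)
  obtain R1 K1 where R1: "R1 > 0" "K1 \<ge> 0" "\<And>t y. \<bar>t - s0\<bar> < R1 \<Longrightarrow> 0 \<le> y \<Longrightarrow> y < R1 \<Longrightarrow>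
      V (s0, x0) + (f t - f s0) - K1 * (t - s0)\<^sup>2 + p0 * y - K1 * y\<^sup>2 \<le> V (t, x0 + 1 * y)"
  proof (rule steepen_super[where q = "p - \<beta>" and p = p0, OF V lsc H.continuous pos(6) _ \<epsilon>(1) _ f \<rho>1(1)])
    show "x0 + 1 * y \<in> X" if "0 < y" "y < \<epsilon>" for y using that by (intro \<epsilon>(2)) auto
    show "V (s0, x0) + (f \<tau> - f s0) + (p - \<beta>) * y \<le> V (\<tau>, x0 + 1 * y)"
      if "\<bar>\<tau> - s0\<bar> < \<rho>1" "0 \<le> y" "y < \<rho>1" for \<tau> y
      using \<rho>1(2)[OF that] \<beta>_pen[of 1 y] that(2) unfolding f_diff left_diff_distrib by linarith
    show "a + 2 * (- (1 / (2 * \<delta>))) * (s0 - s0) + H (1 * p') < 0" if "p - \<beta> \<le> p'" "p' \<le> p0" for p'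
    proof (cases "p' \<le> p")
      case True
      then show ?thesis using \<beta>[of p p'] p(2) c(2) that by (simp add: c_def)
    next
      case False
      then show ?thesis using H.decreasing[of p p'] p(2) c(2) that by simp
    qed
  qed auto
  obtain R2 K2 where R2: "R2 > 0" "K2 \<ge> 0" "\<And>t y. \<bar>t - s0\<bar> < R2 \<Longrightarrow> 0 \<le> y \<Longrightarrow> y < R2 \<Longrightarrow>
      V (s0, x0) + (f t - f s0) - K2 * (t - s0)\<^sup>2 + (- p0) * y - K2 * y\<^sup>2 \<le> V (t, x0 + (-1) * y)"
  proof (rule steepen_super[where q = "- q - \<beta>" and p = "- p0", OF V lsc H.continuous pos(6) _ \<epsilon>(1) _ f \<rho>2(1)])
    show "x0 + (-1) * y \<in> X" if "0 < y" "y < \<epsilon>" for y using that by (intro \<epsilon>(2)) auto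
    show "V (s0, x0) + (f \<tau> - f s0) + (- q - \<beta>) * y \<le> V (\<tau>, x0 + (-1) * y)"
      if "\<bar>\<tau> - s0\<bar> < \<rho>2" "0 \<le> y" "y < \<rho>2" for \<tau> y
      using \<rho>2(2)[OF that] \<beta>_pen[of "-1" y] that(2) unfolding f_diff left_diff_distrib by linarith
    show "a + 2 * (- (1 / (2 * \<delta>))) * (s0 - s0) + H ((-1) * p') < 0" if "- q - \<beta> \<le> p'" "p' \<le> - p0" for p'
    proof (cases "q \<le> - p'")
      case True
      then show ?thesis using \<beta>[of q "- p'"] q(2) c(2) that by (simp add: c_def)
    next
      case False
      then show ?thesis using H.increasing[of "- p'" q] q(2) c(2) that by simp
    qed
  qed auto
  have "visc_super H {x0} V" using V X(2) unfolding visc_super_def by blast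
  from two_sided_super[OF this pos(6) f R1 R2] have "0 \<le> a + H p0" by simp
  then show False using min pos by linarith
qed

text \<open>At the junction the bounds \<open>p\<close> and \<open>q\<close> for the slopes of \<open>V\<close>, obtained in the same way, lie on
  the branches that the flux sees. Hence \<open>F A q p\<close> is itself at the level to which \<open>U\<close> is confined, and
  a test function with these slopes contradicts the junction condition for \<open>V\<close> at once. The limiter \<open>A\<close>
  is below this level because \<open>U\<close> satisfies the junction condition with arbitrarily steep kinks.\<close>
lemma no_maximum_at_junction:
  assumes J: "junction H1 H2 p1 p2" and A: "A_zero H1 H2 p1 p2 \<le> A"
    and U: "jsub H1 H2 (flux H1 H2 p1 p2 A) U" and V: "jsuper H1 H2 (flux H1 H2 p1 p2 A) V" and x0: "x0 = 0"
  shows False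
proof -
  interpret junction H1 H2 p1 p2 by (rule J)
  obtain r where r: "0 < r" "r < r0" "r < t0" "r < s0"
    "\<And>\<tau> t. \<bar>t - t0\<bar> \<le> r \<Longrightarrow> \<bar>\<tau> - s0\<bar> \<le> r \<Longrightarrow> a + 3 * \<eta> / 4 \<le> k' \<tau> t" using k'_lower_bound by metis
  define b where "b = a + 3 * \<eta> / 4"
  have no_touch: False
    if pos': "0 < b + H1 l" "0 < b + H2 m" "0 < b + F A l m"
      and near: "\<bar>\<tau> - s0\<bar> \<le> r" "\<bar>t' - t0\<bar> < r" "0 < e"
      and touch: "\<And>t x. \<bar>t - t'\<bar> < e \<Longrightarrow> \<bar>x - x'\<bar> < e \<Longrightarrow>
        U (t, x) \<le> U (t', x') + (k \<tau> t - k \<tau> t') + (kink l m x - kink l m x')" for l m \<tau> t' x' e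
  proof -
    have t': "0 < t'" using near r by linarith
    have "b \<le> k' \<tau> t'" unfolding b_def using near by (intro r(5)) auto
    moreover have "(x' < 0 \<longrightarrow> k' \<tau> t' + H1 l \<le> 0) \<and> (0 < x' \<longrightarrow> k' \<tau> t' + H2 m \<le> 0) \<and> (x' = 0 \<longrightarrow> k' \<tau> t' + F A l m \<le> 0)"
      by (rule jsub_residual[OF U t' k_C1 C1_real_kink near(3)]) (rule touch)
    ultimately show False using pos' by (cases x' "0::real" rule: linorder_cases) auto
  qed
  obtain R1 where R1: "R1 > 0" "\<And>q. R1 \<le> \<bar>q\<bar> \<Longrightarrow> - b < H1 q" using H1.large_outside[of "- b"] by metis
  obtain R2 where R2: "R2 > 0" "\<And>q. R2 \<le> \<bar>q\<bar> \<Longrightarrow> - b < H2 q" using H2.large_outside[of "- b"] by metis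
  define R where "R = max R1 R2"
  have R: "0 \<le> R" "\<And>L. R \<le> L \<Longrightarrow> 0 < b + H1 (- L)" "\<And>L. R \<le> L \<Longrightarrow> 0 < b + H2 L"
  proof -
    show "0 \<le> R" using R1 by (simp add: R_def)
    show "0 < b + H1 (- L)" "0 < b + H2 L" if "R \<le> L" for L
      using R1(1) R1(2)[of "- L"] R2(1) R2(2)[of L] that by (auto simp: R_def)
  qed
  have pen: "\<exists>L\<ge>R. B \<le> L * \<rho>" if "0 < \<rho>" for \<rho> B using penalty_unbounded[OF that, of R B 0] by simp
  have "b + A \<le> 0"
  proof (rule ccontr)
    assume bA: "\<not> b + A \<le> 0"
    obtain L t' z' e where *: "R \<le> L" "\<bar>t' - t0\<bar> < r" "\<bar>z'\<bar> < r" "0 < e"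
      "\<And>t z. \<bar>t - t'\<bar> < e \<Longrightarrow> \<bar>z - z'\<bar> < e \<Longrightarrow>
         U (t, x0 + z) \<le> U (t', x0 + z') + (k s0 t - k s0 t') + (kink (- L) L z - kink (- L) L z')"
    proof (rule touch_exists[OF r(1-3), of "\<lambda>L. kink (- L) L" R])
      show "\<exists>L\<ge>R. B \<le> kink (- L) L \<rho>" if "0 < \<rho>" for \<rho> B using pen[OF that] that by (simp add: kink_def)
      show "0 \<le> kink (- L) L z" if "0 \<le> L" for L z using that by (auto simp: kink_def mult_nonneg_nonpos)
      show "kink (- L) L (- z) = kink (- L) L z" for L z by (auto simp: kink_def)
      show "kink (- L) L 0 = 0" for L by (simp add: kink_def)
    qed (use R continuous_kink in auto)
    have "0 < b + F A (- L) L" using bA flux_ge(1)[of A "- L" L] by linarith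
    from no_touch[OF R(2,3)[OF *(1)] this _ *(2,4), of s0 z'] *(5) r show False unfolding x0 by simp
  qed
  then have bA: "A \<le> - b" by simp
  define c where "c = - a - \<eta> / 2"
  have c: "H1 p1 \<le> c" "H2 p2 \<le> c" "A < - a" "c < - a" "0 < b + c"
    using A0_le A bA pos unfolding c_def b_def by linarith+
  obtain p where p: "p \<le> p2" "H2 p = c" using H2.level_left[OF c(2)] by blast
  obtain q where q: "p1 \<le> q" "H1 q = c" using H1.level_right[OF c(1)] by blast
  have Fp: "c \<le> F A l p" for l using flux_ge(5)[of p A l] p by (simp add: H2.H_minus_eq min_def split: if_splits)
  have Fq: "c \<le> F A q m" for m using flux_ge(4)[of q A m] q by (simp add: H1.H_plus_eq max_def split: if_splits)
  have low: "- \<bar>s\<bar> * \<bar>z\<bar> \<le> kink (- L) s z" if "0 \<le> L" for L s z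
  proof (cases "z < 0")
    case True
    then have "0 \<le> kink (- L) s z" using that by (simp add: kink_def mult_nonneg_nonpos)
    moreover have "- \<bar>s\<bar> * \<bar>z\<bar> \<le> 0" by simp
    ultimately show ?thesis by linarith
  next
    case False
    then show ?thesis using abs_ge_minus_self[of "s * z"] by (simp add: kink_def abs_mult)
  qed
  have kpen: "\<exists>L\<ge>R. B \<le> kink (- L) s (- \<rho>)" if "0 < \<rho>" for \<rho> B s using pen[OF that] that by (simp add: kink_def)
  obtain \<rho>1 where \<rho>1: "0 < \<rho>1" "\<And>\<tau> y. \<bar>\<tau> - s0\<bar> < \<rho>1 \<Longrightarrow> 0 \<le> y \<Longrightarrow> y < \<rho>1 \<Longrightarrow>
      V (s0, x0) + a * (\<tau> - s0) - 1 / (2 * \<delta>) * (\<tau> - s0)\<^sup>2 + p * y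
        - \<beta> * (sqrt (1\<^sup>2 + (x0 + 1 * y)\<^sup>2) - sqrt (1\<^sup>2 + x0\<^sup>2)) \<le> V (\<tau>, x0 + 1 * y)"
  proof (rule V_slope[where \<sigma> = 1 and p = p and Lmin = R and h = "\<lambda>L. kink (- L) p", OF _ r(1-3) continuous_kink low])
    fix L \<tau> t' z' e
    assume *: "R \<le> L" "\<bar>\<tau> - s0\<bar> \<le> r" "\<bar>t' - t0\<bar> < r" "\<bar>z'\<bar> < r" "0 < e" and
      touch: "\<forall>t z. \<bar>t - t'\<bar> < e \<longrightarrow> \<bar>z - z'\<bar> < e \<longrightarrow> U (t, x0 + 1 * z)
         \<le> U (t', x0 + 1 * z') + (k \<tau> t - k \<tau> t') + (kink (- L) p z - kink (- L) p z')"
    have "0 < b + H2 p" "0 < b + F A (- L) p" using p(2) c(5) Fp[of "- L"] by linarith+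
    from no_touch[OF R(2)[OF *(1)] this *(2,3,5), of z'] touch show False unfolding x0 by simp
  next
    show "kink (- L) p y = p * y" if "0 \<le> y" for L y using that by (simp add: kink_def)
  qed (use R kpen in auto)
  obtain \<rho>2 where \<rho>2: "0 < \<rho>2" "\<And>\<tau> y. \<bar>\<tau> - s0\<bar> < \<rho>2 \<Longrightarrow> 0 \<le> y \<Longrightarrow> y < \<rho>2 \<Longrightarrow>
      V (s0, x0) + a * (\<tau> - s0) - 1 / (2 * \<delta>) * (\<tau> - s0)\<^sup>2 + (- q) * y
        - \<beta> * (sqrt (1\<^sup>2 + (x0 + (-1) * y)\<^sup>2) - sqrt (1\<^sup>2 + x0\<^sup>2)) \<le> V (\<tau>, x0 + (-1) * y)"
  proof (rule V_slope[where \<sigma> = "-1" and p = "- q" and Lmin = R and h = "\<lambda>L. kink (- L) (- q)", OF _ r(1-3) continuous_kink low])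
    fix L \<tau> t' z' e
    assume *: "R \<le> L" "\<bar>\<tau> - s0\<bar> \<le> r" "\<bar>t' - t0\<bar> < r" "\<bar>z'\<bar> < r" "0 < e" and
      touch: "\<forall>t z. \<bar>t - t'\<bar> < e \<longrightarrow> \<bar>z - z'\<bar> < e \<longrightarrow> U (t, x0 + (-1) * z)
         \<le> U (t', x0 + (-1) * z') + (k \<tau> t - k \<tau> t') + (kink (- L) (- q) z - kink (- L) (- q) z')"
    have pos': "0 < b + H1 q" "0 < b + F A q L" using q(2) c(5) Fq[of L] by linarith+
    show False
    proof (rule no_touch[OF pos'(1) R(3)[OF *(1)] pos'(2) *(2,3,5)])
      fix t x assume "\<bar>t - t'\<bar> < e" "\<bar>x - - z'\<bar> < e"
      then have "\<bar>t - t'\<bar> < e" "\<bar>- x - z'\<bar> < e" by linarith+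
      then have "U (t, x0 + (-1) * (- x)) \<le> U (t', x0 + (-1) * z') + (k \<tau> t - k \<tau> t') + (kink (- L) (- q) (- x) - kink (- L) (- q) (- (- z')))"
        using touch unfolding minus_minus by blast
      then show "U (t, x) \<le> U (t', - z') + (k \<tau> t - k \<tau> t') + (kink q L x - kink q L (- z'))"
        unfolding kink_uminus x0 by simp
    qed
  next
    show "kink (- L) (- q) y = - q * y" if "0 \<le> y" for L y using that by (simp add: kink_def)
  qed (use R kpen in auto)
  \<comment> \<open>The penalty in space has a critical point at the junction and does not change the slopes there.\<close>
  define h where "h = (\<lambda>x. kink q p x + - (\<beta> * sqrt (1\<^sup>2 + x\<^sup>2)))"
  define pen' where "pen' = (\<lambda>x. \<beta> * (x / sqrt (1\<^sup>2 + x\<^sup>2)))"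
  have pen': "C1_real S (\<lambda>x. - (\<beta> * sqrt (1\<^sup>2 + x\<^sup>2))) (\<lambda>x. - pen' x)" for S
    unfolding pen'_def by (intro C1_real_uminus C1_real_cmult C1_real_hypot) simp
  have h: "C1_real {..0} h (\<lambda>x. q + - pen' x)" "C1_real {0..} h (\<lambda>x. p + - pen' x)"
    unfolding h_def by (intro C1_real_add C1_real_kink pen')+
  define f where "f = (\<lambda>\<tau>. a * \<tau> + (- (1 / (2 * \<delta>))) * (\<tau> - s0)\<^sup>2)"
  have f: "C1_real {0<..} f (\<lambda>\<tau>. a + 2 * (- (1 / (2 * \<delta>))) * (\<tau> - s0))"
    unfolding f_def by (rule C1_real_quadratic)
  have f_diff: "f \<tau> - f s0 = a * (\<tau> - s0) - 1 / (2 * \<delta>) * (\<tau> - s0)\<^sup>2" for \<tau>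
    by (simp add: f_def algebra_simps)
  have \<rho>: "0 < min \<rho>1 \<rho>2" using \<rho>1 \<rho>2 by simp
  have "(0::real) = 0 \<longrightarrow> 0 \<le> (a + 2 * (- (1 / (2 * \<delta>))) * (s0 - s0)) + F A (q + - pen' 0) (p + - pen' 0)"
  proof (rule conjunct2[OF conjunct2[OF jsuper_residual[OF V pos(6) f h \<rho>]]])
    fix \<tau> x assume *: "\<bar>\<tau> - s0\<bar> < min \<rho>1 \<rho>2" "\<bar>x - 0\<bar> < min \<rho>1 \<rho>2"
    have "V (s0, 0) + a * (\<tau> - s0) - 1 / (2 * \<delta>) * (\<tau> - s0)\<^sup>2 + kink q p x
        - \<beta> * (sqrt (1\<^sup>2 + x\<^sup>2) - sqrt (1\<^sup>2 + 0\<^sup>2)) \<le> V (\<tau>, x)"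
      using \<rho>1(2)[of \<tau> x] \<rho>2(2)[of \<tau> "- x"] * unfolding x0 by (cases "x < 0") (simp_all add: kink_def)
    then show "V (s0, 0) + (f \<tau> - f s0) + (h x - h 0) \<le> V (\<tau>, x)"
      unfolding f_diff h_def right_diff_distrib by (simp add: kink_def)
  qed
  then have "0 \<le> a + F A q p" by (simp add: pen'_def)
  moreover have "F A q p < - a"
    unfolding flux_less_iff H1.H_plus_eq H2.H_minus_eq using p q c by (simp add: max_absorb1 min_absorb1)
  ultimately show False by linarith
qed

end

context junction begin

text \<open>Only the time is doubled. As sub- and super-solution have the same initial datum, the barriers bound
  their difference, and a penalty of small slope in space suffices for a maximum to exist; at the
  maximum the two preceding lemmas apply.\<close>
theorem comparison:
  assumes A: "A0 \<le> A"
    and usc: "usc_on half_plane U" and lsc: "usc_on half_plane (\<lambda>z. - V z)"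
    and U: "jsub H1 H2 (F A) U" and V: "jsuper H1 H2 (F A) V"
    and growth: "growth_above U" "growth_above (\<lambda>z. - V z)"
    and g: "uniformly_continuous_on UNIV g" and init: "\<And>x. U (0, x) \<le> g x" "\<And>x. g x \<le> V (0, x)"
    and t: "0 \<le> tt"
  shows "U (tt, xx) \<le> V (tt, xx)"
proof (rule ccontr)
  assume neg: "\<not> ?thesis"
  define D where "D = U (tt, xx) - V (tt, xx)"
  have D: "0 < D" using neg by (simp add: D_def)
  \<comment> \<open>The barriers bound the difference and make it small for small times.\<close>
  define c0 where "c0 = \<bar>H1 p1\<bar> + \<bar>H2 p2\<bar> + \<bar>A\<bar> + 1"
  have c0: "0 < c0" "0 < c0 + H1 p1" "0 < c0 + H2 p2" "0 < c0 + A" unfolding c0_def by linarith+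
  have upper: "U (t, x) \<le> g x + c0 * t" if "0 \<le> t" for t x
    by (rule upper_barrier[OF usc U growth(1) g init(1) c0(2-4) that])
  have "0 < D / 4" "0 < tt + 3" using D t by auto
  from lower_barrier[OF lsc V growth(2) g init(2) this(2,1)] obtain c1 where
    c1: "0 \<le> c1" "\<And>s x. 0 \<le> s \<Longrightarrow> s < tt + 3 \<Longrightarrow> g x - D / 4 - c1 * s \<le> V (s, x)" by blast
  have diff: "U (t, x) - V (s, x) \<le> c0 * t + c1 * s + D / 4" if "0 \<le> t" "0 \<le> s" "s < tt + 3" for t s x
    using upper[OF that(1), of x] c1(2)[OF that(2,3), of x] by linarith
  define M where "M = c0 * (tt + 1) + c1 * (tt + 2) + D / 4"
  have M: "0 < M" unfolding M_def using c0 c1 t D by (simp add: add_pos_nonneg add_nonneg_pos)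
  have diff_M: "U (t, x) - V (s, x) \<le> M" if "0 \<le> t" "t \<le> tt + 1" "0 \<le> s" "s \<le> tt + 2" for t s x
  proof -
    have "c0 * t \<le> c0 * (tt + 1)" "c1 * s \<le> c1 * (tt + 2)" using that c0 c1 by (auto intro: mult_left_mono)
    then show ?thesis using diff[of t s x] that unfolding M_def by linarith
  qed
  define \<theta> where "\<theta> = min (D / (8 * (c0 + c1))) (1 / 2)"
  have \<theta>: "0 < \<theta>" "\<theta> \<le> 1 / 2" "(c0 + c1) * \<theta> \<le> D / 8"
  proof -
    show "0 < \<theta>" using D c0 c1 by (auto simp: \<theta>_def)
    show "\<theta> \<le> 1 / 2" unfolding \<theta>_def by (rule min.cobounded2)
    have "\<theta> \<le> D / (8 * (c0 + c1))" by (simp add: \<theta>_def)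
    then show "(c0 + c1) * \<theta> \<le> D / 8" using c0 c1 by (simp add: field_simps)
  qed
  \<comment> \<open>The parameter of the doubling is small enough to keep both times close to each other, and hence
    away from \<open>0\<close>.\<close>
  define \<delta> where "\<delta> = (\<theta> / 2)\<^sup>2 / (2 * M)"
  have \<delta>: "0 < \<delta>" "2 * \<delta> * M = (\<theta> / 2)\<^sup>2" using \<theta> M by (auto simp: \<delta>_def)
  define \<eta> where "\<eta> = D / (8 * (tt + 1))"
  have \<eta>: "0 < \<eta>" "\<eta> * tt \<le> D / 8" using D t by (auto simp: \<eta>_def field_simps)
  define K where "K = M + 1"
  define w where "w = sqrt (1\<^sup>2 + xx\<^sup>2)"
  have w: "1 \<le> w" by (simp add: w_def)
  \<comment> \<open>A bound for the time derivative at the maximum. It depends on \<open>\<delta>\<close> only, so the slope \<open>\<beta>\<close> of the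
    penalty in space can be chosen afterwards.\<close>
  define C where "C = \<theta> / (2 * \<delta>)"
  obtain d1 where d1: "d1 > 0" "\<And>q q'. H1 q \<le> C \<Longrightarrow> \<bar>q' - q\<bar> \<le> d1 \<Longrightarrow> H1 q' < H1 q + \<eta> / 2"
    using H1.perturb_slope[of "\<eta> / 2" C] \<eta> by auto
  obtain d2 where d2: "d2 > 0" "\<And>q q'. H2 q \<le> C \<Longrightarrow> \<bar>q' - q\<bar> \<le> d2 \<Longrightarrow> H2 q' < H2 q + \<eta> / 2"
    using H2.perturb_slope[of "\<eta> / 2" C] \<eta> by auto
  define \<beta> where "\<beta> = min (min d1 d2) (D / (8 * w))"
  have \<beta>: "0 < \<beta>" "\<beta> \<le> d1" "\<beta> \<le> d2" "\<beta> * w \<le> D / 8"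
  proof -
    show "0 < \<beta>" "\<beta> \<le> d1" "\<beta> \<le> d2" using d1 d2 D w by (auto simp: \<beta>_def)
    have "\<beta> \<le> D / (8 * w)" by (simp add: \<beta>_def)
    then show "\<beta> * w \<le> D / 8" using w by (simp add: field_simps)
  qed
  define P where "P = (\<lambda>t \<tau> x. 1 / (2 * \<delta>) * (t - \<tau>)\<^sup>2 + \<eta> * t + K * (max 0 (t - tt))\<^sup>2 + \<beta> * sqrt (1\<^sup>2 + x\<^sup>2))"
  define \<Phi> where "\<Phi> = (\<lambda>t \<tau> x. U (t, x) - V (\<tau>, x) - P t \<tau> x)"
  have P_parts: "0 \<le> 1 / (2 * \<delta>) * (t - \<tau>)\<^sup>2" "0 \<le> \<eta> * t" "0 \<le> K * (max 0 (t - tt))\<^sup>2"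
    "\<beta> * \<bar>x\<bar> \<le> \<beta> * sqrt (1\<^sup>2 + x\<^sup>2)" "0 \<le> \<beta> * \<bar>x\<bar>" if "0 \<le> t" for t \<tau> x
  proof -
    have "\<bar>x\<bar> \<le> sqrt (1\<^sup>2 + x\<^sup>2)" by (rule real_le_rsqrt) simp
    then show "\<beta> * \<bar>x\<bar> \<le> \<beta> * sqrt (1\<^sup>2 + x\<^sup>2)" using \<beta> by (intro mult_left_mono) auto
  qed (use that \<delta> \<eta> \<beta> M in \<open>auto simp: K_def\<close>)
  have start: "D / 2 < \<Phi> tt tt xx"
    using D \<eta>(2) \<beta>(4) unfolding \<Phi>_def P_def w_def D_def by simp
  define X where "X = \<bar>xx\<bar> + M / \<beta> + 1"
  have X: "\<bar>xx\<bar> \<le> X" "M / \<beta> < X" using M \<beta> by (auto simp: X_def add_pos_nonneg)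
  let ?B = "{0..tt + 1} \<times> ({0..tt + 2} \<times> {- X..X})"
  have in_B: "(tt, tt, xx) \<in> ?B" using t X by auto
  have comp: "compact ?B" by (intro compact_Times) auto
  have "usc_on ?B (\<lambda>z. U (fst z, snd (snd z)) + (- V (fst (snd z), snd (snd z)) + - P (fst z) (fst (snd z)) (snd (snd z))))"
  proof (intro usc_on_add)
    show "usc_on ?B (\<lambda>z. U (fst z, snd (snd z)))"
      by (rule usc_on_compose[OF usc, of _ "\<lambda>z. (fst z, snd (snd z))"]) (auto intro!: continuous_intros)
    show "usc_on ?B (\<lambda>z. - V (fst (snd z), snd (snd z)))"
      by (rule usc_on_compose[OF lsc, of _ "\<lambda>z. (fst (snd z), snd (snd z))"]) (auto intro!: continuous_intros)
    show "usc_on ?B (\<lambda>z. - P (fst z) (fst (snd z)) (snd (snd z)))"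
      unfolding P_def by (intro continuous_imp_usc_on continuous_intros)
  qed
  then obtain z0 where z0: "z0 \<in> ?B" "\<And>z. z \<in> ?B \<Longrightarrow> U (fst z, snd (snd z)) + (- V (fst (snd z), snd (snd z)) + - P (fst z) (fst (snd z)) (snd (snd z)))
      \<le> U (fst z0, snd (snd z0)) + (- V (fst (snd z0), snd (snd z0)) + - P (fst z0) (fst (snd z0)) (snd (snd z0)))"
    using usc_on_attains_max[OF _ comp] in_B by blast
  obtain t0 s0 x0 where z0_eq: "z0 = (t0, s0, x0)" by (cases z0)
  have in_B0: "0 \<le> t0" "t0 \<le> tt + 1" "0 \<le> s0" "s0 \<le> tt + 2" "\<bar>x0\<bar> \<le> X" using z0(1) by (auto simp: z0_eq)
  have max: "\<Phi> t \<tau> x \<le> \<Phi> t0 s0 x0" if "0 \<le> t" "t \<le> tt + 1" "0 \<le> \<tau>" "\<tau> \<le> tt + 2" "\<bar>x\<bar> \<le> X" for t \<tau> x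
  proof -
    have "(t, \<tau>, x) \<in> ?B" using that by auto
    from z0(2)[OF this] show ?thesis unfolding z0_eq \<Phi>_def fst_conv snd_conv by linarith
  qed
  have big: "D / 2 < \<Phi> t0 s0 x0" using max[of tt tt xx] start t X by simp
  note parts = P_parts(1)[OF in_B0(1), of s0] P_parts(2,3)[OF in_B0(1)] P_parts(4,5)[OF in_B0(1), of x0]
  have P_less: "P t0 s0 x0 < M" using big diff_M[OF in_B0(1-4), of x0] D unfolding \<Phi>_def by linarith
  have close: "\<bar>t0 - s0\<bar> < \<theta> / 2"
  proof -
    have "1 / (2 * \<delta>) * (t0 - s0)\<^sup>2 < M" using P_less parts unfolding P_def by linarith
    then have "(t0 - s0)\<^sup>2 < (\<theta> / 2)\<^sup>2" using \<delta> by (simp add: field_simps)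
    then show ?thesis using \<theta>(1) by (metis abs_of_pos half_gt_zero power2_less_imp_less power2_abs abs_ge_zero less_imp_le)
  qed
  have "t0 < tt + 1"
  proof (rule ccontr)
    assume "\<not> ?thesis"
    then have "t0 = tt + 1" using in_B0 by simp
    then have "K * (max 0 (t0 - tt))\<^sup>2 = K" by simp
    then show False using P_less parts unfolding P_def K_def by linarith
  qed
  moreover have "\<bar>x0\<bar> < X"
  proof -
    have "\<beta> * \<bar>x0\<bar> < M" using P_less parts unfolding P_def by linarith
    then have "\<bar>x0\<bar> < M / \<beta>" using \<beta> by (simp add: field_simps)
    then show ?thesis using X by simp
  qed
  moreover have "0 < t0" "0 < s0"
  proof -
    have "\<not> (t0 \<le> \<theta> \<and> s0 \<le> \<theta>)"
    proof
      assume "t0 \<le> \<theta> \<and> s0 \<le> \<theta>"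
      then have "c0 * t0 \<le> c0 * \<theta>" "c1 * s0 \<le> c1 * \<theta>" using c0 c1 by (auto intro: mult_left_mono)
      then have "U (t0, x0) - V (s0, x0) \<le> D / 8 + D / 4"
        using diff[OF in_B0(1,3), of x0] in_B0 \<theta>(3) by (simp add: distrib_right)
      then show False using big parts D unfolding \<Phi>_def P_def by linarith
    qed
    then show "0 < t0" "0 < s0" using close \<theta> by linarith+
  qed
  moreover have "s0 < tt + 2" using close \<open>t0 < tt + 1\<close> \<theta> by linarith
  ultimately have int: "0 < t0" "t0 < tt + 1" "0 < s0" "s0 < tt + 2" "\<bar>x0\<bar> < X" by auto
  define r0 where "r0 = min (min (min t0 (tt + 1 - t0)) (min s0 (tt + 2 - s0))) (X - \<bar>x0\<bar>)"
  interpret doubling U V \<delta> \<eta> K \<beta> tt t0 s0 x0 r0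
  proof
    show "0 < r0" using int by (auto simp: r0_def)
    fix t \<tau> x assume "\<bar>t - t0\<bar> < r0" "\<bar>\<tau> - s0\<bar> < r0" "\<bar>x - x0\<bar> < r0"
    moreover have "r0 \<le> t0" "r0 \<le> tt + 1 - t0" "r0 \<le> s0" "r0 \<le> tt + 2 - s0" "r0 \<le> X - \<bar>x0\<bar>"
      by (auto simp: r0_def)
    ultimately have "0 \<le> t" "t \<le> tt + 1" "0 \<le> \<tau>" "\<tau> \<le> tt + 2" "\<bar>x\<bar> \<le> X" by linarith+
    then have "\<Phi> t \<tau> x \<le> \<Phi> t0 s0 x0" by (rule max)
    then show "U (t, x) - V (\<tau>, x) - (1 / (2 * \<delta>) * (t - \<tau>)\<^sup>2 + \<eta> * t + K * (max 0 (t - tt))\<^sup>2) - \<beta> * sqrt (1\<^sup>2 + x\<^sup>2)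
      \<le> U (t0, x0) - V (s0, x0) - (1 / (2 * \<delta>) * (t0 - s0)\<^sup>2 + \<eta> * t0 + K * (max 0 (t0 - tt))\<^sup>2) - \<beta> * sqrt (1\<^sup>2 + x0\<^sup>2)"
      unfolding \<Phi>_def P_def by linarith
  qed (use usc lsc \<delta> \<eta> \<beta> M int in \<open>auto simp: K_def\<close>)
  have "\<bar>a\<bar> \<le> C"
  proof -
    have "\<bar>a\<bar> = \<bar>t0 - s0\<bar> / \<delta>" using \<delta> by (simp add: a_def abs_divide)
    also have "\<dots> \<le> (\<theta> / 2) / \<delta>" using close \<delta> by (intro divide_right_mono) auto
    finally show ?thesis by (simp add: C_def)
  qed
  then have aC: "- a \<le> C" by linarith
  show False
  proof (cases x0 "0::real" rule: linorder_cases)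
    case less
    show False
      by (rule no_interior_maximum[OF H1 jsub_imp_visc_sub(1)[OF U] jsuper_imp_visc_super(1)[OF V]])
         (use less d1(2) aC \<beta>(2) in auto)
  next
    case greater
    show False
      by (rule no_interior_maximum[OF H2 jsub_imp_visc_sub(2)[OF U] jsuper_imp_visc_super(2)[OF V]])
         (use greater d2(2) aC \<beta>(3) in auto)
  next
    case equal
    show False by (rule no_maximum_at_junction[OF junction_axioms A U V equal])
  qed
qed

end

section \<open>Existence\<close>

lemma jsub_cong:
  assumes "\<And>z. z \<in> half_plane \<Longrightarrow> U z = U' z" and "jsub H1 H2 F U" shows "jsub H1 H2 F U'"
  unfolding jsub_def
proof (intro allI impI)
  fix \<phi> GL GR and z :: "real \<times> real"
  assume a: "junction_test \<phi> GL GR" "0 < fst z" "touches_above \<phi> U' z"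
  have "eventually (\<lambda>w. w \<in> half_plane \<and> 0 < fst w) (nhds z)"
    using eventually_nhds_half_plane[of "fst z" "snd z"] a(2) by simp
  moreover have "eventually (\<lambda>w. U' w \<le> \<phi> w) (nhds z)" "\<phi> z = U' z" using a(3) by (auto simp: touches_above_def)
  ultimately have "eventually (\<lambda>w. U w \<le> \<phi> w) (nhds z)" "\<phi> z = U z"
    using assms(1) a(2) by (auto elim: eventually_elim2 simp: half_plane_def mem_Times_iff)
  then have "touches_above \<phi> U z" by (simp add: touches_above_def)
  then show "residual H1 H2 F GL GR z \<le> 0" using assms(2) a(1,2) unfolding jsub_def by blast
qed

lemma junction_test_shift: "junction_test \<phi> GL GR \<Longrightarrow> junction_test (\<lambda>z. \<phi> z + c) GL GR"
  unfolding junction_test_def C1_on_def by (auto intro!: continuous_intros derivative_eq_intros)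

lemma perturbed_test:
  assumes "junction_test \<phi> GL GR"
  shows "junction_test (\<lambda>z. \<phi> z + (c * (fst z - t0)\<^sup>2 + (kink l m (snd z) + c * (snd z - x0)\<^sup>2)))
    (\<lambda>z. GL z + (2 * c * (fst z - t0), l + 2 * c * (snd z - x0)))
    (\<lambda>z. GR z + (2 * c * (fst z - t0), m + 2 * c * (snd z - x0)))"
proof -
  have q: "C1_real S (\<lambda>t. c * (t - s)\<^sup>2) (\<lambda>t. 2 * c * (t - s))" for S s
    using C1_real_quadratic[of S 0 c s] by simp
  show ?thesis
    by (rule junction_test_add[OF assms], rule junction_test_sum[OF q]; intro C1_real_add C1_real_kink q)
qed

lemma continuous_on_box:
  assumes e: "continuous_on S e" and z: "(t0, x0) \<in> S" and W: "open W" "e (t0, x0) \<in> W"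
  obtains r :: real where "r > 0" "\<And>t x. \<bar>t - t0\<bar> < r \<Longrightarrow> \<bar>x - x0\<bar> < r \<Longrightarrow> (t, x) \<in> S \<Longrightarrow> e (t, x) \<in> W"
proof -
  obtain N where N: "open N" "(t0, x0) \<in> N" "\<And>y. y \<in> S \<Longrightarrow> y \<in> N \<Longrightarrow> e y \<in> W"
    using e z W unfolding continuous_on_topological by meson
  have "eventually (\<lambda>y. y \<in> N) (nhds (t0, x0))" using N by (intro eventually_nhds_in_open)
  then show ?thesis using that N(3) unfolding eventually_nhds_box by blast
qed

text \<open>The residual is not continuous across the junction: near a point of the junction it takes
  values close to one of three numbers.\<close>
lemma residual_nearby:
  assumes \<phi>: "junction_test \<phi> GL GR" and t0: "0 < t0" and W: "open W"
    and H: "continuous_on UNIV H1" "continuous_on UNIV H2"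
    and F: "\<And>S f g. continuous_on S f \<Longrightarrow> continuous_on S g \<Longrightarrow> continuous_on S (\<lambda>z::real \<times> real. F (f z) (g z))"
    and mem: "residual H1 H2 F GL GR (t0, x0) \<in> W"
      "x0 = 0 \<Longrightarrow> fst (GL (t0, 0)) + H1 (snd (GL (t0, 0))) \<in> W"
      "x0 = 0 \<Longrightarrow> fst (GR (t0, 0)) + H2 (snd (GR (t0, 0))) \<in> W"
  obtains r where "r > 0" "r \<le> t0"
    "\<And>t x. \<bar>t - t0\<bar> < r \<Longrightarrow> \<bar>x - x0\<bar> < r \<Longrightarrow> residual H1 H2 F GL GR (t, x) \<in> W"
proof -
  have G: "continuous_on ({0<..} \<times> {..0}) GL" "continuous_on ({0<..} \<times> {0..}) GR"
    using \<phi> by (auto simp: junction_test_def C1_on_def)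
  define eL where "eL = (\<lambda>z. fst (GL z) + H1 (snd (GL z)))"
  define eR where "eR = (\<lambda>z. fst (GR z) + H2 (snd (GR z)))"
  define eF where "eF = (\<lambda>z. fst (GL z) + F (snd (GL z)) (snd (GR z)))"
  have eL: "continuous_on ({0<..} \<times> {..0}) eL" unfolding eL_def
    by (intro continuous_intros G continuous_on_compose2[OF H(1)]) auto
  have eR: "continuous_on ({0<..} \<times> {0..}) eR" unfolding eR_def
    by (intro continuous_intros G continuous_on_compose2[OF H(2)]) auto
  have eF: "continuous_on ({0<..} \<times> {0}) eF" unfolding eF_def
    by (intro continuous_intros F continuous_on_subset[OF G(1)] continuous_on_subset[OF G(2)]) auto
  have res: "residual H1 H2 F GL GR z = (if snd z < 0 then eL z else if 0 < snd z then eR z else eF z)" for z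
    by (simp add: residual_def eL_def eR_def eF_def)
  consider "x0 < 0" | "0 < x0" | "x0 = 0" by linarith
  then show ?thesis
  proof cases
    case 1
    then obtain r where r: "r > 0" "\<And>t x. \<bar>t - t0\<bar> < r \<Longrightarrow> \<bar>x - x0\<bar> < r \<Longrightarrow> (t, x) \<in> {0<..} \<times> {..0} \<Longrightarrow> eL (t, x) \<in> W"
      using continuous_on_box[OF eL _ W, of t0 x0] mem(1) t0 by (auto simp: res)
    show ?thesis
    proof (rule that[of "min r (min t0 (- x0))"])
      fix t x assume *: "\<bar>t - t0\<bar> < min r (min t0 (- x0))" "\<bar>x - x0\<bar> < min r (min t0 (- x0))"
      then have "0 < t" "x < 0" by auto
      then show "residual H1 H2 F GL GR (t, x) \<in> W" using r(2)[of t x] * by (simp add: res)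
    qed (use 1 r t0 in auto)
  next
    case 2
    then obtain r where r: "r > 0" "\<And>t x. \<bar>t - t0\<bar> < r \<Longrightarrow> \<bar>x - x0\<bar> < r \<Longrightarrow> (t, x) \<in> {0<..} \<times> {0..} \<Longrightarrow> eR (t, x) \<in> W"
      using continuous_on_box[OF eR _ W, of t0 x0] mem(1) t0 by (auto simp: res)
    show ?thesis
    proof (rule that[of "min r (min t0 x0)"])
      fix t x assume *: "\<bar>t - t0\<bar> < min r (min t0 x0)" "\<bar>x - x0\<bar> < min r (min t0 x0)"
      then have "0 < t" "0 < x" by auto
      then show "residual H1 H2 F GL GR (t, x) \<in> W" using r(2)[of t x] * by (simp add: res)
    qed (use 2 r t0 in auto)
  next
    case 3
    obtain rL where rL: "rL > 0" "\<And>t x. \<bar>t - t0\<bar> < rL \<Longrightarrow> \<bar>x - x0\<bar> < rL \<Longrightarrow> (t, x) \<in> {0<..} \<times> {..0} \<Longrightarrow> eL (t, x) \<in> W"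
      using continuous_on_box[OF eL _ W, of t0 x0] mem(2) t0 3 by (auto simp: eL_def)
    obtain rR where rR: "rR > 0" "\<And>t x. \<bar>t - t0\<bar> < rR \<Longrightarrow> \<bar>x - x0\<bar> < rR \<Longrightarrow> (t, x) \<in> {0<..} \<times> {0..} \<Longrightarrow> eR (t, x) \<in> W"
      using continuous_on_box[OF eR _ W, of t0 x0] mem(3) t0 3 by (auto simp: eR_def)
    obtain rF where rF: "rF > 0" "\<And>t x. \<bar>t - t0\<bar> < rF \<Longrightarrow> \<bar>x - x0\<bar> < rF \<Longrightarrow> (t, x) \<in> {0<..} \<times> {0} \<Longrightarrow> eF (t, x) \<in> W"
      using continuous_on_box[OF eF _ W, of t0 x0] mem(1) t0 3 by (auto simp: res)
    show ?thesis
    proof (rule that[of "min (min rL rR) (min rF t0)"])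
      fix t x assume *: "\<bar>t - t0\<bar> < min (min rL rR) (min rF t0)" "\<bar>x - x0\<bar> < min (min rL rR) (min rF t0)"
      then have "0 < t" by auto
      then show "residual H1 H2 F GL GR (t, x) \<in> W"
        using rL(2)[of t x] rR(2)[of t x] rF(2)[of t x] * by (auto simp: res)
    qed (use rL rR rF t0 in auto)
  qed
qed

lemma DERIV_local_min_within:
  fixes d :: "real \<Rightarrow> real"
  assumes D: "(d has_real_derivative l) (at x within S)" and r: "r > 0"
    and min: "\<And>y. \<bar>y - x\<bar> < r \<Longrightarrow> y \<in> S \<Longrightarrow> d x \<le> d y"
  shows "{x..<x + r} \<subseteq> S \<Longrightarrow> 0 \<le> l" and "{x - r<..x} \<subseteq> S \<Longrightarrow> l \<le> 0"
proof -
  show "0 \<le> l" if S: "{x..<x + r} \<subseteq> S"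
  proof (rule ccontr)
    assume "\<not> 0 \<le> l"
    then obtain e where e: "e > 0" "\<And>h. 0 < h \<Longrightarrow> x + h \<in> S \<Longrightarrow> h < e \<Longrightarrow> d (x + h) < d x"
      using has_real_derivative_neg_dec_right[OF D] by auto
    define h where "h = min e r / 2"
    have "0 < h" "h < e" "h < r" using e r by (auto simp: h_def)
    moreover from this have "x + h \<in> S" using S by auto
    ultimately show False using e(2)[of h] min[of "x + h"] by simp
  qed
  show "l \<le> 0" if S: "{x - r<..x} \<subseteq> S"
  proof (rule ccontr)
    assume "\<not> l \<le> 0"
    then obtain e where e: "e > 0" "\<And>h. 0 < h \<Longrightarrow> x - h \<in> S \<Longrightarrow> h < e \<Longrightarrow> d (x - h) < d x"
      using has_real_derivative_pos_inc_left[OF D] by auto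
    define h where "h = min e r / 2"
    have "0 < h" "h < e" "h < r" using e r by (auto simp: h_def)
    moreover from this have "x - h \<in> S" using S by auto
    ultimately show False using e(2)[of h] min[of "x - h"] by simp
  qed
qed

context junction begin

text \<open>Where one test function touches another, the tangential derivatives agree and the slopes at the
  junction are ordered in the way in which the flux is monotone.\<close>
lemma residual_le_at_contact:
  assumes \<phi>: "junction_test \<phi> GL GR" and \<psi>: "junction_test \<psi> ML MR" and t: "0 < t"
    and touch: "touches_below \<psi> \<phi> (t, x)"
  shows "residual H1 H2 (F A) GL GR (t, x) \<le> residual H1 H2 (F A) ML MR (t, x)"
proof -
  obtain r where r: "r > 0" "\<And>s y. \<bar>s - t\<bar> < r \<Longrightarrow> \<bar>y - x\<bar> < r \<Longrightarrow> \<psi> (s, y) \<le> \<phi> (s, y)"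
    and eq: "\<psi> (t, x) = \<phi> (t, x)"
    using touch unfolding touches_below_def eventually_nhds_box by blast
  have time: "fst (G (t, x)) = fst (M (t, x))"
    if G: "C1_on ({0<..} \<times> X) \<phi> G" "C1_on ({0<..} \<times> X) \<psi> M" "x \<in> X" for X G M
  proof -
    have D: "((\<lambda>s. \<phi> (s, x) - \<psi> (s, x)) has_real_derivative fst (G (t, x)) - fst (M (t, x))) (at t within {0<..})"
      using t that by (intro DERIV_diff C1_on_partial_time) auto
    have min: "\<phi> (t, x) - \<psi> (t, x) \<le> \<phi> (s, x) - \<psi> (s, x)" if "\<bar>s - t\<bar> < min r t" for s
      using r(2)[of s x] that eq r(1) by simp
    have m: "0 < min r t" using r t by simp
    from DERIV_local_min_within[OF D m] min show ?thesis by fastforce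
  qed
  have space: "({x..<x + r'} \<subseteq> X \<longrightarrow> snd (M (t, x)) \<le> snd (G (t, x))) \<and> ({x - r'<..x} \<subseteq> X \<longrightarrow> snd (G (t, x)) \<le> snd (M (t, x)))"
    if G: "C1_on ({0<..} \<times> X) \<phi> G" "C1_on ({0<..} \<times> X) \<psi> M" "x \<in> X" "0 < r'" "r' \<le> r" for X G M r'
  proof -
    have D: "((\<lambda>y. \<phi> (t, y) - \<psi> (t, y)) has_real_derivative snd (G (t, x)) - snd (M (t, x))) (at x within X)"
      using t that by (intro DERIV_diff C1_on_partial_space) auto
    have min: "\<phi> (t, x) - \<psi> (t, x) \<le> \<phi> (t, y) - \<psi> (t, y)" if "\<bar>y - x\<bar> < r'" for y
      using r(2)[of t y] that eq r(1) \<open>r' \<le> r\<close> by simp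
    from DERIV_local_min_within[OF D \<open>0 < r'\<close>] min show ?thesis by fastforce
  qed
  have C1: "C1_on ({0<..} \<times> {..0}) \<phi> GL" "C1_on ({0<..} \<times> {..0}) \<psi> ML"
    "C1_on ({0<..} \<times> {0..}) \<phi> GR" "C1_on ({0<..} \<times> {0..}) \<psi> MR"
    using \<phi> \<psi> by (auto simp: junction_test_def)
  show ?thesis
  proof (cases x "0::real" rule: linorder_cases)
    case less
    define r' where "r' = min r (- x)"
    have r': "0 < r'" "r' \<le> r" "{x..<x + r'} \<subseteq> {..0}" "{x - r'<..x} \<subseteq> {..0}" using less r by (auto simp: r'_def)
    have "GL (t, x) = ML (t, x)"
      using time[OF C1(1,2)] space[OF C1(1,2) _ r'(1,2)] r'(3,4) less by (auto intro: prod_eqI)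
    then show ?thesis using less by (simp add: residual_def)
  next
    case greater
    define r' where "r' = min r x"
    have r': "0 < r'" "r' \<le> r" "{x..<x + r'} \<subseteq> {0..}" "{x - r'<..x} \<subseteq> {0..}" using greater r by (auto simp: r'_def)
    have "GR (t, x) = MR (t, x)"
      using time[OF C1(3,4)] space[OF C1(3,4) _ r'(1,2)] r'(3,4) greater by (auto intro: prod_eqI)
    then show ?thesis using greater by (simp add: residual_def)
  next
    case equal
    have sub: "{x - r<..x} \<subseteq> {..0}" "{x..<x + r} \<subseteq> {0..}" using equal by auto
    have "fst (GL (t, x)) = fst (ML (t, x))" using time[OF C1(1,2)] equal by auto
    moreover have "snd (GL (t, x)) \<le> snd (ML (t, x))" using space[OF C1(1,2) _ r(1) order_refl] sub equal by auto
    moreover have "snd (MR (t, x)) \<le> snd (GR (t, x))" using space[OF C1(3,4) _ r(1) order_refl] sub equal by auto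
    ultimately show ?thesis using flux_mono equal by (simp add: residual_def)
  qed
qed

text \<open>A test function that violates the sub-solution condition at a point can be replaced by one that
  touches strictly and violates it in a neighbourhood. At the junction this requires a violation of the
  equations on both sides as well: a slope on which the violation of the flux condition does not depend
  may be moved away until the Hamiltonian is large.\<close>
lemma strict_test_above:
  assumes \<phi>: "junction_test \<phi> GL GR" and t0: "0 < t0" and touch: "touches_above \<phi> U (t0, x0)"
    and viol: "0 < residual H1 H2 (F A) GL GR (t0, x0)"
  obtains \<psi> KL KR r where "junction_test \<psi> KL KR" "\<psi> (t0, x0) = U (t0, x0)" "0 < r" "r \<le> t0"
    "\<And>t x. \<bar>t - t0\<bar> < r \<Longrightarrow> \<bar>x - x0\<bar> < r \<Longrightarrow> U (t, x) + (t - t0)\<^sup>2 + (x - x0)\<^sup>2 \<le> \<psi> (t, x)"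
    "\<And>t x. \<bar>t - t0\<bar> < r \<Longrightarrow> \<bar>x - x0\<bar> < r \<Longrightarrow> 0 < residual H1 H2 (F A) KL KR (t, x)"
proof -
  define b where "b = fst (GL (t0, x0))"
  obtain l m where lm: "l \<le> 0" "0 \<le> m" "x0 \<noteq> 0 \<Longrightarrow> l = 0 \<and> m = 0"
    "x0 = 0 \<Longrightarrow> 0 < b + H1 (snd (GL (t0, x0)) + l) \<and> 0 < b + H2 (snd (GR (t0, x0)) + m)
      \<and> 0 < b + F A (snd (GL (t0, x0)) + l) (snd (GR (t0, x0)) + m)"
  proof (cases "x0 = 0")
    case True
    define q1 q2 where "q1 = snd (GL (t0, x0))" and "q2 = snd (GR (t0, x0))"
    have "- b < F A q1 q2" using viol True by (simp add: residual_def b_def q1_def q2_def)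
    then consider "- b < A" | "- b < H_plus H1 p1 q1" | "- b < H_minus H2 p2 q2"
      using flux_le_iff[of A q1 q2 "- b"] by linarith
    then have "\<exists>l m. l \<le> 0 \<and> 0 \<le> m \<and> - b < H1 (q1 + l) \<and> - b < H2 (q2 + m) \<and> - b < F A (q1 + l) (q2 + m)"
    proof cases
      case 1
      obtain R1 where R1: "R1 > 0" "\<And>q. R1 \<le> \<bar>q\<bar> \<Longrightarrow> - b < H1 q" using H1.large_outside[of "- b"] by metis
      obtain R2 where R2: "R2 > 0" "\<And>q. R2 \<le> \<bar>q\<bar> \<Longrightarrow> - b < H2 q" using H2.large_outside[of "- b"] by metis
      show ?thesis
      proof (intro exI conjI)
        show "- b < H1 (q1 + (- (R1 + \<bar>q1\<bar>)))" by (rule R1(2)) auto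
        show "- b < H2 (q2 + (R2 + \<bar>q2\<bar>))" by (rule R2(2)) auto
        show "- b < F A (q1 + (- (R1 + \<bar>q1\<bar>))) (q2 + (R2 + \<bar>q2\<bar>))" using 1 flux_ge(1) less_le_trans by blast
      qed (use R1 R2 in auto)
    next
      case 2
      obtain R2 where R2: "R2 > 0" "\<And>q. R2 \<le> \<bar>q\<bar> \<Longrightarrow> - b < H2 q" using H2.large_outside[of "- b"] by metis
      show ?thesis
      proof (intro exI conjI)
        show "- b < H1 (q1 + 0)" using 2 H1.H_plus_bounds(2)[of q1] by simp
        show "- b < H2 (q2 + (R2 + \<bar>q2\<bar>))" by (rule R2(2)) auto
        show "- b < F A (q1 + 0) (q2 + (R2 + \<bar>q2\<bar>))" using 2 flux_ge(4)[of q1 A "q2 + (R2 + \<bar>q2\<bar>)"] by simp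
      qed (use R2 in auto)
    next
      case 3
      obtain R1 where R1: "R1 > 0" "\<And>q. R1 \<le> \<bar>q\<bar> \<Longrightarrow> - b < H1 q" using H1.large_outside[of "- b"] by metis
      show ?thesis
      proof (intro exI conjI)
        show "- b < H1 (q1 + (- (R1 + \<bar>q1\<bar>)))" by (rule R1(2)) auto
        show "- b < H2 (q2 + 0)" using 3 H2.H_minus_bounds(2)[of q2] by simp
        show "- b < F A (q1 + (- (R1 + \<bar>q1\<bar>))) (q2 + 0)" using 3 flux_ge(5)[of q2 A "q1 + (- (R1 + \<bar>q1\<bar>))"] by simp
      qed (use R1 in auto)
    qed
    then obtain l m where "l \<le> 0" "0 \<le> m" "- b < H1 (q1 + l)" "- b < H2 (q2 + m)" "- b < F A (q1 + l) (q2 + m)" by blast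
    moreover from this have "0 < b + H1 (q1 + l)" "0 < b + H2 (q2 + m)" "0 < b + F A (q1 + l) (q2 + m)" by linarith+
    ultimately show ?thesis using that[of l m] True unfolding q1_def q2_def by blast
  next
    case False
    then show ?thesis using that[of 0 0] by auto
  qed
  define \<psi> where "\<psi> = (\<lambda>z. \<phi> z + (1 * (fst z - t0)\<^sup>2 + (kink l m (snd z) + 1 * (snd z - x0)\<^sup>2)))"
  define KL where "KL = (\<lambda>z. GL z + (2 * 1 * (fst z - t0), l + 2 * 1 * (snd z - x0)))"
  define KR where "KR = (\<lambda>z. GR z + (2 * 1 * (fst z - t0), m + 2 * 1 * (snd z - x0)))"
  have \<psi>: "junction_test \<psi> KL KR" unfolding \<psi>_def KL_def KR_def by (rule perturbed_test[OF \<phi>])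
  have K: "KL (t0, x0) = GL (t0, x0) + (0, l)" "KR (t0, x0) = GR (t0, x0) + (0, m)" by (simp_all add: KL_def KR_def)
  have time: "x0 = 0 \<Longrightarrow> fst (GR (t0, x0)) = b"
    using junction_test_time_derivatives[OF \<phi> t0] by (simp add: b_def)
  have R: "residual H1 H2 (F A) KL KR (t0, x0) \<in> {0<..}"
    using viol lm(3,4) unfolding residual_def K b_def by (cases "x0 = 0") auto
  have R': "fst (KL (t0, 0)) + H1 (snd (KL (t0, 0))) \<in> {0<..}" "fst (KR (t0, 0)) + H2 (snd (KR (t0, 0))) \<in> {0<..}" if "x0 = 0"
    using K lm(4) time that by (auto simp: b_def)
  obtain r1 where r1: "r1 > 0" "r1 \<le> t0"
    "\<And>t x. \<bar>t - t0\<bar> < r1 \<Longrightarrow> \<bar>x - x0\<bar> < r1 \<Longrightarrow> residual H1 H2 (F A) KL KR (t, x) \<in> {0<..}"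
    by (rule residual_nearby[where F = "F A", OF \<psi> t0 open_greaterThan H1.continuous H2.continuous _ R])
       (assumption | rule continuous_flux R' that)+
  obtain r2 where r2: "r2 > 0" "\<And>t x. \<bar>t - t0\<bar> < r2 \<Longrightarrow> \<bar>x - x0\<bar> < r2 \<Longrightarrow> U (t, x) \<le> \<phi> (t, x)"
    and eq: "\<phi> (t0, x0) = U (t0, x0)"
    using touch unfolding touches_above_def eventually_nhds_box by blast
  have k0: "0 \<le> kink l m x" for x using lm(1,2) by (auto simp: kink_def mult_nonpos_nonpos)
  have "kink l m x0 = 0" using lm(3) by (cases "x0 = 0") (auto simp: kink_def)
  then have "\<psi> (t0, x0) = U (t0, x0)" using eq by (simp add: \<psi>_def)
  moreover have "U (t, x) + (t - t0)\<^sup>2 + (x - x0)\<^sup>2 \<le> \<psi> (t, x)" if "\<bar>t - t0\<bar> < min r1 r2" "\<bar>x - x0\<bar> < min r1 r2" for t x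
    using r2(2)[of t x] k0[of x] that by (simp add: \<psi>_def)
  ultimately show ?thesis using that[OF \<psi>, of "min r1 r2"] r1 r2(1) by auto
qed

lemma strict_test_below:
  assumes \<phi>: "junction_test \<phi> GL GR" and t0: "0 < t0" and touch: "touches_below \<phi> V (t0, x0)"
    and viol: "residual H1 H2 (F A) GL GR (t0, x0) < 0"
  obtains \<psi> KL KR r where "junction_test \<psi> KL KR" "\<psi> (t0, x0) = V (t0, x0)" "0 < r" "r \<le> t0"
    "\<And>t x. \<bar>t - t0\<bar> < r \<Longrightarrow> \<bar>x - x0\<bar> < r \<Longrightarrow> \<psi> (t, x) \<le> V (t, x) - (t - t0)\<^sup>2 - (x - x0)\<^sup>2"
    "\<And>t x. \<bar>t - t0\<bar> < r \<Longrightarrow> \<bar>x - x0\<bar> < r \<Longrightarrow> residual H1 H2 (F A) KL KR (t, x) < 0"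
proof -
  define b q1 q2 where "b = fst (GL (t0, x0))" and "q1 = snd (GL (t0, x0))" and "q2 = snd (GR (t0, x0))"
  \<comment> \<open>At the junction the slopes are moved to the branches on which the flux sees the Hamiltonians.\<close>
  define l where "l = (if x0 = 0 then max q1 p1 - q1 else 0)"
  define m where "m = (if x0 = 0 then min q2 p2 - q2 else 0)"
  have lm: "0 \<le> l" "m \<le> 0" by (auto simp: l_def m_def)
  have at_0: "b + H1 (q1 + l) < 0 \<and> b + H2 (q2 + m) < 0 \<and> b + F A (q1 + l) (q2 + m) < 0" if "x0 = 0"
  proof -
    have "F A q1 q2 < - b" using viol that by (simp add: residual_def b_def q1_def q2_def)
    moreover have "q1 + l = max q1 p1" "q2 + m = min q2 p2" using that by (auto simp: l_def m_def)
    ultimately show ?thesis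
      unfolding flux_less_iff H1.H_plus_eq H2.H_minus_eq using flux_less_iff[of A "max q1 p1" "min q2 p2" "- b"]
      by (simp add: H1.H_plus_eq H2.H_minus_eq)
  qed
  define \<psi> where "\<psi> = (\<lambda>z. \<phi> z + ((-1) * (fst z - t0)\<^sup>2 + (kink l m (snd z) + (-1) * (snd z - x0)\<^sup>2)))"
  define KL where "KL = (\<lambda>z. GL z + (2 * (-1) * (fst z - t0), l + 2 * (-1) * (snd z - x0)))"
  define KR where "KR = (\<lambda>z. GR z + (2 * (-1) * (fst z - t0), m + 2 * (-1) * (snd z - x0)))"
  have \<psi>: "junction_test \<psi> KL KR" unfolding \<psi>_def KL_def KR_def by (rule perturbed_test[OF \<phi>])
  have K: "KL (t0, x0) = GL (t0, x0) + (0, l)" "KR (t0, x0) = GR (t0, x0) + (0, m)" by (simp_all add: KL_def KR_def)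
  have time: "x0 = 0 \<Longrightarrow> fst (GR (t0, x0)) = b"
    using junction_test_time_derivatives[OF \<phi> t0] by (simp add: b_def)
  have R: "residual H1 H2 (F A) KL KR (t0, x0) \<in> {..<0}"
    using viol at_0 unfolding residual_def K b_def q1_def q2_def by (cases "x0 = 0") (auto simp: l_def m_def)
  have R': "fst (KL (t0, 0)) + H1 (snd (KL (t0, 0))) \<in> {..<0}" "fst (KR (t0, 0)) + H2 (snd (KR (t0, 0))) \<in> {..<0}" if "x0 = 0"
    using K at_0 time that by (auto simp: b_def q1_def q2_def)
  obtain r1 where r1: "r1 > 0" "r1 \<le> t0"
    "\<And>t x. \<bar>t - t0\<bar> < r1 \<Longrightarrow> \<bar>x - x0\<bar> < r1 \<Longrightarrow> residual H1 H2 (F A) KL KR (t, x) \<in> {..<0}"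
    by (rule residual_nearby[where F = "F A", OF \<psi> t0 open_lessThan H1.continuous H2.continuous _ R])
       (assumption | rule continuous_flux R' that)+
  obtain r2 where r2: "r2 > 0" "\<And>t x. \<bar>t - t0\<bar> < r2 \<Longrightarrow> \<bar>x - x0\<bar> < r2 \<Longrightarrow> \<phi> (t, x) \<le> V (t, x)"
    and eq: "\<phi> (t0, x0) = V (t0, x0)"
    using touch unfolding touches_below_def eventually_nhds_box by blast
  have k0: "kink l m x \<le> 0" for x using lm by (auto simp: kink_def mult_nonneg_nonpos mult_nonpos_nonneg)
  have "kink l m x0 = 0" by (cases "x0 = 0") (auto simp: kink_def l_def m_def)
  then have "\<psi> (t0, x0) = V (t0, x0)" using eq by (simp add: \<psi>_def)
  moreover have "\<psi> (t, x) \<le> V (t, x) - (t - t0)\<^sup>2 - (x - x0)\<^sup>2" if "\<bar>t - t0\<bar> < min r1 r2" "\<bar>x - x0\<bar> < min r1 r2" for t x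
    using r2(2)[of t x] k0[of x] that by (simp add: \<psi>_def)
  ultimately show ?thesis using that[OF \<psi>, of "min r1 r2"] r1 r2(1) by auto
qed

end

lemma upper_env_mono:
  assumes u: "locally_bounded u" "locally_bounded v" and z: "z \<in> half_plane"
    and le: "\<And>w. w \<in> half_plane \<Longrightarrow> u w \<le> v w"
  shows "upper_env u z \<le> upper_env v z"
proof (rule dense_ge)
  fix c assume "upper_env v z < c"
  then obtain s where "s > 0" "\<And>w. w \<in> half_plane \<Longrightarrow> dist z w < s \<Longrightarrow> v w < c"
    using upper_env_lessD[OF u(2) z] by metis
  then show "upper_env u z \<le> c"
    by (intro upper_env_leI[OF u(1) z, of s]) (auto intro: less_imp_le order_trans[OF le])
qed

lemma upper_env_approached:
  assumes "locally_bounded u" "z \<in> half_plane" "c < upper_env u z" "r > 0"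
  obtains w where "w \<in> half_plane" "dist z w < r" "c < u w"
  using upper_env_leI[OF assms(1,2,4), of c] assms(3) by fastforce

lemma lower_env_approached:
  assumes "locally_bounded u" "z \<in> half_plane" "lower_env u z < c" "r > 0"
  obtains w where "w \<in> half_plane" "dist z w < r" "u w < c"
  using le_lower_envI[OF assms(1,2,4), of c] assms(3) by fastforce

lemma junction_test_continuous:
  "junction_test \<phi> GL GR \<Longrightarrow> continuous_on ({0<..} \<times> UNIV) \<phi>"
  by (simp add: junction_test_def)

lemma junction_test_nearby:
  assumes \<phi>: "junction_test \<phi> GL GR" and t0: "0 < t0" and e: "0 < e"
  obtains d where "0 < d" "\<And>w. dist (t0, x0) w < d \<Longrightarrow> 0 < fst w \<and> \<bar>\<phi> w - \<phi> (t0, x0)\<bar> < e"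
proof -
  have "open ({0<..} \<times> UNIV :: (real \<times> real) set)" by (intro open_Times) auto
  then have "isCont \<phi> (t0, x0)"
    using junction_test_continuous[OF \<phi>] t0 by (simp add: continuous_on_eq_continuous_at)
  then obtain d where d: "0 < d" "\<And>w. dist w (t0, x0) < d \<Longrightarrow> dist (\<phi> w) (\<phi> (t0, x0)) < e"
    using e unfolding continuous_at_eps_delta by blast
  show ?thesis
  proof (rule that[of "min d t0"])
    fix w assume w: "dist (t0, x0) w < min d t0"
    have "\<bar>t0 - fst w\<bar> \<le> dist (t0, x0) w" using dist_fst_le[of "(t0, x0)" w] by (simp add: dist_real_def)
    then show "0 < fst w \<and> \<bar>\<phi> w - \<phi> (t0, x0)\<bar> < e"
      using w d(2)[of w] by (auto simp: dist_commute dist_real_def)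
  qed (use d t0 in auto)
qed

context junction begin

text \<open>A strict test function is passed on to a member of the family that nearly attains the supremum.\<close>
lemma sup_of_subsolutions:
  assumes W: "\<And>w. w \<in> W \<Longrightarrow> locally_bounded w \<and> jsub H1 H2 (F A) (upper_env w)"
    and S: "locally_bounded S" and le: "\<And>w z. w \<in> W \<Longrightarrow> z \<in> half_plane \<Longrightarrow> w z \<le> S z"
    and sup: "\<And>z c. z \<in> half_plane \<Longrightarrow> c < S z \<Longrightarrow> \<exists>w\<in>W. c < w z"
  shows "jsub H1 H2 (F A) (upper_env S)"
  unfolding jsub_def
proof (intro allI impI, rule ccontr)
  fix \<phi> GL GR and z0 :: "real \<times> real"
  assume \<phi>: "junction_test \<phi> GL GR" "0 < fst z0" "touches_above \<phi> (upper_env S) z0"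
    "\<not> residual H1 H2 (F A) GL GR z0 \<le> 0"
  obtain t0 x0 where z0: "z0 = (t0, x0)" by (cases z0)
  have t0: "0 < t0" using \<phi>(2) z0 by simp
  obtain \<psi> KL KR r where \<psi>: "junction_test \<psi> KL KR" "\<psi> (t0, x0) = upper_env S (t0, x0)" "0 < r" "r \<le> t0"
    "\<And>t x. \<bar>t - t0\<bar> < r \<Longrightarrow> \<bar>x - x0\<bar> < r \<Longrightarrow> upper_env S (t, x) + (t - t0)\<^sup>2 + (x - x0)\<^sup>2 \<le> \<psi> (t, x)"
    "\<And>t x. \<bar>t - t0\<bar> < r \<Longrightarrow> \<bar>x - x0\<bar> < r \<Longrightarrow> 0 < residual H1 H2 (F A) KL KR (t, x)"
    using strict_test_above[OF \<phi>(1) t0 \<phi>(3)[unfolded z0]] \<phi>(4) z0 by (metis not_le)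
  define \<rho> where "\<rho> = r / 2"
  have \<rho>: "0 < \<rho>" "\<rho> < r" "\<rho> < t0" using \<psi>(3,4) by (auto simp: \<rho>_def)
  obtain d where d: "0 < d" "\<And>w. dist (t0, x0) w < d \<Longrightarrow> 0 < fst w \<and> \<bar>\<psi> w - \<psi> (t0, x0)\<bar> < \<rho>\<^sup>2 / 4"
    using junction_test_nearby[OF \<psi>(1) t0, of "\<rho>\<^sup>2 / 4" x0] \<rho> by auto
  have "\<psi> (t0, x0) - \<rho>\<^sup>2 / 4 < upper_env S (t0, x0)" "0 < min d \<rho>" using \<psi>(2) \<rho> d by auto
  then obtain z1 where z1: "z1 \<in> half_plane" "dist (t0, x0) z1 < min d \<rho>" "\<psi> (t0, x0) - \<rho>\<^sup>2 / 4 < S z1"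
    using upper_env_approached[OF S, of "(t0, x0)"] t0 by (metis half_plane_iff less_imp_le)
  have "\<bar>\<psi> z1 - \<psi> (t0, x0)\<bar> < \<rho>\<^sup>2 / 4" using d(2)[of z1] z1(2) by simp
  then have "\<psi> z1 - \<rho>\<^sup>2 / 2 < S z1" using z1(3) by linarith
  then obtain w where w: "w \<in> W" "\<psi> z1 - \<rho>\<^sup>2 / 2 < w z1" using sup[OF z1(1)] by blast
  have lb: "locally_bounded w" using W w(1) by blast
  let ?B = "{t0 - \<rho>..t0 + \<rho>} \<times> {x0 - \<rho>..x0 + \<rho>}"
  have B_hp: "?B \<subseteq> half_plane" "?B \<subseteq> {0<..} \<times> UNIV" using \<rho> by auto
  have "usc_on ?B (\<lambda>z. upper_env w z + - \<psi> z)"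
    by (intro usc_on_add usc_on_subset[OF usc_upper_env[OF lb] B_hp(1)] continuous_imp_usc_on continuous_intros
        continuous_on_subset[OF junction_test_continuous[OF \<psi>(1)] B_hp(2)])
  moreover have "compact ?B" by (intro compact_Times) auto
  moreover have z1_B: "z1 \<in> ?B"
  proof -
    have "\<bar>t0 - fst z1\<bar> \<le> dist (t0, x0) z1" "\<bar>x0 - snd z1\<bar> \<le> dist (t0, x0) z1"
      using dist_fst_le[of "(t0, x0)" z1] dist_snd_le[of "(t0, x0)" z1] by (simp_all add: dist_real_def)
    then show ?thesis using z1(2) by (auto simp: mem_Times_iff)
  qed
  ultimately obtain z2 where z2: "z2 \<in> ?B" "\<And>y. y \<in> ?B \<Longrightarrow> upper_env w y + - \<psi> y \<le> upper_env w z2 + - \<psi> z2"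
    using usc_on_attains_max[of ?B] by blast
  obtain t2 x2 where z2_eq: "z2 = (t2, x2)" by (cases z2)
  have near2: "\<bar>t2 - t0\<bar> \<le> \<rho>" "\<bar>x2 - x0\<bar> \<le> \<rho>" using z2(1) by (auto simp: z2_eq)
  have "- (\<rho>\<^sup>2 / 2) < upper_env w z2 - \<psi> z2"
    using z2(2)[OF z1_B] le_upper_env[OF lb z1(1)] w(2) by linarith
  moreover have "upper_env w z2 \<le> upper_env S z2"
    by (rule upper_env_mono[OF lb S]) (use z2(1) B_hp le[OF w(1)] in auto)
  moreover have "upper_env S z2 + (t2 - t0)\<^sup>2 + (x2 - x0)\<^sup>2 \<le> \<psi> z2"
    unfolding z2_eq using near2 \<rho>(2) by (intro \<psi>(5)) auto
  ultimately have dist2: "(t2 - t0)\<^sup>2 + (x2 - x0)\<^sup>2 < \<rho>\<^sup>2 / 2" by linarith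
  have int: "\<bar>t2 - t0\<bar> < \<rho>" "\<bar>x2 - x0\<bar> < \<rho>"
  proof -
    have "(t2 - t0)\<^sup>2 < \<rho>\<^sup>2" "(x2 - x0)\<^sup>2 < \<rho>\<^sup>2"
      using dist2 zero_le_power2[of "x2 - x0"] zero_le_power2[of "t2 - t0"] zero_le_power2[of \<rho>] by linarith+
    then show "\<bar>t2 - t0\<bar> < \<rho>" "\<bar>x2 - x0\<bar> < \<rho>"
      using \<rho>(1) abs_le_square_iff[of \<rho> "t2 - t0"] abs_le_square_iff[of \<rho> "x2 - x0"] by auto
  qed
  define c where "c = upper_env w z2 - \<psi> z2"
  have "touches_above (\<lambda>z. \<psi> z + c) (upper_env w) z2"
    unfolding touches_above_def z2_eq eventually_nhds_box
  proof (intro conjI exI[of _ "min (\<rho> - \<bar>t2 - t0\<bar>) (\<rho> - \<bar>x2 - x0\<bar>)"] allI impI)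
    fix s y assume "\<bar>s - t2\<bar> < min (\<rho> - \<bar>t2 - t0\<bar>) (\<rho> - \<bar>x2 - x0\<bar>)" "\<bar>y - x2\<bar> < min (\<rho> - \<bar>t2 - t0\<bar>) (\<rho> - \<bar>x2 - x0\<bar>)"
    then have "(s, y) \<in> ?B" by auto
    from z2(2)[OF this] show "upper_env w (s, y) \<le> \<psi> (s, y) + c" by (simp add: c_def)
  qed (use int in \<open>auto simp: c_def z2_eq\<close>)
  moreover have "0 < fst z2" using near2 \<rho> by (auto simp: z2_eq)
  ultimately have "residual H1 H2 (F A) KL KR z2 \<le> 0"
    using W[OF w(1)] junction_test_shift[OF \<psi>(1), of c] unfolding jsub_def by blast
  then show False using \<psi>(6)[of t2 x2] int \<rho>(2) by (auto simp: z2_eq)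
qed

lemma smooth_subsolution:
  assumes G: "C1_real UNIV G G'" "\<And>x. \<bar>G' x\<bar> \<le> L"
  obtains c where "0 \<le> c" "junction_subsol H1 H2 (F A) (\<lambda>z. G (snd z) - c * fst z)"
    "\<And>z. z \<in> half_plane \<Longrightarrow> upper_env (\<lambda>z. G (snd z) - c * fst z) z = G (snd z) - c * fst z"
proof -
  obtain c1 where c1: "\<And>q. \<bar>q\<bar> \<le> L \<Longrightarrow> H1 q \<le> c1" using H1.bounded_slopes_bound by blast
  obtain c2 where c2: "\<And>q. \<bar>q\<bar> \<le> L \<Longrightarrow> H2 q \<le> c2" using H2.bounded_slopes_bound by blast
  define c where "c = \<bar>c1\<bar> + \<bar>c2\<bar> + \<bar>A\<bar>"
  let ?w = "\<lambda>z. G (snd z) - c * fst z"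
  have vals: "H1 (G' x) \<le> c" "H2 (G' x) \<le> c" "F A (G' x) (G' x) \<le> c" for x
    using c1[OF G(2)[of x]] c2[OF G(2)[of x]] H1.H_plus_bounds(2)[of "G' x"] H2.H_minus_bounds(2)[of "G' x"]
    unfolding c_def flux_le_iff by linarith+
  have cont: "continuous_on half_plane ?w"
    by (intro continuous_intros continuous_on_compose2[OF C1_real_continuous[OF G(1)], of _ snd]) auto
  have lb: "locally_bounded ?w" by (rule locally_boundedI[OF cont cont]) auto
  have env: "upper_env ?w z = ?w z" if "z \<in> half_plane" for z
    by (rule upper_env_of_usc[OF lb that continuous_imp_usc_on[OF cont]])
  have w: "junction_test (\<lambda>z. - c * fst z + G (snd z)) (\<lambda>z. (- c, G' (snd z))) (\<lambda>z. (- c, G' (snd z)))"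
    by (rule junction_test_sum[OF C1_real_linear C1_real_subset[OF G(1)] C1_real_subset[OF G(1)]]) auto
  have "jsub H1 H2 (F A) ?w"
    unfolding jsub_def
  proof (intro allI impI)
    fix \<phi> GL GR and z :: "real \<times> real"
    assume \<phi>: "junction_test \<phi> GL GR" "0 < fst z" "touches_above \<phi> ?w z"
    have "touches_below (\<lambda>z. - c * fst z + G (snd z)) \<phi> (fst z, snd z)"
      using \<phi>(3) unfolding touches_above_def touches_below_def by simp
    from residual_le_at_contact[OF \<phi>(1) w \<phi>(2) this, of A]
    have "residual H1 H2 (F A) GL GR z \<le> residual H1 H2 (F A) (\<lambda>z. (- c, G' (snd z))) (\<lambda>z. (- c, G' (snd z))) z" by simp
    also have "\<dots> \<le> 0" using vals[of "snd z"] vals(3)[of 0] by (simp add: residual_def)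
    finally show "residual H1 H2 (F A) GL GR z \<le> 0" .
  qed
  then have "junction_subsol H1 H2 (F A) ?w"
    using lb env unfolding junction_subsol_iff by (auto intro: jsub_cong[rotated])
  then show ?thesis using that[of c] env by (simp add: c_def)
qed

lemma growth_aboveI:
  assumes G: "C1_real UNIV G G'" "\<And>x. \<bar>G' x\<bar> \<le> L" and c: "0 \<le> c"
    and le: "\<And>t x. 0 \<le> t \<Longrightarrow> u (t, x) \<le> \<bar>G x\<bar> + B + c * t"
  shows "growth_above u"
  unfolding growth_above_def
proof (intro allI impI)
  fix T :: real assume "0 < T"
  let ?C = "(\<bar>G 0\<bar> + L) + \<bar>B\<bar> + c * T"
  have "u (t, x) \<le> ?C * (1 + \<bar>x\<bar>)" if "0 \<le> t \<and> t < T" for t x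
  proof -
    have "c * t \<le> c * T" using that c by (intro mult_left_mono) auto
    moreover have "\<bar>G x\<bar> \<le> (\<bar>G 0\<bar> + L) * (1 + \<bar>x\<bar>)" by (rule linear_bound_of_lipschitz[OF G])
    moreover have "\<bar>B\<bar> + c * T \<le> (\<bar>B\<bar> + c * T) * (1 + \<bar>x\<bar>)"
      using mult_left_mono[of 1 "1 + \<bar>x\<bar>" "\<bar>B\<bar> + c * T"] c \<open>0 < T\<close> by simp
    ultimately show ?thesis using le[of t x] that unfolding distrib_right by linarith
  qed
  then show "\<exists>C. \<forall>t x. 0 \<le> t \<and> t < T \<longrightarrow> u (t, x) \<le> C * (1 + \<bar>x\<bar>)" by blast
qed

lemma linear_growth_iff: "linear_growth u \<longleftrightarrow> growth_above u \<and> growth_above (\<lambda>z. - u z)"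
proof
  assume u: "linear_growth u"
  have "\<exists>C. \<forall>t x. 0 \<le> t \<and> t < T \<longrightarrow> u (t, x) \<le> C * (1 + \<bar>x\<bar>) \<and> - u (t, x) \<le> C * (1 + \<bar>x\<bar>)" if "0 < T" for T
    using u that unfolding linear_growth_def abs_le_iff by blast
  then show "growth_above u \<and> growth_above (\<lambda>z. - u z)" unfolding growth_above_def by meson
next
  assume u: "growth_above u \<and> growth_above (\<lambda>z. - u z)"
  show "linear_growth u" unfolding linear_growth_def
  proof (intro allI impI)
    fix T :: real assume T: "0 < T"
    obtain C1 C2 where C: "\<forall>t x. 0 \<le> t \<and> t < T \<longrightarrow> u (t, x) \<le> C1 * (1 + \<bar>x\<bar>)"
      "\<forall>t x. 0 \<le> t \<and> t < T \<longrightarrow> - u (t, x) \<le> C2 * (1 + \<bar>x\<bar>)"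
      using u T unfolding growth_above_def by meson
    have "\<bar>u (t, x)\<bar> \<le> max C1 C2 * (1 + \<bar>x\<bar>)" if "0 \<le> t \<and> t < T" for t x
    proof -
      have "C1 * (1 + \<bar>x\<bar>) \<le> max C1 C2 * (1 + \<bar>x\<bar>)" "C2 * (1 + \<bar>x\<bar>) \<le> max C1 C2 * (1 + \<bar>x\<bar>)"
        by (intro mult_right_mono; simp)+
      then show ?thesis using C that by (smt (verit))
    qed
    then show "\<exists>C. \<forall>t x. 0 \<le> t \<and> t < T \<longrightarrow> \<bar>u (t, x)\<bar> \<le> C * (1 + \<bar>x\<bar>)" by blast
  qed
qed

lemma growth_above_upper_env:
  assumes u: "locally_bounded u" and growth: "growth_above u"
  shows "growth_above (upper_env u)"
  unfolding growth_above_def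
proof (intro allI impI)
  fix T :: real assume "0 < T"
  then obtain C where C: "\<And>t x. 0 \<le> t \<Longrightarrow> t < T \<Longrightarrow> u (t, x) \<le> C * (1 + \<bar>x\<bar>)"
    using growth unfolding growth_above_def by blast
  have "upper_env u (t, x) \<le> C * (1 + \<bar>x\<bar>)" if t: "0 \<le> t \<and> t < T" for t x
  proof -
    have "upper_env u (t, x) \<le> (\<lambda>z. C * (1 + \<bar>snd z\<bar>)) (t, x)"
    proof (rule upper_env_le_continuous[OF u, of _ _ "T - t"])
      fix w :: "real \<times> real" assume w: "w \<in> half_plane" "dist (t, x) w < T - t"
      have "\<bar>t - fst w\<bar> \<le> dist (t, x) w" using dist_fst_le[of "(t, x)" w] by (simp add: dist_real_def)
      then show "u w \<le> C * (1 + \<bar>snd w\<bar>)" using C[of "fst w" "snd w"] w by (cases w) auto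
    qed (use t in \<open>auto intro!: continuous_intros\<close>)
    then show ?thesis by simp
  qed
  then show "\<exists>C. \<forall>t x. 0 \<le> t \<and> t < T \<longrightarrow> upper_env u (t, x) \<le> C * (1 + \<bar>x\<bar>)" by blast
qed

text \<open>Perron's method: the supremum of all sub-solutions with the given initial datum is a solution,
  since a violation of the super-solution condition would allow to increase it locally. The barriers
  keep the supremum finite and give the initial datum.\<close>
theorem perron:
  assumes g: "uniformly_continuous_on UNIV g"
  shows "\<exists>u. junction_cauchy H1 H2 (F A) g u"
proof -
  define c0 where "c0 = \<bar>H1 p1\<bar> + \<bar>H2 p2\<bar> + \<bar>A\<bar> + 1"
  have c0: "0 \<le> c0" "0 < c0 + H1 p1" "0 < c0 + H2 p2" "0 < c0 + A" unfolding c0_def by linarith+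
  have g_cont: "continuous_on half_plane (\<lambda>z. g (snd z))"
    by (rule continuous_on_compose2[OF uniformly_continuous_imp_continuous[OF g], of _ snd]) (auto intro!: continuous_intros)
  then have upper_cont: "continuous_on half_plane (\<lambda>z. g (snd z) + c0 * fst z)" by (intro continuous_intros)
  define W where "W = {w. locally_bounded w \<and> jsub H1 H2 (F A) (upper_env w) \<and>
    (\<forall>x. upper_env w (0, x) \<le> g x) \<and> growth_above (upper_env w)}"
  have W_upper: "upper_env w z \<le> g (snd z) + c0 * fst z" if "w \<in> W" "z \<in> half_plane" for w z
    using upper_barrier[OF usc_upper_env _ _ g _ c0(2-4), of w "fst z" "snd z"] that
    by (auto simp: W_def half_plane_def)
  have W_le: "w z \<le> g (snd z) + c0 * fst z" if "w \<in> W" "z \<in> half_plane" for w z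
    using W_upper[OF that] le_upper_env[of w z] that by (auto simp: W_def)
  have W_lower: "\<exists>c\<ge>0. \<exists>w\<in>W. \<forall>z\<in>half_plane. g (snd z) - e - c * fst z \<le> w z" if e: "0 < e" for e
  proof -
    obtain G G' L where G: "C1_real UNIV G G'" "\<And>x. \<bar>G' x\<bar> \<le> L" "\<And>x. \<bar>G x - g x\<bar> \<le> e / 2"
      using uniformly_continuous_approx[OF g, of "e/2"] e by auto
    have Ge: "C1_real UNIV (\<lambda>x. G x + - (e / 2)) G'" by (rule C1_real_shift[OF G(1)])
    obtain c where c: "0 \<le> c" "junction_subsol H1 H2 (F A) (\<lambda>z. G (snd z) + - (e / 2) - c * fst z)"
      "\<And>z. z \<in> half_plane \<Longrightarrow> upper_env (\<lambda>z. G (snd z) + - (e / 2) - c * fst z) z = G (snd z) + - (e / 2) - c * fst z"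
      using smooth_subsolution[OF Ge G(2)] by blast
    let ?w = "\<lambda>z. G (snd z) + - (e / 2) - c * fst z"
    have "growth_above (upper_env ?w)"
    proof (rule growth_aboveI[OF Ge G(2) order_refl, of _ 0])
      fix t x :: real assume t: "0 \<le> t"
      have "0 \<le> c * t" using t c by simp
      then show "upper_env ?w (t, x) \<le> \<bar>G x + - (e / 2)\<bar> + 0 + 0 * t" using c(3)[of "(t, x)"] t by simp
    qed
    moreover have "upper_env ?w (0, x) \<le> g x" for x using c(3)[of "(0, x)"] abs_le_D1[OF G(3)[of x]] by simp
    ultimately have mem: "?w \<in> W" using c(2) by (simp add: W_def junction_subsol_iff)
    have "g (snd z) - e - c * fst z \<le> ?w z" for z using G(3)[of "snd z"] by linarith
    then show ?thesis by (intro exI[of _ c] conjI c(1) bexI[OF _ mem]) simp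
  qed
  define S where "S = (\<lambda>z. SUP w\<in>W. w z)"
  obtain c1 w1 where w1: "0 \<le> c1" "w1 \<in> W" "\<And>z. z \<in> half_plane \<Longrightarrow> g (snd z) - 1 - c1 * fst z \<le> w1 z"
    using W_lower[of 1] by auto
  have bdd: "bdd_above ((\<lambda>w. w z) ` W)" if "z \<in> half_plane" for z
    by (rule bdd_aboveI2[of _ _ "g (snd z) + c0 * fst z"]) (rule W_le[OF _ that])
  have S_ge: "w z \<le> S z" if "w \<in> W" "z \<in> half_plane" for w z
    unfolding S_def by (rule cSUP_upper[OF that(1) bdd[OF that(2)]])
  have S_le: "S z \<le> g (snd z) + c0 * fst z" if "z \<in> half_plane" for z
    unfolding S_def by (rule cSUP_least) (use w1(2) W_le that in auto)
  have S_sup: "\<exists>w\<in>W. c < w z" if "z \<in> half_plane" "c < S z" for z c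
    using that less_cSUP_iff[OF _ bdd[OF that(1)]] w1(2) unfolding S_def by auto
  have lower_cont: "continuous_on half_plane (\<lambda>z. g (snd z) - 1 - c1 * fst z)" using g_cont by (intro continuous_intros)
  have S_lower: "g (snd z) - 1 - c1 * fst z \<le> S z" if "z \<in> half_plane" for z
    using w1(3)[OF that] S_ge[OF w1(2) that] by linarith
  have lb: "locally_bounded S" by (rule locally_boundedI[OF lower_cont upper_cont S_lower S_le])
  have env_le: "upper_env S z \<le> g (snd z) + c0 * fst z" if "z \<in> half_plane" for z
    using upper_env_le_continuous[OF lb upper_cont that zero_less_one] S_le by simp
  have env_sub: "jsub H1 H2 (F A) (upper_env S)"
  proof (rule sup_of_subsolutions[where W = W and S = S])
    show "locally_bounded w \<and> jsub H1 H2 (F A) (upper_env w)" if "w \<in> W" for w using that by (simp add: W_def)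
  qed (fact lb S_ge S_sup)+
  obtain G G' L where G: "C1_real UNIV G G'" "\<And>x. \<bar>G' x\<bar> \<le> L" "\<And>x. \<bar>G x - g x\<bar> \<le> 1"
    using uniformly_continuous_approx[OF g zero_less_one] by blast
  have growth: "growth_above u" if le: "\<And>z. z \<in> half_plane \<Longrightarrow> u z \<le> max (g (snd z) + c0 * fst z) B" for u B
  proof (rule growth_aboveI[OF G(1,2) c0(1), of _ "1 + \<bar>B\<bar>"])
    fix t x :: real assume t: "0 \<le> t"
    have "0 \<le> c0 * t" using t c0 by simp
    moreover have "g x \<le> \<bar>G x\<bar> + 1" using G(3)[of x] by linarith
    ultimately show "u (t, x) \<le> \<bar>G x\<bar> + (1 + \<bar>B\<bar>) + c0 * t" using le[of "(t, x)"] t by simp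
  qed
  have W_I: "w \<in> W" if cont: "continuous_on half_plane f" and le: "\<And>z. z \<in> half_plane \<Longrightarrow> S z \<le> w z" "\<And>z. z \<in> half_plane \<Longrightarrow> w z \<le> f z"
      and f: "\<And>z. z \<in> half_plane \<Longrightarrow> f z \<le> max (g (snd z) + c0 * fst z) B"
      and usc: "usc_on half_plane w" and sub: "jsub H1 H2 (F A) w" and init: "\<And>x. w (0, x) \<le> g x" for w f B
  proof -
    have lower: "g (snd z) - 1 - c1 * fst z \<le> w z" if "z \<in> half_plane" for z using S_lower[OF that] le(1)[OF that] by linarith
    have lbw: "locally_bounded w" by (rule locally_boundedI[OF lower_cont cont lower le(2)])
    have env: "upper_env w z = w z" if "z \<in> half_plane" for z by (rule upper_env_of_usc[OF lbw that usc])
    have "growth_above (upper_env w)"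
    proof (rule growth)
      fix z assume "z \<in> half_plane"
      then show "upper_env w z \<le> max (g (snd z) + c0 * fst z) B" using env[of z] le(2)[of z] f[of z] by linarith
    qed
    moreover have "jsub H1 H2 (F A) (upper_env w)" by (rule jsub_cong[OF _ sub]) (simp add: env)
    ultimately show ?thesis using lbw env init by (simp add: W_def)
  qed
  have S_eq: "upper_env S z = S z" if z: "z \<in> half_plane" for z
  proof -
    have "upper_env S \<in> W"
      by (rule W_I[OF upper_cont le_upper_env[OF lb] env_le _ usc_upper_env[OF lb] env_sub])
         (use env_le[of "(0, _)"] in auto)
    from S_ge[OF this z] le_upper_env[OF lb z] show ?thesis by simp
  qed
  have usc_S: "usc_on half_plane S"
    using usc_upper_env[OF lb] S_eq unfolding usc_on_def by (metis Int_iff)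
  have super: "jsuper H1 H2 (F A) (lower_env S)"
    unfolding jsuper_def
  proof (intro allI impI, rule ccontr)
    fix \<phi> GL GR and z0 :: "real \<times> real"
    assume \<phi>: "junction_test \<phi> GL GR" "0 < fst z0" "touches_below \<phi> (lower_env S) z0"
      "\<not> 0 \<le> residual H1 H2 (F A) GL GR z0"
    obtain t0 x0 where z0: "z0 = (t0, x0)" by (cases z0)
    have t0: "0 < t0" using \<phi>(2) z0 by simp
    obtain \<psi> KL KR r where \<psi>: "junction_test \<psi> KL KR" "\<psi> (t0, x0) = lower_env S (t0, x0)" "0 < r" "r \<le> t0"
      "\<And>t x. \<bar>t - t0\<bar> < r \<Longrightarrow> \<bar>x - x0\<bar> < r \<Longrightarrow> \<psi> (t, x) \<le> lower_env S (t, x) - (t - t0)\<^sup>2 - (x - x0)\<^sup>2"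
      "\<And>t x. \<bar>t - t0\<bar> < r \<Longrightarrow> \<bar>x - x0\<bar> < r \<Longrightarrow> residual H1 H2 (F A) KL KR (t, x) < 0"
      using strict_test_below[OF \<phi>(1) t0 \<phi>(3)[unfolded z0]] \<phi>(4) z0 by (metis not_le)
    define \<rho> where "\<rho> = r / 2"
    have \<rho>: "0 < \<rho>" "\<rho> < r" "\<rho> < t0" using \<psi>(3,4) by (auto simp: \<rho>_def)
    define N where "N \<sigma> = {z :: real \<times> real. \<bar>fst z - t0\<bar> < \<sigma> \<and> \<bar>snd z - x0\<bar> < \<sigma>}" for \<sigma>
    have N_open: "open (N \<sigma>)" for \<sigma>
      unfolding N_def by (intro open_Collect_conj open_Collect_less continuous_intros)
    have N_time: "0 < fst z" if "z \<in> N r" for z using that \<psi>(4) by (auto simp: N_def)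
    \<comment> \<open>The supremum is raised to a lifted test function near the point; further away the lift is
      compensated by the strictness of the contact.\<close>
    define w where "w = (\<lambda>z. if z \<in> N r then max (S z) (\<psi> z + \<rho>\<^sup>2) else S z)"
    have w_ge: "S z \<le> w z" for z by (simp add: w_def)
    have w_outside: "w z = S z" if "z \<in> half_plane" "z \<notin> N \<rho>" for z
    proof (cases "z \<in> N r")
      case True
      obtain t x where z: "z = (t, x)" by (cases z)
      have "\<rho>\<^sup>2 \<le> (t - t0)\<^sup>2 + (x - x0)\<^sup>2"
      proof -
        have "\<rho> \<le> \<bar>t - t0\<bar> \<or> \<rho> \<le> \<bar>x - x0\<bar>" using that(2) by (auto simp: N_def z)
        then have "\<rho>\<^sup>2 \<le> (t - t0)\<^sup>2 \<or> \<rho>\<^sup>2 \<le> (x - x0)\<^sup>2" using \<rho>(1) abs_le_square_iff[of \<rho>] by auto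
        then show ?thesis using zero_le_power2[of "t - t0"] zero_le_power2[of "x - x0"] by linarith
      qed
      moreover have "\<psi> z \<le> lower_env S z - (t - t0)\<^sup>2 - (x - x0)\<^sup>2"
        using \<psi>(5)[of t x] True by (simp add: N_def z)
      ultimately have "\<psi> z + \<rho>\<^sup>2 \<le> S z" using lower_env_le[OF lb that(1)] by linarith
      then show ?thesis by (simp add: w_def max_absorb1)
    qed (simp add: w_def)
    have \<psi>_cont: "continuous_on X \<psi>" if "\<And>z. z \<in> X \<Longrightarrow> 0 < fst z" for X
    proof (rule continuous_on_subset[OF junction_test_continuous[OF \<psi>(1)]], rule subsetI)
      show "z \<in> {0<..} \<times> UNIV" if "z \<in> X" for z
        using \<open>\<And>z. z \<in> X \<Longrightarrow> 0 < fst z\<close>[OF that] by (simp add: mem_Times_iff)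
    qed
    obtain B where B: "\<And>z. z \<in> N \<rho> \<Longrightarrow> \<psi> z + \<rho>\<^sup>2 \<le> B"
    proof -
      let ?K = "{t0 - \<rho>..t0 + \<rho>} \<times> {x0 - \<rho>..x0 + \<rho>}"
      have "compact (\<psi> ` ?K)"
        by (intro compact_continuous_image \<psi>_cont compact_Times) (use \<rho> in auto)
      then obtain C where C: "\<forall>y\<in>\<psi> ` ?K. \<bar>y\<bar> \<le> C" using compact_imp_bounded[of "\<psi> ` ?K"] by (auto simp: bounded_iff)
      have "\<psi> z + \<rho>\<^sup>2 \<le> C + \<rho>\<^sup>2" if "z \<in> N \<rho>" for z
      proof -
        have "z \<in> ?K" using that by (auto simp: N_def mem_Times_iff)
        then have "\<bar>\<psi> z\<bar> \<le> C" using C by blast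
        then show ?thesis by simp
      qed
      then show ?thesis by (rule that)
    qed
    have w_le: "w z \<le> max (g (snd z) + c0 * fst z) B" if "z \<in> half_plane" for z
    proof (cases "z \<in> N \<rho>")
      case True
      then have "w z \<le> max (S z) B" using B[OF True] by (auto simp: w_def)
      then show ?thesis using S_le[OF that] by (simp add: le_max_iff_disj max_def split: if_splits)
    next
      case False
      then show ?thesis using w_outside[OF that] S_le[OF that] by simp
    qed
    have w_usc: "usc_on half_plane w"
    proof (rule usc_onI)
      fix z c assume z: "z \<in> half_plane" "w z < c"
      show "\<exists>d>0. \<forall>y\<in>half_plane. dist z y < d \<longrightarrow> w y < c"
      proof (cases "z \<in> N r")
        case True
        have max_usc: "usc_on (N r) (\<lambda>z. max (S z) (\<psi> z + \<rho>\<^sup>2))"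
        proof (rule usc_on_max)
          have "N r \<subseteq> half_plane"
          proof
            show "z \<in> half_plane" if "z \<in> N r" for z using N_time[OF that] by (simp add: half_plane_def mem_Times_iff)
          qed
          then show "usc_on (N r) S" by (rule usc_on_subset[OF usc_S])
          show "usc_on (N r) (\<lambda>z. \<psi> z + \<rho>\<^sup>2)"
            by (rule continuous_imp_usc_on) (intro continuous_on_add \<psi>_cont N_time continuous_on_const)
        qed
        have max_less: "max (S z) (\<psi> z + \<rho>\<^sup>2) < c" using z(2) True by (simp add: w_def)
        obtain d where d: "d > 0" "\<And>y. y \<in> N r \<Longrightarrow> dist z y < d \<Longrightarrow> max (S y) (\<psi> y + \<rho>\<^sup>2) < c"
          by (rule usc_onD[OF max_usc True max_less], rule that)
        obtain d' where d': "d' > 0" "\<And>y. dist y z < d' \<Longrightarrow> y \<in> N r" using N_open[of r] True unfolding open_dist by blast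
        show ?thesis
        proof (intro exI[of _ "min d d'"] conjI ballI impI)
          fix y assume "dist z y < min d d'"
          then show "w y < c" using d(2)[of y] d'(2)[of y] by (simp add: w_def dist_commute)
        qed (use d d' in auto)
      next
        case False
        have S_less: "S z < c" using z(2) False by (simp add: w_def)
        obtain d where d: "d > 0" "\<And>y. y \<in> half_plane \<Longrightarrow> dist z y < d \<Longrightarrow> S y < c"
          by (rule usc_onD[OF usc_S z(1) S_less], rule that)
        show ?thesis
        proof (intro exI[of _ "min d (r - \<rho>)"] conjI ballI impI)
          fix y assume y: "y \<in> half_plane" "dist z y < min d (r - \<rho>)"
          have "\<bar>fst z - fst y\<bar> \<le> dist z y" "\<bar>snd z - snd y\<bar> \<le> dist z y"
            using dist_fst_le[of z y] dist_snd_le[of z y] by (simp_all add: dist_real_def)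
          then have "y \<notin> N \<rho>" using False y(2) by (auto simp: N_def)
          then show "w y < c" using w_outside[OF y(1)] d(2)[OF y(1)] y(2) by simp
        qed (use d \<rho> in auto)
      qed
    qed
    have w_sub: "jsub H1 H2 (F A) w"
      unfolding jsub_def
    proof (intro allI impI)
      fix \<phi>' GL' GR' and z :: "real \<times> real"
      assume \<phi>': "junction_test \<phi>' GL' GR'" "0 < fst z" "touches_above \<phi>' w z"
      have z: "z \<in> half_plane" using \<phi>'(2) by (simp add: half_plane_def mem_Times_iff)
      have ev: "\<phi>' z = w z" "eventually (\<lambda>y. w y \<le> \<phi>' y) (nhds z)" using \<phi>'(3) by (auto simp: touches_above_def)
      show "residual H1 H2 (F A) GL' GR' z \<le> 0"
      proof (cases "w z = S z")
        case True
        have "eventually (\<lambda>y. y \<in> half_plane \<and> 0 < fst y) (nhds z)"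
          using eventually_nhds_half_plane[of "fst z" "snd z"] \<phi>'(2) by simp
        with ev(2) have "eventually (\<lambda>y. upper_env S y \<le> \<phi>' y) (nhds z)"
          by eventually_elim (use w_ge S_eq order_trans in metis)
        then have "touches_above \<phi>' (upper_env S) z" using ev(1) True S_eq[OF z] by (simp add: touches_above_def)
        then show ?thesis using env_sub \<phi>'(1,2) unfolding jsub_def by blast
      next
        case False
        then have zN: "z \<in> N r" and wz: "w z = \<psi> z + \<rho>\<^sup>2" by (auto simp: w_def max_def split: if_splits)
        have "eventually (\<lambda>y. y \<in> N r) (nhds z)" using N_open zN by (rule eventually_nhds_in_open)
        with ev(2) have "eventually (\<lambda>y. \<psi> y + \<rho>\<^sup>2 \<le> \<phi>' y) (nhds z)"
          by eventually_elim (simp add: w_def)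
        then have "touches_below (\<lambda>y. \<psi> y + \<rho>\<^sup>2) \<phi>' (fst z, snd z)" using ev(1) wz by (simp add: touches_below_def)
        from residual_le_at_contact[OF \<phi>'(1) junction_test_shift[OF \<psi>(1)] \<phi>'(2) this, of A]
        show ?thesis using \<psi>(6)[of "fst z" "snd z"] zN by (simp add: N_def)
      qed
    qed
    have w_init: "w (0, x) \<le> g x" for x
    proof -
      have "(0, x) \<notin> N \<rho>" using \<rho>(3) by (auto simp: N_def)
      then show ?thesis using w_outside[of "(0, x)"] S_le[of "(0, x)"] by simp
    qed
    have "continuous_on half_plane (\<lambda>z. max (g (snd z) + c0 * fst z) B)" by (intro continuous_on_max upper_cont continuous_on_const)
    from W_I[OF this w_ge w_le order_refl w_usc w_sub w_init] have "w \<in> W" .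
    then have w_S: "w z \<le> S z" if "z \<in> half_plane" for z using S_ge that by blast
    obtain d where d: "0 < d" "\<And>w. dist (t0, x0) w < d \<Longrightarrow> 0 < fst w \<and> \<bar>\<psi> w - \<psi> (t0, x0)\<bar> < \<rho>\<^sup>2 / 2"
      using junction_test_nearby[OF \<psi>(1) t0, of "\<rho>\<^sup>2 / 2" x0] \<rho> by auto
    have "lower_env S (t0, x0) < \<psi> (t0, x0) + \<rho>\<^sup>2 / 2" "0 < min d \<rho>" using \<psi>(2) \<rho> d by auto
    then obtain z1 where z1: "z1 \<in> half_plane" "dist (t0, x0) z1 < min d \<rho>" "S z1 < \<psi> (t0, x0) + \<rho>\<^sup>2 / 2"
      using lower_env_approached[OF lb, of "(t0, x0)"] t0 by (metis half_plane_iff less_imp_le)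
    have "\<bar>t0 - fst z1\<bar> \<le> dist (t0, x0) z1" "\<bar>x0 - snd z1\<bar> \<le> dist (t0, x0) z1"
      using dist_fst_le[of "(t0, x0)" z1] dist_snd_le[of "(t0, x0)" z1] by (simp_all add: dist_real_def)
    then have "z1 \<in> N r" using z1(2) \<rho>(2) by (auto simp: N_def)
    then have "\<psi> z1 + \<rho>\<^sup>2 \<le> S z1" using w_S[OF z1(1)] by (simp add: w_def)
    moreover have "\<bar>\<psi> z1 - \<psi> (t0, x0)\<bar> < \<rho>\<^sup>2 / 2" using d(2)[of z1] z1(2) by simp
    ultimately show False using z1(3) by linarith
  qed
  have "junction_sol H1 H2 (F A) S"
    using lb env_sub super by (simp add: junction_sol_def junction_subsol_iff junction_supersol_iff)
  moreover have "has_initial_datum S g"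
    unfolding has_initial_datum_def
  proof (intro allI conjI)
    fix x
    show "upper_env S (0, x) \<le> g x" using env_le[of "(0, x)"] by simp
    show "g x \<le> lower_env S (0, x)"
    proof (rule field_le_epsilon)
      fix e :: real assume "0 < e"
      then obtain c w where c: "w \<in> W" "\<And>z. z \<in> half_plane \<Longrightarrow> g (snd z) - e - c * fst z \<le> w z" using W_lower by blast
      have "upper_env (\<lambda>z. - S z) (0, x) \<le> (\<lambda>z. - (g (snd z) - e - c * fst z)) (0, x)"
      proof (rule upper_env_le_continuous[OF _ _ _ zero_less_one])
        show "continuous_on half_plane (\<lambda>z. - (g (snd z) - e - c * fst z))" using g_cont by (intro continuous_intros)
        fix z assume "z \<in> half_plane"
        then show "- S z \<le> - (g (snd z) - e - c * fst z)" using c(2)[of z] S_ge[OF c(1), of z] by linarith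
      qed (use lb in auto)
      then show "g x \<le> lower_env S (0, x) + e" by (simp add: lower_env_uminus)
    qed
  qed
  moreover have "linear_growth S"
    unfolding linear_growth_iff
  proof
    show "growth_above S" by (rule growth[of _ 0], drule S_le) (rule max.coboundedI1)
    show "growth_above (\<lambda>z. - S z)"
    proof (rule growth_aboveI[OF G(1,2) w1(1), of _ 2])
      fix t x :: real assume "0 \<le> t"
      then show "- S (t, x) \<le> \<bar>G x\<bar> + 2 + c1 * t" using S_lower[of "(t, x)"] G(3)[of x] by simp
    qed
  qed
  ultimately show ?thesis unfolding junction_cauchy_def by blast
qed

section \<open>Extremal Ishii solutions\<close>

lemma junction_comparison:
  assumes A: "A0 \<le> A" and g: "uniformly_continuous_on UNIV g"
    and u: "junction_subsol H1 H2 (F A) u" "has_initial_datum u g" "linear_growth u"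
    and v: "junction_supersol H1 H2 (F A) v" "has_initial_datum v g" "linear_growth v"
    and z: "z \<in> half_plane"
  shows "upper_env u z \<le> lower_env v z"
proof -
  have lb: "locally_bounded u" "locally_bounded v"
    using u(1) v(1) by (auto simp: junction_subsol_iff junction_supersol_iff)
  have "upper_env u (fst z, snd z) \<le> lower_env v (fst z, snd z)"
  proof (rule comparison[OF A usc_upper_env[OF lb(1)] usc_uminus_lower_env[OF lb(2)] _ _ _ _ g])
    show "jsub H1 H2 (F A) (upper_env u)" "jsuper H1 H2 (F A) (lower_env v)"
      using u(1) v(1) by (auto simp: junction_subsol_iff junction_supersol_iff)
    show "growth_above (upper_env u)"
      by (rule growth_above_upper_env[OF lb(1)]) (use u(3) in \<open>simp add: linear_growth_iff\<close>)
    have "growth_above (upper_env (\<lambda>z. - v z))"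
      by (rule growth_above_upper_env) (use lb(2) v(3) in \<open>simp_all add: linear_growth_iff\<close>)
    then show "growth_above (\<lambda>z. - lower_env v z)" by (simp add: lower_env_uminus)
  qed (use u(2) v(2) z in \<open>auto simp: has_initial_datum_def half_plane_def\<close>)
  then show ?thesis by simp
qed

lemma junction_cauchy_unique:
  assumes A: "A0 \<le> A" and g: "uniformly_continuous_on UNIV g"
    and u: "junction_cauchy H1 H2 (F A) g u" and v: "junction_cauchy H1 H2 (F A) g v" and z: "z \<in> half_plane"
  shows "v z = u z"
proof -
  have le: "u' z \<le> v' z" if "junction_cauchy H1 H2 (F A) g u'" "junction_cauchy H1 H2 (F A) g v'" for u' v'
  proof -
    have *: "junction_subsol H1 H2 (F A) u'" "has_initial_datum u' g" "linear_growth u'"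
      "junction_supersol H1 H2 (F A) v'" "has_initial_datum v' g" "linear_growth v'"
      using that by (auto simp: junction_cauchy_def junction_sol_def)
    have "u' z \<le> upper_env u' z" using * z by (intro le_upper_env) (auto simp: junction_subsol_iff)
    also have "\<dots> \<le> lower_env v' z" by (rule junction_comparison[OF A g * z])
    also have "\<dots> \<le> v' z" using * z by (intro lower_env_le) (auto simp: junction_supersol_iff)
    finally show ?thesis .
  qed
  show ?thesis using le[OF u v] le[OF v u] by simp
qed

lemma junction_cauchy_imp_ishii_cauchy:
  "Aminus \<le> A \<Longrightarrow> A \<le> Aplus \<Longrightarrow> junction_cauchy H1 H2 (F A) g u \<Longrightarrow> ishii_cauchy H1 H2 g u"
  using junction_sol_imp_ishii_sol by (auto simp: junction_cauchy_def ishii_cauchy_def)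

lemma ishii_le_Aminus:
  assumes g: "uniformly_continuous_on UNIV g" and v: "ishii_cauchy H1 H2 g v"
    and u: "junction_cauchy H1 H2 (F Aminus) g u" and z: "z \<in> half_plane"
  shows "v z \<le> u z"
proof -
  have *: "junction_subsol H1 H2 (F Aminus) v" "has_initial_datum v g" "linear_growth v"
    "junction_supersol H1 H2 (F Aminus) u" "has_initial_datum u g" "linear_growth u"
    using u v ishii_subsol_imp_junction_subsol by (auto simp: junction_cauchy_def junction_sol_def ishii_cauchy_def ishii_sol_def)
  have "v z \<le> upper_env v z" using * z by (intro le_upper_env) (auto simp: junction_subsol_iff)
  also have "\<dots> \<le> lower_env u z" by (rule junction_comparison[OF A0_le_Aminus g * z])
  also have "\<dots> \<le> u z" using * z by (intro lower_env_le) (auto simp: junction_supersol_iff)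
  finally show ?thesis .
qed

lemma Aplus_le_ishii:
  assumes g: "uniformly_continuous_on UNIV g" and v: "ishii_cauchy H1 H2 g v"
    and u: "junction_cauchy H1 H2 (F Aplus) g u" and z: "z \<in> half_plane"
  shows "u z \<le> v z"
proof -
  have *: "junction_subsol H1 H2 (F Aplus) u" "has_initial_datum u g" "linear_growth u"
    "junction_supersol H1 H2 (F Aplus) v" "has_initial_datum v g" "linear_growth v"
    using u v ishii_supersol_imp_junction_supersol by (auto simp: junction_cauchy_def junction_sol_def ishii_cauchy_def ishii_sol_def)
  have "u z \<le> upper_env u z" using * z by (intro le_upper_env) (auto simp: junction_subsol_iff)
  also have "\<dots> \<le> lower_env v z"
    by (rule junction_comparison[OF order_trans[OF A0_le_Aminus Aminus_le_Aplus] g * z])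
  also have "\<dots> \<le> v z" using * z by (intro lower_env_le) (auto simp: junction_supersol_iff)
  finally show ?thesis .
qed

text \<open>If the two flux limiters differ, take a wedge that decreases in time at the rate \<open>Aplus\<close>, with
  slopes on the outer branches, which the flux does not see. Then the flux at these slopes is the
  limiter: the wedge solves the junction problem for \<open>Aplus\<close>, and tested with itself it violates the
  super-solution condition for \<open>Aminus\<close>.\<close>
lemma wedge_solution:
  assumes ne: "Aplus \<noteq> Aminus"
  obtains g u where "uniformly_continuous_on UNIV g" "junction_cauchy H1 H2 (F Aplus) g u"
    "\<And>v. junction_cauchy H1 H2 (F Aminus) g v \<Longrightarrow> \<exists>z\<in>half_plane. v z \<noteq> u z"
proof -
  have less: "Aminus < Aplus" using Aminus_le_Aplus ne by simp
  have "H1 p1 \<le> Aplus" "H2 p2 \<le> Aplus" using A0_le A0_le_Aminus Aminus_le_Aplus by linarith+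
  then obtain l1 l2 where l1: "l1 \<le> p1" "H1 l1 = Aplus" and l2: "p2 \<le> l2" "H2 l2 = Aplus"
    using H1.level_left H2.level_right by metis
  have FA: "F A l1 l2 = A" if "A0 \<le> A" for A
    using l1 l2 A0_le that unfolding flux_def H1.H_plus_eq H2.H_minus_eq by (simp add: max_absorb2 min_absorb2)
  have FA': "F Aplus l1 l2 = Aplus" "F Aminus l1 l2 = Aminus"
    using FA A0_le_Aminus Aminus_le_Aplus by (meson order_trans)+
  define g where "g = kink l1 l2"
  define u where "u = (\<lambda>z::real \<times> real. - Aplus * fst z + g (snd z))"
  have test: "junction_test u (\<lambda>z. (- Aplus, l1)) (\<lambda>z. (- Aplus, l2))"
    unfolding u_def g_def by (rule junction_test_sum[OF C1_real_linear C1_real_kink])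
  have cont: "continuous_on half_plane u"
    unfolding u_def g_def by (intro continuous_intros continuous_on_compose2[OF continuous_kink[of UNIV]]) auto
  have lb: "locally_bounded u" by (rule locally_boundedI[OF cont cont]) auto
  have env: "upper_env u z = u z" if "z \<in> half_plane" for z
    by (rule upper_env_of_usc[OF lb that continuous_imp_usc_on[OF cont]])
  have env': "lower_env u z = u z" if "z \<in> half_plane" for z
  proof -
    have "upper_env (\<lambda>z. - u z) z = - u z"
      by (rule upper_env_of_usc[OF _ that continuous_imp_usc_on]) (use lb cont in \<open>auto intro: continuous_intros\<close>)
    then show ?thesis by (simp add: lower_env_uminus)
  qed
  have eventually_env: "eventually (\<lambda>w. upper_env u w = u w \<and> lower_env u w = u w) (nhds z)" if "0 < fst z" for z
    using eventually_nhds_half_plane[of "fst z" "snd z"] that env env' by (auto elim: eventually_mono)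
  have at_z: "upper_env u z = u z" "lower_env u z = u z" if "0 < fst z" for z
    using env env' that by (auto simp: half_plane_def mem_Times_iff)
  have res: "residual H1 H2 (F Aplus) (\<lambda>z. (- Aplus, l1)) (\<lambda>z. (- Aplus, l2)) z = 0" for z
    using l1 l2 FA'(1) by (simp add: residual_def)
  have sub: "jsub H1 H2 (F Aplus) (upper_env u)"
    unfolding jsub_def
  proof (intro allI impI)
    fix \<phi> GL GR and z :: "real \<times> real"
    assume \<phi>: "junction_test \<phi> GL GR" "0 < fst z" "touches_above \<phi> (upper_env u) z"
    have "eventually (\<lambda>w. u w \<le> \<phi> w) (nhds z)"
      using eventually_env[OF \<phi>(2)] \<phi>(3) unfolding touches_above_def by (auto elim: eventually_elim2)
    then have "touches_below u \<phi> (fst z, snd z)" using \<phi>(3) at_z[OF \<phi>(2)] by (simp add: touches_above_def touches_below_def)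
    from residual_le_at_contact[OF \<phi>(1) test \<phi>(2) this, of Aplus] show "residual H1 H2 (F Aplus) GL GR z \<le> 0"
      using res[of z] by simp
  qed
  have super: "jsuper H1 H2 (F Aplus) (lower_env u)"
    unfolding jsuper_def
  proof (intro allI impI)
    fix \<phi> GL GR and z :: "real \<times> real"
    assume \<phi>: "junction_test \<phi> GL GR" "0 < fst z" "touches_below \<phi> (lower_env u) z"
    have "eventually (\<lambda>w. \<phi> w \<le> u w) (nhds z)"
      using eventually_env[OF \<phi>(2)] \<phi>(3) unfolding touches_below_def by (auto elim: eventually_elim2)
    then have "touches_below \<phi> u (fst z, snd z)" using \<phi>(3) at_z[OF \<phi>(2)] by (simp add: touches_below_def)
    from residual_le_at_contact[OF test \<phi>(1,2) this, of Aplus] show "0 \<le> residual H1 H2 (F Aplus) GL GR z"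
      using res[of z] by simp
  qed
  define L where "L = \<bar>l1\<bar> + \<bar>l2\<bar>"
  have g_lip: "\<bar>g x - g y\<bar> \<le> L * \<bar>x - y\<bar>" for x y
  proof -
    have "g x - g y = l1 * (min x 0 - min y 0) + l2 * (max x 0 - max y 0)"
      by (auto simp: g_def kink_def min_def max_def algebra_simps)
    moreover have "\<bar>l1 * (min x 0 - min y 0)\<bar> \<le> \<bar>l1\<bar> * \<bar>x - y\<bar>" "\<bar>l2 * (max x 0 - max y 0)\<bar> \<le> \<bar>l2\<bar> * \<bar>x - y\<bar>"
      unfolding abs_mult by (intro mult_left_mono; auto simp: min_def max_def)+
    ultimately show ?thesis unfolding L_def distrib_right by linarith
  qed
  have g_uc: "uniformly_continuous_on UNIV g"
    unfolding uniformly_continuous_on_def dist_real_def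
  proof (intro allI impI)
    fix e :: real assume e: "0 < e"
    have L: "0 < L + 1" by (simp add: L_def)
    have "\<bar>g y - g x\<bar> < e" if "\<bar>y - x\<bar> < e / (L + 1)" for x y
    proof -
      have "\<bar>g y - g x\<bar> \<le> L * \<bar>y - x\<bar>" by (rule g_lip)
      also have "\<dots> \<le> (L + 1) * \<bar>y - x\<bar>" by (intro mult_right_mono) auto
      also have "\<dots> < e" using that L by (simp add: pos_less_divide_eq mult.commute)
      finally show ?thesis .
    qed
    then show "\<exists>d>0. \<forall>x\<in>UNIV. \<forall>x'\<in>UNIV. \<bar>x' - x\<bar> < d \<longrightarrow> \<bar>g x' - g x\<bar> < e"
      using e L by (intro exI[of _ "e / (L + 1)"]) auto
  qed
  have growth: "linear_growth u"
    unfolding linear_growth_def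
  proof (intro allI impI)
    fix T :: real assume "0 < T"
    have "\<bar>u (t, x)\<bar> \<le> (\<bar>Aplus\<bar> * T + L) * (1 + \<bar>x\<bar>)" if "0 \<le> t \<and> t < T" for t x
    proof -
      have "\<bar>Aplus * t\<bar> \<le> \<bar>Aplus\<bar> * T" unfolding abs_mult using that by (intro mult_left_mono) auto
      moreover have "\<bar>g x\<bar> \<le> L * \<bar>x\<bar>" using g_lip[of x 0] by (simp add: g_def kink_def)
      moreover have "0 \<le> \<bar>Aplus\<bar> * T * \<bar>x\<bar>" "0 \<le> L" using \<open>0 < T\<close> by (auto simp: L_def)
      moreover have "(\<bar>Aplus\<bar> * T + L) * (1 + \<bar>x\<bar>) = \<bar>Aplus\<bar> * T + \<bar>Aplus\<bar> * T * \<bar>x\<bar> + L + L * \<bar>x\<bar>"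
        by (simp add: algebra_simps)
      ultimately show ?thesis unfolding u_def fst_conv snd_conv by linarith
    qed
    then show "\<exists>C. \<forall>t x. 0 \<le> t \<and> t < T \<longrightarrow> \<bar>u (t, x)\<bar> \<le> C * (1 + \<bar>x\<bar>)" by blast
  qed
  have "has_initial_datum u g" using env env' by (simp add: has_initial_datum_def u_def)
  then have sol: "junction_cauchy H1 H2 (F Aplus) g u"
    using lb sub super growth
    by (simp add: junction_cauchy_def junction_sol_def junction_subsol_iff junction_supersol_iff)
  have "\<exists>z\<in>half_plane. v z \<noteq> u z" if v: "junction_cauchy H1 H2 (F Aminus) g v" for v
  proof (rule ccontr)
    assume "\<not> ?thesis"
    then have eq: "v z = u z" if "z \<in> half_plane" for z using that by blast
    have lb_v: "locally_bounded v" and super_v: "jsuper H1 H2 (F Aminus) (lower_env v)"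
      using v by (auto simp: junction_cauchy_def junction_sol_def junction_supersol_iff)
    have env_v: "lower_env v z = u z" if "z \<in> half_plane" for z
      using lower_env_cong[OF lb_v lb that zero_less_one] eq env'[OF that] by simp
    have "touches_below u (lower_env v) (1, 0)"
      using eventually_nhds_half_plane[of 1 0] env_v by (auto simp: touches_below_def elim: eventually_mono)
    then have "0 \<le> residual H1 H2 (F Aminus) (\<lambda>z. (- Aplus, l1)) (\<lambda>z. (- Aplus, l2)) (1, 0)"
      using test super_v unfolding jsuper_def by (metis fst_conv zero_less_one)
    then show False using less FA'(2) by (simp add: residual_def)
  qed
  then show ?thesis using that g_uc sol by blast
qed

theorem extremal_solutions:
  assumes g: "uniformly_continuous_on UNIV g"
  shows "\<exists>u. is_the_only (junction_cauchy H1 H2 (F Aplus) g) u \<and> minimal_ishii H1 H2 g u"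
    and "\<exists>u. is_the_only (junction_cauchy H1 H2 (F Aminus) g) u \<and> maximal_ishii H1 H2 g u"
proof -
  obtain u where u: "junction_cauchy H1 H2 (F Aplus) g u" using perron[OF g] by blast
  then show "\<exists>u. is_the_only (junction_cauchy H1 H2 (F Aplus) g) u \<and> minimal_ishii H1 H2 g u"
    using junction_cauchy_unique[OF order_trans[OF A0_le_Aminus Aminus_le_Aplus] g u] Aplus_le_ishii[OF g _ u]
      junction_cauchy_imp_ishii_cauchy[OF Aminus_le_Aplus order_refl u]
    unfolding is_the_only_def minimal_ishii_def by blast
  obtain u where u: "junction_cauchy H1 H2 (F Aminus) g u" using perron[OF g] by blast
  then show "\<exists>u. is_the_only (junction_cauchy H1 H2 (F Aminus) g) u \<and> maximal_ishii H1 H2 g u"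
    using junction_cauchy_unique[OF A0_le_Aminus g u] ishii_le_Aminus[OF g _ u]
      junction_cauchy_imp_ishii_cauchy[OF order_refl Aminus_le_Aplus u]
    unfolding is_the_only_def maximal_ishii_def by blast
qed

theorem unique_iff:
  "(\<forall>g. uniformly_continuous_on UNIV g \<longrightarrow> (\<exists>u. is_the_only (ishii_cauchy H1 H2 g) u)) \<longleftrightarrow> Aplus = Aminus"
proof
  assume unique: "\<forall>g. uniformly_continuous_on UNIV g \<longrightarrow> (\<exists>u. is_the_only (ishii_cauchy H1 H2 g) u)"
  show "Aplus = Aminus"
  proof (rule ccontr)
    assume "Aplus \<noteq> Aminus"
    then obtain g u where g: "uniformly_continuous_on UNIV g" and u: "junction_cauchy H1 H2 (F Aplus) g u"
      and neq: "\<And>v. junction_cauchy H1 H2 (F Aminus) g v \<Longrightarrow> \<exists>z\<in>half_plane. v z \<noteq> u z"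
      using wedge_solution by blast
    obtain v where v: "junction_cauchy H1 H2 (F Aminus) g v" using perron[OF g] by blast
    have "ishii_cauchy H1 H2 g u" "ishii_cauchy H1 H2 g v"
      using junction_cauchy_imp_ishii_cauchy[OF Aminus_le_Aplus order_refl u]
        junction_cauchy_imp_ishii_cauchy[OF order_refl Aminus_le_Aplus v] .
    then have "v z = u z" if "z \<in> half_plane" for z
      using unique g that unfolding is_the_only_def by metis
    then show False using neq[OF v] by blast
  qed
next
  assume eq: "Aplus = Aminus"
  show "\<forall>g. uniformly_continuous_on UNIV g \<longrightarrow> (\<exists>u. is_the_only (ishii_cauchy H1 H2 g) u)"
  proof (intro allI impI)
    fix g :: "real \<Rightarrow> real" assume g: "uniformly_continuous_on UNIV g"
    obtain u where u: "junction_cauchy H1 H2 (F Aplus) g u" using perron[OF g] by blast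
    have "v z = u z" if "ishii_cauchy H1 H2 g v" "z \<in> half_plane" for v z
      using ishii_le_Aminus[OF g that(1) u[unfolded eq] that(2)] Aplus_le_ishii[OF g that(1) u that(2)] by simp
    then show "\<exists>u. is_the_only (ishii_cauchy H1 H2 g) u"
      using junction_cauchy_imp_ishii_cauchy[OF Aminus_le_Aplus order_refl u] unfolding is_the_only_def by blast
  qed
qed

end

theorem theorem7p3:
  fixes H1 H2 :: "real \<Rightarrow> real" and p1 p2 :: real
  assumes "continuous_on UNIV H1" and "continuous_on UNIV H2"
    and "quasi_convex H1" and "quasi_convex H2"
    and "coercive H1" and "coercive H2"
    and "turning_point H1 p1" and "turning_point H2 p2"
  defines "Aplus \<equiv> AI_plus H1 H2 p1 p2" and "Aminus \<equiv> AI_minus H1 H2 p1 p2"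
  shows
    "Aminus \<le> Aplus \<and>
     (\<forall>u. ishii_subsol H1 H2 u \<longrightarrow> junction_subsol H1 H2 (flux H1 H2 p1 p2 Aminus) u) \<and>
     (\<forall>u. ishii_supersol H1 H2 u \<longrightarrow> junction_supersol H1 H2 (flux H1 H2 p1 p2 Aplus) u) \<and>
     (\<forall>A\<in>{Aminus..Aplus}. \<forall>u. junction_sol H1 H2 (flux H1 H2 p1 p2 A) u \<longrightarrow> ishii_sol H1 H2 u) \<and>
     (\<forall>g. uniformly_continuous_on UNIV g \<longrightarrow>
        (\<exists>u. is_the_only (junction_cauchy H1 H2 (flux H1 H2 p1 p2 Aplus) g) u \<and>
             minimal_ishii H1 H2 g u) \<and>
        (\<exists>u. is_the_only (junction_cauchy H1 H2 (flux H1 H2 p1 p2 Aminus) g) u \<and>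
             maximal_ishii H1 H2 g u)) \<and>
     ((\<forall>g. uniformly_continuous_on UNIV g \<longrightarrow> (\<exists>u. is_the_only (ishii_cauchy H1 H2 g) u))
        \<longleftrightarrow> Aplus = Aminus)"
proof -
  interpret junction H1 H2 p1 p2
    using assms by unfold_locales auto
  have sols: "\<forall>A\<in>{AI_minus H1 H2 p1 p2..AI_plus H1 H2 p1 p2}. \<forall>u.
      junction_sol H1 H2 (flux H1 H2 p1 p2 A) u \<longrightarrow> ishii_sol H1 H2 u"
    by (intro ballI allI impI junction_sol_imp_ishii_sol) auto
  show ?thesis
    unfolding Aplus_def Aminus_def
    by (intro conjI allI impI Aminus_le_Aplus ishii_subsol_imp_junction_subsol
        ishii_supersol_imp_junction_supersol sols extremal_solutions unique_iff)
qed

end
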